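(* Let $(R,\mathfrak m)$ be a two-dimensional Cohen-Macaulay local ring with infinite residue field and let $I$ be an $\mathfrak m$-primary ideal. For a minimal reduction $J$ of $I$, if $r_J(I)<\rho(I)$, then $$\rho(I)\le r_J(I)-1+(e_2(I)-1)e_2(I)-e_3(I).$$
   Context: $\lambda(\cdot)$ denotes length. The Ratliff-Rush closure of an ideal $K$ is $\widetilde K=\bigcup_{k\ge1}(K^{k+1}:K^k)$; $\widetilde{I^n}$ is the Ratliff-Rush closure of $I^n$, and $I^0=\widetilde{I^0}=R$. The Ratliff-Rush index is $\rho(I)=\min\{n\ge 0: \widetilde{I^k}=I^k \text{ for all } k\ge n\}$. An ideal $J\subseteq I$ is a reduction of $I$ if $JI^n=I^{n+1}$ for some $n\ge0$; it is minimal if minimal under inclusion among reductions of $I$; $r_J(I)$ is the least $n\ge 0$ with $JI^n=I^{n+1}$. With $d=2$, write $\sum_{n\ge0}\lambda(I^n/I^{n+1})z^n=h_I(z)/(1-z)^2$ with $h_I\in\mathbb Z[z]$; for all $i\ge 0$ (including $i=3$) set $e_i(I)=h_I^{(i)}(1)/i!$. Equivalently, for $n\gg0$, $\sum_{j=0}^n\lambda(R/I^{j+1})=\sum_{j=0}^{3}(-1)^je_j(I)\binom{n+3-j}{3-j}$. *)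

theory Defs
  imports
    "HOL-Algebra.Module"
    "HOL-Algebra.QuotRing"
    "HOL-Algebra.Ideal_Product"
    "HOL-Algebra.Ring_Divisibility"
    "HOL-Computational_Algebra.Polynomial_FPS"
    "HOL-Library.Extended_Nat"
begin

section \<open>Cohen-Macaulay local rings\<close>

definition krull_dim :: "('a, 'b) ring_scheme \<Rightarrow> enat" where
  "krull_dim R = Sup {enat n | n. \<exists>P :: nat \<Rightarrow> 'a set.
     (\<forall>i\<le>n. primeideal (P i) R) \<and> (\<forall>i<n. P i \<subset> P (Suc i))}"

text \<open>The middle condition says that \<open>x\<^sub>i\<close> is a nonzerodivisor
  on \<open>R/(x\<^sub>0, \<dots>, x\<^bsub>i-1\<^esub>)\<close>.\<close>

definition regular_sequence :: "('a, 'b) ring_scheme \<Rightarrow> 'a list \<Rightarrow> bool" where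
  "regular_sequence R xs \<longleftrightarrow> set xs \<subseteq> carrier R \<and>
     (\<forall>i<length xs. \<forall>y\<in>carrier R.
        xs ! i \<otimes>\<^bsub>R\<^esub> y \<in> Idl\<^bsub>R\<^esub> (set (take i xs)) \<longrightarrow> y \<in> Idl\<^bsub>R\<^esub> (set (take i xs))) \<and>
     Idl\<^bsub>R\<^esub> (set xs) \<noteq> carrier R"

definition ring_depth :: "('a, 'b) ring_scheme \<Rightarrow> 'a set \<Rightarrow> enat" where
  "ring_depth R m = Sup {enat (length xs) | xs. regular_sequence R xs \<and> set xs \<subseteq> m}"

locale noetherian_local_ring = cring R + noetherian_ring R for R (structure) +
  fixes m :: "'a set"
  assumes maximalideal_m: "maximalideal m R"
    and maximalideal_unique: "maximalideal M R \<Longrightarrow> M = m"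

locale cohen_macaulay_local_ring = noetherian_local_ring +
  assumes depth_eq_dim: "ring_depth R m = krull_dim R"


section \<open>Ideals\<close>

definition ideal_radical :: "('a, 'b) ring_scheme \<Rightarrow> 'a set \<Rightarrow> 'a set" where
  "ideal_radical R Q = {x \<in> carrier R. \<exists>n::nat. x [^]\<^bsub>R\<^esub> n \<in> Q}"

definition primary_ideal :: "('a, 'b) ring_scheme \<Rightarrow> 'a set \<Rightarrow> bool" where
  "primary_ideal R Q \<longleftrightarrow> ideal Q R \<and> Q \<noteq> carrier R \<and>
     (\<forall>x\<in>carrier R. \<forall>y\<in>carrier R.
        x \<otimes>\<^bsub>R\<^esub> y \<in> Q \<longrightarrow> x \<in> Q \<or> (\<exists>n::nat. y [^]\<^bsub>R\<^esub> n \<in> Q))"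

text \<open>\<open>is_primary_to R P Q\<close>: the ideal \<open>Q\<close> is \<open>P\<close>-primary.\<close>

definition is_primary_to :: "('a, 'b) ring_scheme \<Rightarrow> 'a set \<Rightarrow> 'a set \<Rightarrow> bool" where
  "is_primary_to R P Q \<longleftrightarrow> primary_ideal R Q \<and> ideal_radical R Q = P"

text \<open>The unit of \<^const>\<open>ideals_set\<close> is the unit ideal, so \<open>I\<^sup>0 = R\<close>.\<close>

abbreviation ideal_pow :: "('a, 'b) ring_scheme \<Rightarrow> 'a set \<Rightarrow> nat \<Rightarrow> 'a set" where
  "ideal_pow R I n \<equiv> I [^]\<^bsub>ideals_set R\<^esub> n"

definition ideal_colon :: "('a, 'b) ring_scheme \<Rightarrow> 'a set \<Rightarrow> 'a set \<Rightarrow> 'a set" where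
  "ideal_colon R A B = {x \<in> carrier R. \<forall>y\<in>B. x \<otimes>\<^bsub>R\<^esub> y \<in> A}"

definition ratliff_rush_closure :: "('a, 'b) ring_scheme \<Rightarrow> 'a set \<Rightarrow> 'a set" where
  "ratliff_rush_closure R K =
     (\<Union>k\<in>{1..}. ideal_colon R (ideal_pow R K (k + 1)) (ideal_pow R K k))"

definition ratliff_rush_index :: "('a, 'b) ring_scheme \<Rightarrow> 'a set \<Rightarrow> nat" where
  "ratliff_rush_index R I =
     (LEAST n. \<forall>k\<ge>n. ratliff_rush_closure R (ideal_pow R I k) = ideal_pow R I k)"

definition is_reduction :: "('a, 'b) ring_scheme \<Rightarrow> 'a set \<Rightarrow> 'a set \<Rightarrow> bool" where
  "is_reduction R J I \<longleftrightarrow> ideal J R \<and> J \<subseteq> I \<and>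
     (\<exists>n. J \<cdot>\<^bsub>R\<^esub> ideal_pow R I n = ideal_pow R I (n + 1))"

definition is_minimal_reduction :: "('a, 'b) ring_scheme \<Rightarrow> 'a set \<Rightarrow> 'a set \<Rightarrow> bool" where
  "is_minimal_reduction R J I \<longleftrightarrow> is_reduction R J I \<and>
     (\<forall>J'. is_reduction R J' I \<longrightarrow> J' \<subseteq> J \<longrightarrow> J' = J)"

definition reduction_number :: "('a, 'b) ring_scheme \<Rightarrow> 'a set \<Rightarrow> 'a set \<Rightarrow> nat" where
  "reduction_number R J I = (LEAST n. J \<cdot>\<^bsub>R\<^esub> ideal_pow R I n = ideal_pow R I (n + 1))"


section \<open>Length and Hilbert coefficients\<close>

definition module_length ::
    "('a, 'b) ring_scheme \<Rightarrow> ('a, 'c, 'd) module_scheme \<Rightarrow> enat" where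
  "module_length R M = Sup {enat n | n. \<exists>N :: nat \<Rightarrow> 'c set.
     (\<forall>i\<le>n. submodule (N i) R M) \<and> (\<forall>i<n. N i \<subset> N (Suc i))}"

text \<open>The \<open>R\<close>-module \<open>A/B\<close> for ideals \<open>B \<subseteq> A\<close>. The fields \<open>mult\<close> and \<open>one\<close> are
  required by the record type but play no role in the module structure.\<close>

definition quotient_module ::
    "('a, 'b) ring_scheme \<Rightarrow> 'a set \<Rightarrow> 'a set \<Rightarrow> ('a, 'a set) module" where
  "quotient_module R A B =
     \<lparr>carrier = (\<lambda>x. B +>\<^bsub>R\<^esub> x) ` A, monoid.mult = rcoset_mult R B, one = B +>\<^bsub>R\<^esub> \<one>\<^bsub>R\<^esub>,
      zero = B, add = set_add R, module.smult = (\<lambda>a X. \<Union>x\<in>X. B +>\<^bsub>R\<^esub> (a \<otimes>\<^bsub>R\<^esub> x))\<rparr>"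

lemma (in cring) quotient_module_is_module:
  assumes A: "ideal A R" and B: "ideal B R" and "B \<subseteq> A"
  shows "module R (quotient_module R A B)"
proof -
  interpret A: ideal A R by fact
  interpret B: ideal B R by fact
  let ?M = "quotient_module R A B"
  have carr: "x \<in> carrier R" if "x \<in> A" for x
    using that by (rule A.a_Hcarr)
  have smult: "a \<odot>\<^bsub>?M\<^esub> (B +> x) = B +> (a \<otimes> x)" if "a \<in> carrier R" "x \<in> A" for a x
  proof -
    have x: "x \<in> carrier R" using that carr by blast
    have "B +> (a \<otimes> y) = B +> (a \<otimes> x)" if y: "y \<in> B +> x" for y
    proof -
      obtain b where b: "b \<in> B" "y = b \<oplus> x"
        using y by (auto simp: a_r_coset_def')
      have bc: "b \<in> carrier R" using b by (simp add: B.a_Hcarr)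
      have "a \<otimes> y = a \<otimes> b \<oplus> a \<otimes> x"
        using b bc x \<open>a \<in> carrier R\<close> by (simp add: r_distr)
      then have "a \<otimes> y \<in> B +> (a \<otimes> x)"
        using B.I_l_closed[OF b(1) \<open>a \<in> carrier R\<close>] unfolding a_r_coset_def' by auto
      then show ?thesis
        using B.a_repr_independence'[of "a \<otimes> y" "a \<otimes> x"] x \<open>a \<in> carrier R\<close> by simp
    qed
    moreover have "x \<in> B +> x" using x by (rule B.a_rcos_self)
    ultimately have "(\<Union>y\<in>B +> x. B +> (a \<otimes> y)) = B +> (a \<otimes> x)"
      by blast
    then show ?thesis
      by (simp add: quotient_module_def)
  qed
  have add: "(B +> x) \<oplus>\<^bsub>?M\<^esub> (B +> y) = B +> (x \<oplus> y)" if "x \<in> A" "y \<in> A" for x y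
    using that carr by (simp add: quotient_module_def B.a_rcos_sum)
  have zero: "\<zero>\<^bsub>?M\<^esub> = B +> \<zero>"
    by (simp add: quotient_module_def a_rcos_zero[OF B B.zero_closed])
  have carrier: "carrier ?M = (\<lambda>x. B +> x) ` A"
    by (simp add: quotient_module_def)
  have ab: "abelian_group ?M"
  proof (rule abelian_groupI)
    fix X assume "X \<in> carrier ?M"
    then obtain x where x: "x \<in> A" "X = B +> x" by (auto simp: carrier)
    have "(B +> (\<ominus> x)) \<oplus>\<^bsub>?M\<^esub> X = \<zero>\<^bsub>?M\<^esub>"
      using x carr by (simp add: add zero A.a_inv_closed l_neg)
    then show "\<exists>Y\<in>carrier ?M. Y \<oplus>\<^bsub>?M\<^esub> X = \<zero>\<^bsub>?M\<^esub>"
      using x by (auto simp: carrier A.a_inv_closed)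
  qed (auto simp: carrier add zero carr a_ac)
  show ?thesis
    by (rule moduleI[OF is_cring ab])
      (auto simp: carrier add smult carr A.I_l_closed l_distr r_distr m_assoc)
qed

text \<open>The numerator \<open>h\<^sub>I\<close> of the Hilbert series of an ideal \<open>I\<close> in dimension two:
  \<open>\<Sum>\<^sub>n \<lambda>(I\<^sup>n/I\<^bsup>n+1\<^esup>) z\<^sup>n = h\<^sub>I(z)/(1-z)\<^sup>2\<close>.\<close>

definition hilbert_numerator :: "('a, 'b) ring_scheme \<Rightarrow> 'a set \<Rightarrow> int poly" where
  "hilbert_numerator R I = (THE h. fps_of_poly h = (1 - fps_X)\<^sup>2 *
     Abs_fps (\<lambda>n. int (the_enat (module_length R
       (quotient_module R (ideal_pow R I n) (ideal_pow R I (n + 1)))))))"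

definition hilbert_coeff :: "('a, 'b) ring_scheme \<Rightarrow> 'a set \<Rightarrow> nat \<Rightarrow> rat" where
  "hilbert_coeff R I i = of_int (poly ((pderiv ^^ i) (hilbert_numerator R I)) 1) / fact i"

end

theory Submission
  imports Defs
begin

text \<open>
  Write \<open>F\<^sub>n\<close> for the Ratliff-Rush closure of \<open>I\<^sup>n\<close>, \<open>r\<close> for the reduction number,
  \<open>w\<^sub>n = \<lambda>(F\<^sub>n/I\<^sup>n)\<close> and \<open>v\<^sub>n = \<lambda>(F\<^bsub>n+1\<^esub>/JF\<^sub>n)\<close>. Suppose \<open>J = (x, y)\<close> and all relations between
  \<open>x\<close> and \<open>y\<close> are multiples of the trivial one. For every ideal \<open>A\<close> of finite colength this gives

    \<open>\<lambda>(R/JA) = \<lambda>(R/J) + 2\<lambda>(R/A) - \<lambda>(R/(A : J))\<close>   (\<open>colength_two_gen\<close>).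

  For \<open>A = F\<^sub>n\<close>, where \<open>F\<^sub>n : J = F\<^bsub>n-1\<^esub>\<close>, it says that the second difference of \<open>\<lambda>(R/F\<^sub>n)\<close> is
  \<open>\<lambda>(R/J)\<close> minus a term of \<open>v\<close>; for \<open>A = I\<^sup>n\<close> with \<open>n \<ge> r\<close>, where \<open>JI\<^sup>n = I\<^bsup>n+1\<^esup>\<close>, it says that the
  second difference of \<open>\<lambda>(R/I\<^sup>n)\<close> is at least \<open>\<lambda>(R/J)\<close>. Three things follow.

  The colength of \<open>I\<^sup>n\<close> is at most that of \<open>J\<^sup>n\<close>, hence at most \<open>\<lambda>(R/J) n(n+1)/2\<close>, so the excess of
  its second difference over \<open>\<lambda>(R/J)\<close> vanishes for large \<open>n\<close>. Then \<open>I\<^bsup>n+1\<^esup> : J = I\<^sup>n\<close> for large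
  \<open>n\<close>, which forces \<open>F\<^sub>n = I\<^sup>n\<close>, and \<open>v\<close> and \<open>w\<close> have finite support.

  Summing the second differences yields the numerator of the Hilbert series,
  \<open>h(z) = \<lambda>(R/J) - (1-z) \<Sum>v\<^sub>n z\<^sup>n + (1-z)\<^sup>3 \<Sum>w\<^bsub>n+1\<^esub> z\<^sup>n\<close>, so that \<open>e\<^sub>2 = \<Sum>n v\<^sub>n\<close> and
  \<open>e\<^sub>3 = \<Sum>(n choose 2) v\<^sub>n - \<Sum>w\<^sub>n\<close>. Every \<open>n\<close> with \<open>v\<^sub>n > 0\<close> is at most \<open>e\<^sub>2\<close>, whence
  \<open>\<Sum>(n choose 2) v\<^sub>n \<le> (e\<^sub>2 - 1)e\<^sub>2\<close> and \<open>(e\<^sub>2 - 1)e\<^sub>2 - e\<^sub>3 \<ge> \<Sum>w\<^sub>n\<close>.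

  The sequence \<open>w\<close> is convex from index \<open>r - 1\<close> on, nonnegative, and eventually zero. Once it
  vanishes at some \<open>n \<ge> r - 1\<close> it stays zero, so \<open>w\<^sub>n \<ge> 1\<close> for the \<open>\<rho>(I) - r + 1\<close> indices with
  \<open>r - 1 \<le> n < \<rho>(I)\<close>. Hence \<open>\<Sum>w\<^sub>n \<ge> \<rho>(I) - r + 1\<close>, which is the claim.

  It remains to find \<open>x\<close> and \<open>y\<close>. If a minimal reduction \<open>J\<close> needed three generators, then for an
  infinite residue field the powers of \<open>J\<close> would have so many independent generators that
  \<open>\<lambda>(R/J\<^sup>n)\<close> would grow cubically; but a regular sequence of length two in a ring of dimension
  two generates an ideal primary to the maximal ideal, and comparison with its powers bounds the
  growth by a quadratic function (\<open>minimal_reduction_two_gen\<close>). The same regular sequence shows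
  that the relations between \<open>x\<close> and \<open>y\<close> are trivial (\<open>koszul_syzygies_if_m_primary\<close>).
\<close>

section \<open>Heights of families of sets\<close>

text \<open>Krull dimension, length of a module and length of an interval of ideals are all heights of
  families of sets, so the comparison of chains can be done once, without any algebra.\<close>

definition strict_chain :: "'c set set \<Rightarrow> nat \<Rightarrow> (nat \<Rightarrow> 'c set) \<Rightarrow> bool" where
  "strict_chain \<A> n N \<longleftrightarrow> (\<forall>i\<le>n. N i \<in> \<A>) \<and> (\<forall>i<n. N i \<subset> N (Suc i))"

definition chain_height :: "'c set set \<Rightarrow> enat" where
  "chain_height \<A> = Sup {enat n | n. \<exists>N. strict_chain \<A> n N}"

lemma strict_chain_le: "strict_chain \<A> n N \<Longrightarrow> k \<le> n \<Longrightarrow> strict_chain \<A> k N"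
  by (auto simp: strict_chain_def)

lemma chain_height_leI:
  "(\<And>n N. strict_chain \<A> n N \<Longrightarrow> enat n \<le> h) \<Longrightarrow> chain_height \<A> \<le> h"
  unfolding chain_height_def by (rule Sup_least) auto

lemma chain_height_upper: "strict_chain \<A> n N \<Longrightarrow> enat n \<le> chain_height \<A>"
  unfolding chain_height_def by (rule Sup_upper) auto

lemma enat_le_chain_height_iff:
  assumes "A \<in> \<A>"
  shows "enat n \<le> chain_height \<A> \<longleftrightarrow> (\<exists>N. strict_chain \<A> n N)"
proof
  assume le: "enat n \<le> chain_height \<A>"
  show "\<exists>N. strict_chain \<A> n N"
  proof (rule ccontr)
    assume no: "\<nexists>N. strict_chain \<A> n N"
    have n: "n > 0"
      using no assms by (cases n) (auto simp: strict_chain_def)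
    have "enat k \<le> enat (n - 1)" if "strict_chain \<A> k N" for k N
      using no strict_chain_le[OF that, of n] by (metis enat_ord_simps(1) n not_less_eq_eq Suc_diff_1)
    then have "chain_height \<A> \<le> enat (n - 1)"
      by (rule chain_height_leI)
    then show False
      using le n by (metis enat_ord_simps(1) Suc_diff_1 not_less_eq_eq order_refl order_trans)
  qed
qed (auto intro: chain_height_upper)

lemma chain_height_mono_map:
  assumes "\<And>N. N \<in> \<A> \<Longrightarrow> f N \<in> \<B>"
    and "\<And>N N'. N \<in> \<A> \<Longrightarrow> N' \<in> \<A> \<Longrightarrow> N \<subset> N' \<Longrightarrow> f N \<subset> f N'"
  shows "chain_height \<A> \<le> chain_height \<B>"
proof (rule chain_height_leI)
  fix n N assume "strict_chain \<A> n N"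
  then have "strict_chain \<B> n (\<lambda>i. f (N i))"
    using assms by (auto simp: strict_chain_def)
  then show "enat n \<le> chain_height \<B>"
    by (rule chain_height_upper)
qed

lemma card_steps_Suc:
  "card {i. i < Suc n \<and> P i} = card {i. i < n \<and> P i} + (if P n then 1 else 0)"
proof -
  have "{i. i < Suc n \<and> P i} = {i. i < n \<and> P i} \<union> (if P n then {n} else {})"
    by (auto simp: less_Suc_eq)
  then show ?thesis
    by (auto simp: card_insert_if)
qed

text \<open>Dropping the repetitions of a weakly increasing sequence leaves a strict chain with the
  same last member.\<close>

lemma strict_chain_of_weak_chain:
  assumes "\<And>i. i \<le> n \<Longrightarrow> N i \<in> \<A>" and "\<And>i. i < n \<Longrightarrow> N i \<subseteq> N (Suc i)"
  shows "\<exists>M. strict_chain \<A> (card {i. i < n \<and> N i \<noteq> N (Suc i)}) M \<and>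
             M (card {i. i < n \<and> N i \<noteq> N (Suc i)}) = N n"
  using assms
proof (induction n)
  case 0
  then show ?case by (auto simp: strict_chain_def intro!: exI[of _ N])
next
  case (Suc n)
  let ?k = "card {i. i < n \<and> N i \<noteq> N (Suc i)}"
  obtain M where M: "strict_chain \<A> ?k M" "M ?k = N n"
    using Suc by force
  show ?case
  proof (cases "N n = N (Suc n)")
    case True
    then show ?thesis using M by (auto simp: card_steps_Suc)
  next
    case False
    then have "strict_chain \<A> (Suc ?k) (\<lambda>i. if i \<le> ?k then M i else N (Suc n))"
      using M Suc.prems by (auto simp: strict_chain_def le_Suc_eq less_Suc_eq)
    then show ?thesis using False
      by (auto simp: card_steps_Suc intro!: exI[of _ "\<lambda>i. if i \<le> ?k then M i else N (Suc n)"])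
  qed
qed

lemma weak_chain_le_height:
  assumes "\<And>i. i \<le> n \<Longrightarrow> N i \<in> \<A>" and "\<And>i. i < n \<Longrightarrow> N i \<subseteq> N (Suc i)"
  shows "enat (card {i. i < n \<and> N i \<noteq> N (Suc i)}) \<le> chain_height \<A>"
  using strict_chain_of_weak_chain[of n N \<A>, OF assms] chain_height_upper by blast

lemma enat_add_leI:
  assumes "\<And>n k. enat n \<le> x \<Longrightarrow> enat k \<le> y \<Longrightarrow> enat (n + k) \<le> z"
  shows "x + y \<le> z"
proof (cases x)
  case (enat n)
  then show ?thesis
  proof (cases y)
    case (enat k)
    then show ?thesis using \<open>x = enat n\<close> assms[of n k] by simp
  next
    case infinity
    have "enat k \<le> z" for k
      using assms[of 0 k] infinity by (simp add: zero_enat_def[symmetric])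
    then show ?thesis
      by (metis dual_order.refl enat_ile enat_ord_simps(1) not_less_eq_eq enat_ord_simps(3) not_infinity_eq)
  qed
next
  case infinity
  have "enat k \<le> z" for k
    using assms[of k 0] infinity by (simp add: zero_enat_def[symmetric])
  then show ?thesis
    by (metis dual_order.refl enat_ile enat_ord_simps(1) not_less_eq_eq enat_ord_simps(3) not_infinity_eq)
qed

section \<open>Ideal arithmetic\<close>

definition colon_elem :: "('a, 'b) ring_scheme \<Rightarrow> 'a set \<Rightarrow> 'a \<Rightarrow> 'a set" where
  "colon_elem R K z = {r \<in> carrier R. z \<otimes>\<^bsub>R\<^esub> r \<in> K}"

definition mult_plus :: "('a, 'b) ring_scheme \<Rightarrow> 'a \<Rightarrow> 'a set \<Rightarrow> 'a set \<Rightarrow> 'a set" where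
  "mult_plus R z P K = {z \<otimes>\<^bsub>R\<^esub> p \<oplus>\<^bsub>R\<^esub> k | p k. p \<in> P \<and> k \<in> K}"

context cring
begin

lemma ideal_carrier: "ideal A R \<Longrightarrow> a \<in> A \<Longrightarrow> a \<in> carrier R"
  by (rule ideal.Icarr)

lemma ideal_subset_carrier: "ideal A R \<Longrightarrow> A \<subseteq> carrier R"
  using ideal_carrier by blast

lemma ideal_zero: "ideal A R \<Longrightarrow> \<zero> \<in> A"
  by (simp add: additive_subgroup.zero_closed ideal.axioms(1))

lemma ideal_add: "ideal A R \<Longrightarrow> a \<in> A \<Longrightarrow> b \<in> A \<Longrightarrow> a \<oplus> b \<in> A"
  by (simp add: additive_subgroup.a_closed ideal.axioms(1))

lemma ideal_uminus: "ideal A R \<Longrightarrow> a \<in> A \<Longrightarrow> \<ominus> a \<in> A"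
  by (simp add: additive_subgroup.a_inv_closed ideal.axioms(1))

lemma ideal_minus: "ideal A R \<Longrightarrow> a \<in> A \<Longrightarrow> b \<in> A \<Longrightarrow> a \<ominus> b \<in> A"
  by (simp add: a_minus_def ideal_add ideal_uminus)

lemma ideal_mult: "ideal A R \<Longrightarrow> a \<in> A \<Longrightarrow> r \<in> carrier R \<Longrightarrow> r \<otimes> a \<in> A"
  by (rule ideal.I_l_closed)

lemma ideal_mult': "ideal A R \<Longrightarrow> a \<in> A \<Longrightarrow> r \<in> carrier R \<Longrightarrow> a \<otimes> r \<in> A"
  by (rule ideal.I_r_closed)

lemmas ideal_closed = ideal_carrier ideal_zero ideal_add ideal_uminus ideal_minus
  ideal_mult ideal_mult'

lemma ideal_add_cancel_left:
  assumes "ideal A R" "a \<in> A" "b \<in> carrier R" "a \<oplus> b \<in> A"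
  shows "b \<in> A"
proof -
  have "b = (a \<oplus> b) \<ominus> a"
    using assms ideal_carrier[OF assms(1,2)] by algebra
  then show ?thesis using ideal_minus[OF assms(1,4,2)] by simp
qed

lemma ideal_add_cancel_right:
  assumes "ideal A R" "a \<in> A" "b \<in> carrier R" "b \<oplus> a \<in> A"
  shows "b \<in> A"
  using assms ideal_add_cancel_left a_comm ideal_carrier by metis

lemma ideal_criterion:
  assumes "A \<subseteq> carrier R" "\<zero> \<in> A"
    and add: "\<And>a b. a \<in> A \<Longrightarrow> b \<in> A \<Longrightarrow> a \<oplus> b \<in> A"
    and mult: "\<And>r a. r \<in> carrier R \<Longrightarrow> a \<in> A \<Longrightarrow> r \<otimes> a \<in> A"
  shows "ideal A R"
proof (rule idealI)
  have "\<ominus> a \<in> A" if "a \<in> A" for a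
  proof -
    have "\<ominus> a = (\<ominus> \<one>) \<otimes> a" using that assms(1) by (simp add: l_minus subset_iff)
    then show ?thesis using mult[of "\<ominus> \<one>" a] that by simp
  qed
  then show "subgroup A (add_monoid R)"
    using assms by (auto simp: subgroup_def a_inv_def[symmetric])
  fix a x assume "a \<in> A" "x \<in> carrier R"
  then show "x \<otimes> a \<in> A" "a \<otimes> x \<in> A"
    using mult[of x a] assms(1) by (auto simp: m_comm subset_iff)
qed (rule ring_axioms)

lemma mult_plusI:
  "p \<in> P \<Longrightarrow> k \<in> K \<Longrightarrow> z \<otimes> p \<oplus> k \<in> mult_plus R z P K"
  by (auto simp: mult_plus_def)

lemma mult_plus_ideal:
  assumes P: "ideal P R" and K: "ideal K R" and z: "z \<in> carrier R"
  shows "ideal (mult_plus R z P K) R"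
proof (rule ideal_criterion)
  show "mult_plus R z P K \<subseteq> carrier R"
    using z ideal_carrier[OF P] ideal_carrier[OF K] by (auto simp: mult_plus_def)
  show "\<zero> \<in> mult_plus R z P K"
    using mult_plusI[OF ideal_zero[OF P] ideal_zero[OF K], of z] z by simp
next
  fix a b assume "a \<in> mult_plus R z P K" "b \<in> mult_plus R z P K"
  then obtain p k p' k' where *: "p \<in> P" "k \<in> K" "p' \<in> P" "k' \<in> K"
      "a = z \<otimes> p \<oplus> k" "b = z \<otimes> p' \<oplus> k'"
    by (auto simp: mult_plus_def)
  then have c: "p \<in> carrier R" "k \<in> carrier R" "p' \<in> carrier R" "k' \<in> carrier R"
    using ideal_carrier[OF P] ideal_carrier[OF K] by auto
  have "a \<oplus> b = z \<otimes> (p \<oplus> p') \<oplus> (k \<oplus> k')"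
    unfolding * using c z by algebra
  then show "a \<oplus> b \<in> mult_plus R z P K"
    using * by (simp add: mult_plusI ideal_add[OF P] ideal_add[OF K])
next
  fix r a assume r: "r \<in> carrier R" and "a \<in> mult_plus R z P K"
  then obtain p k where *: "p \<in> P" "k \<in> K" "a = z \<otimes> p \<oplus> k"
    by (auto simp: mult_plus_def)
  then have c: "p \<in> carrier R" "k \<in> carrier R"
    using ideal_carrier[OF P] ideal_carrier[OF K] by auto
  have "r \<otimes> a = z \<otimes> (r \<otimes> p) \<oplus> r \<otimes> k"
    unfolding * using c z r by algebra
  then show "r \<otimes> a \<in> mult_plus R z P K"
    using * r by (simp add: mult_plusI ideal_mult[OF P] ideal_mult[OF K])
qed

lemma subset_mult_plus:
  assumes "ideal P R" "ideal K R" "z \<in> carrier R"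
  shows "K \<subseteq> mult_plus R z P K"
proof
  fix k assume k: "k \<in> K"
  then have "z \<otimes> \<zero> \<oplus> k = k"
    using assms ideal_carrier[OF assms(2)] by simp
  then show "k \<in> mult_plus R z P K"
    using mult_plusI[OF ideal_zero[OF assms(1)] k, of z] by simp
qed

lemma mult_in_mult_plus:
  assumes "ideal P R" "ideal K R" "z \<in> carrier R" "p \<in> P"
  shows "z \<otimes> p \<in> mult_plus R z P K"
  using mult_plusI[OF assms(4) ideal_zero[OF assms(2)], of z] assms ideal_carrier[OF assms(1,4)]
  by simp

lemma mult_plus_subset:
  assumes "ideal A R" "K \<subseteq> A" "\<And>p. p \<in> P \<Longrightarrow> z \<otimes> p \<in> A"
  shows "mult_plus R z P K \<subseteq> A"
  using assms by (auto simp: mult_plus_def intro!: ideal_add[OF assms(1)])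

lemma mult_plus_mono: "P \<subseteq> P' \<Longrightarrow> K \<subseteq> K' \<Longrightarrow> mult_plus R z P K \<subseteq> mult_plus R z P' K'"
  by (auto simp: mult_plus_def)

lemma colon_elem_ideal:
  assumes K: "ideal K R" and z: "z \<in> carrier R"
  shows "ideal (colon_elem R K z) R"
  by (rule ideal_criterion)
    (use z in \<open>auto simp: colon_elem_def r_distr m_lcomm ideal_closed[OF K]\<close>)

lemma subset_colon_elem:
  assumes "ideal K R" "z \<in> carrier R"
  shows "K \<subseteq> colon_elem R K z"
  using assms by (auto simp: colon_elem_def ideal_closed[OF assms(1)])

lemma set_add_subset:
  assumes "ideal A R" "ideal B R"
  shows "A \<subseteq> A <+>\<^bsub>R\<^esub> B" "B \<subseteq> A <+>\<^bsub>R\<^esub> B"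
proof -
  have "a \<oplus> b \<in> A <+>\<^bsub>R\<^esub> B" if "a \<in> A" "b \<in> B" for a b
    using that by (auto simp: set_add_def')
  from this[of _ \<zero>] this[of \<zero>]
  have "a \<in> A \<Longrightarrow> a \<in> A <+>\<^bsub>R\<^esub> B" "b \<in> B \<Longrightarrow> b \<in> A <+>\<^bsub>R\<^esub> B" for a b
    using ideal_zero[OF assms(1)] ideal_zero[OF assms(2)]
      ideal_carrier[OF assms(1)] ideal_carrier[OF assms(2)] by fastforce+
  then show "A \<subseteq> A <+>\<^bsub>R\<^esub> B" "B \<subseteq> A <+>\<^bsub>R\<^esub> B"
    by auto
qed

text \<open>The modular law in the form of a comparison of two nested ideals.\<close>

lemma ideal_modular:
  assumes B: "ideal B R" and N: "ideal N R" and N': "ideal N' R" and "N \<subseteq> N'"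
    and int: "N \<inter> B = N' \<inter> B" and sum: "N <+>\<^bsub>R\<^esub> B = N' <+>\<^bsub>R\<^esub> B"
  shows "N = N'"
proof
  show "N' \<subseteq> N"
  proof
    fix t assume t: "t \<in> N'"
    then have "t \<in> N <+>\<^bsub>R\<^esub> B"
      using set_add_subset(1)[OF N' B] sum by auto
    then obtain u b where u: "u \<in> N" "b \<in> B" "t = u \<oplus> b"
      by (auto simp: set_add_def')
    have "b \<in> N'"
      using ideal_add_cancel_left[OF N', of u b] u t \<open>N \<subseteq> N'\<close> ideal_carrier[OF B] by auto
    then have "b \<in> N" using int u by auto
    then show "t \<in> N" using u ideal_add[OF N] by simp
  qed
qed (rule \<open>N \<subseteq> N'\<close>)

end

section \<open>Length of an interval of ideals\<close>

definition ideal_interval :: "('a, 'b) ring_scheme \<Rightarrow> 'a set \<Rightarrow> 'a set \<Rightarrow> 'a set set" where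
  "ideal_interval R B A = {N. ideal N R \<and> B \<subseteq> N \<and> N \<subseteq> A}"

definition interval_length :: "('a, 'b) ring_scheme \<Rightarrow> 'a set \<Rightarrow> 'a set \<Rightarrow> enat" where
  "interval_length R B A = chain_height (ideal_interval R B A)"

context cring
begin

lemma enat_le_interval_length_iff:
  assumes "ideal A R" "B \<subseteq> A"
  shows "enat n \<le> interval_length R B A \<longleftrightarrow> (\<exists>N. strict_chain (ideal_interval R B A) n N)"
  unfolding interval_length_def
  by (rule enat_le_chain_height_iff[of A]) (use assms in \<open>auto simp: ideal_interval_def\<close>)

text \<open>Concatenating chains gives one inequality. For the other, a chain \<open>N\<^sub>i\<close> from \<open>C\<close> to \<open>A\<close> is
  projected to the chains \<open>N\<^sub>i \<inter> B\<close> and \<open>N\<^sub>i + B\<close>; by the modular law every step of the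
  given chain stays strict in at least one of them.\<close>

lemma interval_length_additive:
  assumes A: "ideal A R" and B: "ideal B R" and C: "ideal C R" and "C \<subseteq> B" "B \<subseteq> A"
  shows "interval_length R C A = interval_length R C B + interval_length R B A"
proof (rule antisym)
  show "interval_length R C B + interval_length R B A \<le> interval_length R C A"
  proof (rule enat_add_leI)
    fix n k assume "enat n \<le> interval_length R C B" "enat k \<le> interval_length R B A"
    then obtain M N where M: "strict_chain (ideal_interval R C B) n M"
      and N: "strict_chain (ideal_interval R B A) k N"
      using assms by (auto simp: enat_le_interval_length_iff)
    have "strict_chain (ideal_interval R C A) (n + k) (\<lambda>i. if i \<le> n then M i else N (i - n))"
      unfolding strict_chain_def
    proof (intro conjI allI impI)
      fix i assume "i \<le> n + k"
      then show "(if i \<le> n then M i else N (i - n)) \<in> ideal_interval R C A"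
      proof (cases "i \<le> n")
        case True
        then have "M i \<in> ideal_interval R C B" using M by (simp add: strict_chain_def)
        then show ?thesis using True \<open>B \<subseteq> A\<close> by (auto simp: ideal_interval_def)
      next
        case False
        then have "N (i - n) \<in> ideal_interval R B A"
          using N \<open>i \<le> n + k\<close> by (simp add: strict_chain_def)
        then show ?thesis using False \<open>C \<subseteq> B\<close> by (auto simp: ideal_interval_def)
      qed
    next
      fix i assume i: "i < n + k"
      show "(if i \<le> n then M i else N (i - n))
          \<subset> (if Suc i \<le> n then M (Suc i) else N (Suc i - n))"
      proof -
        consider "i < n" | "i = n" | "i > n" by linarith
        then show ?thesis
        proof cases
          case 1
          then show ?thesis using M by (auto simp: strict_chain_def)
        next
          case 2
          then have "M n \<subseteq> B" "B \<subseteq> N 0" "N 0 \<subset> N (Suc 0)"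
            using M N i by (auto simp: strict_chain_def ideal_interval_def)
          then show ?thesis using 2 by auto
        next
          case 3
          then have "N (i - n) \<subset> N (Suc (i - n))"
            using N i by (auto simp: strict_chain_def)
          then show ?thesis using 3 by (auto simp: Suc_diff_le)
        qed
      qed
    qed
    then show "enat (n + k) \<le> interval_length R C A"
      unfolding interval_length_def by (rule chain_height_upper)
  qed
next
  show "interval_length R C A \<le> interval_length R C B + interval_length R B A"
    unfolding interval_length_def[of R C A]
  proof (rule chain_height_leI)
    fix n N assume N: "strict_chain (ideal_interval R C A) n N"
    then have idl: "ideal (N i) R" "C \<subseteq> N i" "N i \<subseteq> A" if "i \<le> n" for i
      using that by (auto simp: strict_chain_def ideal_interval_def)
    have step: "N i \<subset> N (Suc i)" if "i < n" for i
      using N that by (auto simp: strict_chain_def)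
    let ?S = "{i. i < n \<and> N i \<inter> B \<noteq> N (Suc i) \<inter> B}"
    let ?T = "{i. i < n \<and> N i <+>\<^bsub>R\<^esub> B \<noteq> N (Suc i) <+>\<^bsub>R\<^esub> B}"
    have "{..<n} \<subseteq> ?S \<union> ?T"
    proof
      fix i assume i: "i \<in> {..<n}"
      then show "i \<in> ?S \<union> ?T"
        using ideal_modular[OF B idl(1)[of i] idl(1)[of "Suc i"]] step[of i] by auto
    qed
    then have "card {..<n} \<le> card (?S \<union> ?T)"
      by (intro card_mono) auto
    then have "n \<le> card ?S + card ?T"
      using card_Un_le[of ?S ?T] by simp
    moreover have "enat (card ?S) \<le> interval_length R C B"
      unfolding interval_length_def
    proof (rule weak_chain_le_height)
      fix i assume "i \<le> n"
      then show "N i \<inter> B \<in> ideal_interval R C B"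
        using idl[of i] i_intersect[OF idl(1)[of i] B] \<open>C \<subseteq> B\<close> by (auto simp: ideal_interval_def)
    qed (use step in blast)
    moreover have "enat (card ?T) \<le> interval_length R B A"
      unfolding interval_length_def
    proof (rule weak_chain_le_height)
      fix i assume i: "i \<le> n"
      have "N i <+>\<^bsub>R\<^esub> B \<subseteq> A"
        using idl(3)[OF i] \<open>B \<subseteq> A\<close> ideal_add[OF A] by (auto simp: set_add_def')
      then show "N i <+>\<^bsub>R\<^esub> B \<in> ideal_interval R B A"
        using add_ideals[OF idl(1)[OF i] B] set_add_subset[OF idl(1)[OF i] B]
        by (auto simp: ideal_interval_def)
    next
      fix i assume "i < n"
      then show "N i <+>\<^bsub>R\<^esub> B \<subseteq> N (Suc i) <+>\<^bsub>R\<^esub> B"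
        using step[of i] by (auto simp: set_add_def')
    qed
    ultimately have "enat (card ?S) + enat (card ?T) \<le> interval_length R C B + interval_length R B A"
      by (intro add_mono)
    moreover have "enat n \<le> enat (card ?S) + enat (card ?T)"
      using \<open>n \<le> card ?S + card ?T\<close> by simp
    ultimately show "enat n \<le> interval_length R C B + interval_length R B A"
      by (meson order_trans)
  qed
qed

text \<open>Multiplication by \<open>z\<close> induces an isomorphism of \<open>P/((K : z) \<inter> P)\<close> onto
  \<open>(zP + K)/K\<close>. On the level of ideals it is the pair of strictly monotone maps
  \<open>N \<mapsto> (N : z) \<inter> P\<close> and \<open>N \<mapsto> zN + K\<close>. The case \<open>z = 1\<close> is the second isomorphism theorem.\<close>

lemma interval_length_mult_plus:
  assumes P: "ideal P R" and K: "ideal K R" and z: "z \<in> carrier R"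
  shows "interval_length R K (mult_plus R z P K) = interval_length R (colon_elem R K z \<inter> P) P"
    (is "interval_length R K ?A = interval_length R ?B P")
proof (rule antisym)
  have cP: "p \<in> carrier R" if "p \<in> P" for p using ideal_carrier[OF P that] .
  have cK: "p \<in> carrier R" if "p \<in> K" for p using ideal_carrier[OF K that] .
  show "interval_length R K ?A \<le> interval_length R ?B P"
    unfolding interval_length_def
  proof (rule chain_height_mono_map[where f = "\<lambda>N. colon_elem R N z \<inter> P"])
    fix N assume "N \<in> ideal_interval R K ?A"
    then show "colon_elem R N z \<inter> P \<in> ideal_interval R ?B P"
      using i_intersect[OF colon_elem_ideal[OF _ z, of N] P]
      by (auto simp: ideal_interval_def colon_elem_def)
  next
    fix N N' assume N: "N \<in> ideal_interval R K ?A" "N' \<in> ideal_interval R K ?A" "N \<subset> N'"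
    then obtain t where t: "t \<in> N'" "t \<notin> N" by auto
    then have "t \<in> ?A"
      using N by (auto simp: ideal_interval_def)
    then obtain p k where pk: "p \<in> P" "k \<in> K" "t = z \<otimes> p \<oplus> k"
      by (auto simp: mult_plus_def)
    have "k \<in> N" "k \<in> N'" and idl: "ideal N R" "ideal N' R"
      using N pk by (auto simp: ideal_interval_def)
    then have "z \<otimes> p \<in> N'" "z \<otimes> p \<notin> N"
      using ideal_add_cancel_right[of N' k "z \<otimes> p"] ideal_add[of N "z \<otimes> p" k] t pk z cP by auto
    then show "colon_elem R N z \<inter> P \<subset> colon_elem R N' z \<inter> P"
      using N(3) pk(1) cP by (auto simp: colon_elem_def)
  qed
  show "interval_length R ?B P \<le> interval_length R K ?A"
    unfolding interval_length_def
  proof (rule chain_height_mono_map[where f = "\<lambda>N. mult_plus R z N K"])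
    fix N assume "N \<in> ideal_interval R ?B P"
    then show "mult_plus R z N K \<in> ideal_interval R K ?A"
      using mult_plus_ideal[OF _ K z, of N] subset_mult_plus[OF _ K z, of N]
        mult_plus_mono[of N P K K z]
      by (auto simp: ideal_interval_def)
  next
    fix N N' assume N: "N \<in> ideal_interval R ?B P" "N' \<in> ideal_interval R ?B P" "N \<subset> N'"
    then have idl: "ideal N R" "ideal N' R" by (auto simp: ideal_interval_def)
    obtain t where t: "t \<in> N'" "t \<notin> N" using N by auto
    have tP: "t \<in> P" using t N by (auto simp: ideal_interval_def)
    have "z \<otimes> t \<notin> mult_plus R z N K"
    proof
      assume "z \<otimes> t \<in> mult_plus R z N K"
      then obtain p k where pk: "p \<in> N" "k \<in> K" "z \<otimes> t = z \<otimes> p \<oplus> k"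
        by (auto simp: mult_plus_def)
      have c: "t \<in> carrier R" "p \<in> carrier R" "k \<in> carrier R"
        using tP cP cK pk ideal_carrier[OF idl(1)] by auto
      have "z \<otimes> (t \<ominus> p) = z \<otimes> t \<ominus> z \<otimes> p"
        using c z by algebra
      also have "\<dots> = k"
        unfolding pk(3) using c z by algebra
      finally have "z \<otimes> (t \<ominus> p) \<in> K"
        using pk by simp
      moreover have "p \<in> P" using pk N by (auto simp: ideal_interval_def)
      ultimately have "t \<ominus> p \<in> ?B"
        using tP c ideal_minus[OF P] by (auto simp: colon_elem_def)
      then have "t \<ominus> p \<in> N" using N by (auto simp: ideal_interval_def)
      then have "(t \<ominus> p) \<oplus> p \<in> N" using pk ideal_add[OF idl(1)] by simp
      moreover have "(t \<ominus> p) \<oplus> p = t" using c by algebra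
      ultimately show False using t by simp
    qed
    then show "mult_plus R z N K \<subset> mult_plus R z N' K"
      using mult_in_mult_plus[OF idl(2) K z t(1)] mult_plus_mono[of N N' K K z] N by auto
  qed
qed

lemma interval_length_eq_0_iff:
  assumes "ideal A R" "ideal B R" "B \<subseteq> A"
  shows "interval_length R B A = 0 \<longleftrightarrow> A = B"
proof
  assume 0: "interval_length R B A = 0"
  show "A = B"
  proof (rule ccontr)
    assume "A \<noteq> B"
    then have "strict_chain (ideal_interval R B A) 1 (\<lambda>i. if i = 0 then B else A)"
      using assms by (auto simp: strict_chain_def ideal_interval_def)
    then have "enat 1 \<le> interval_length R B A"
      unfolding interval_length_def by (rule chain_height_upper)
    then show False using 0 by (simp add: zero_enat_def)
  qed
next
  assume "A = B"
  have "interval_length R A A \<le> enat 0"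
    unfolding interval_length_def
  proof (rule chain_height_leI)
    fix n N assume N: "strict_chain (ideal_interval R A A) n N"
    have "\<not> 0 < n"
    proof
      assume "0 < n"
      then have "N 0 \<in> ideal_interval R A A" "N 1 \<in> ideal_interval R A A" "N 0 \<subset> N 1"
        using N by (simp_all add: strict_chain_def)
      then have "N 0 = A" "N 1 = A" "N 0 \<subset> N 1"
        by (auto simp: ideal_interval_def)
      then show False by simp
    qed
    then show "enat n \<le> enat 0" by simp
  qed
  then show "interval_length R B A = 0"
    using \<open>A = B\<close> by (simp add: zero_enat_def[symmetric])
qed

end

section \<open>Colength\<close>

definition colength :: "('a, 'b) ring_scheme \<Rightarrow> 'a set \<Rightarrow> nat" where
  "colength R A = the_enat (interval_length R A (carrier R))"

definition finite_colength :: "('a, 'b) ring_scheme \<Rightarrow> 'a set \<Rightarrow> bool" where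
  "finite_colength R A \<longleftrightarrow> ideal A R \<and> interval_length R A (carrier R) \<noteq> \<infinity>"

context cring
begin

lemma finite_colength_ideal: "finite_colength R A \<Longrightarrow> ideal A R"
  by (simp add: finite_colength_def)

lemma interval_length_carrier:
  "finite_colength R A \<Longrightarrow> interval_length R A (carrier R) = enat (colength R A)"
  by (auto simp: finite_colength_def colength_def)

lemma colength_carrier: "colength R (carrier R) = 0"
  using interval_length_eq_0_iff[OF oneideal oneideal] by (simp add: colength_def zero_enat_def)

lemma finite_colength_carrier: "finite_colength R (carrier R)"
  using interval_length_eq_0_iff[OF oneideal oneideal] oneideal by (simp add: finite_colength_def)

lemma finite_colength_superset:
  assumes B: "finite_colength R B" and A: "ideal A R" and "B \<subseteq> A"
  shows "finite_colength R A"
  using interval_length_additive[OF oneideal A finite_colength_ideal[OF B] \<open>B \<subseteq> A\<close>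
      ideal_subset_carrier[OF A]] interval_length_carrier[OF B] A
  by (cases "interval_length R A (carrier R)") (auto simp: finite_colength_def)

lemma interval_length_finite_colength:
  assumes B: "finite_colength R B" and A: "ideal A R" and "B \<subseteq> A"
  shows "enat (colength R B) = interval_length R B A + enat (colength R A)"
  using interval_length_additive[OF oneideal A finite_colength_ideal[OF B] \<open>B \<subseteq> A\<close>
      ideal_subset_carrier[OF A]] interval_length_carrier[OF B]
    interval_length_carrier[OF finite_colength_superset[OF assms]] by simp

lemma interval_length_eq_colength_diff:
  assumes B: "finite_colength R B" and A: "ideal A R" and "B \<subseteq> A"
  shows "interval_length R B A = enat (colength R B - colength R A)"
  using interval_length_finite_colength[OF assms]
  by (cases "interval_length R B A") auto

lemma colength_antimono:
  assumes B: "finite_colength R B" and A: "ideal A R" and "B \<subseteq> A"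
  shows "colength R A \<le> colength R B"
  using interval_length_finite_colength[OF assms]
  by (cases "interval_length R B A") auto

lemma colength_eq_imp_eq:
  assumes B: "finite_colength R B" and A: "ideal A R" and "B \<subseteq> A"
    and "colength R B \<le> colength R A"
  shows "A = B"
  using interval_length_eq_colength_diff[OF assms(1-3)]
    interval_length_eq_0_iff[OF A finite_colength_ideal[OF B] \<open>B \<subseteq> A\<close>] assms(4)
  by (simp add: zero_enat_def)

text \<open>The isomorphism of \<open>P/((K : z) \<inter> P)\<close> onto \<open>(zP + K)/K\<close>, written without differences so that
  such identities can simply be added up.\<close>

lemma colength_mult_plus:
  assumes K: "finite_colength R K" and P: "finite_colength R P" and z: "z \<in> carrier R"
  shows "colength R K + colength R P =
    colength R (mult_plus R z P K) + colength R (colon_elem R K z \<inter> P)"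
    and "finite_colength R (mult_plus R z P K)"
    and "finite_colength R (colon_elem R K z \<inter> P)"
proof -
  note iK = finite_colength_ideal[OF K] and iP = finite_colength_ideal[OF P]
  have iB: "ideal (colon_elem R K z \<inter> P) R"
    by (intro i_intersect colon_elem_ideal iK iP z)
  have iA: "ideal (mult_plus R z P K) R"
    by (intro mult_plus_ideal iK iP z)
  have KP: "finite_colength R (K \<inter> P)"
  proof -
    have "mult_plus R \<one> P K \<subseteq> carrier R" "ideal (mult_plus R \<one> P K) R"
      using mult_plus_ideal[OF iP iK one_closed] ideal_subset_carrier by auto
    have eq: "colon_elem R K \<one> \<inter> P = K \<inter> P"
      using ideal_carrier[OF iP] by (auto simp: colon_elem_def)
    have "interval_length R (K \<inter> P) P = interval_length R K (mult_plus R \<one> P K)"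
      using interval_length_mult_plus[OF iP iK one_closed] eq by simp
    also have "\<dots> \<noteq> \<infinity>"
      using interval_length_finite_colength[OF K mult_plus_ideal[OF iP iK one_closed]
          subset_mult_plus[OF iP iK one_closed]]
      by (cases "interval_length R K (mult_plus R \<one> P K)") auto
    finally have "interval_length R (K \<inter> P) P \<noteq> \<infinity>" .
    then show ?thesis
      using interval_length_additive[OF oneideal iP i_intersect[OF iK iP] _
          ideal_subset_carrier[OF iP]] interval_length_carrier[OF P] i_intersect[OF iK iP]
      by (auto simp: finite_colength_def)
  qed
  show fB: "finite_colength R (colon_elem R K z \<inter> P)"
    by (rule finite_colength_superset[OF KP iB]) (use subset_colon_elem[OF iK z] in blast)
  show "finite_colength R (mult_plus R z P K)"
    by (rule finite_colength_superset[OF K iA subset_mult_plus[OF iP iK z]])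
  have "enat (colength R K) = interval_length R K (mult_plus R z P K)
      + enat (colength R (mult_plus R z P K))"
    by (rule interval_length_finite_colength[OF K iA subset_mult_plus[OF iP iK z]])
  moreover have "enat (colength R (colon_elem R K z \<inter> P)) =
      interval_length R (colon_elem R K z \<inter> P) P + enat (colength R P)"
    by (rule interval_length_finite_colength[OF fB iP]) simp
  ultimately show "colength R K + colength R P =
    colength R (mult_plus R z P K) + colength R (colon_elem R K z \<inter> P)"
    unfolding interval_length_mult_plus[OF iP iK z]
    by (cases "interval_length R (colon_elem R K z \<inter> P) P") simp_all
qed

lemma colength_mult_plus_carrier:
  assumes K: "finite_colength R K" and z: "z \<in> carrier R"
  shows "colength R K = colength R (mult_plus R z (carrier R) K) + colength R (colon_elem R K z)"
    and "finite_colength R (colon_elem R K z)"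
proof -
  have "colon_elem R K z \<inter> carrier R = colon_elem R K z"
    by (auto simp: colon_elem_def)
  then show "colength R K = colength R (mult_plus R z (carrier R) K) + colength R (colon_elem R K z)"
    and "finite_colength R (colon_elem R K z)"
    using colength_mult_plus[OF K finite_colength_carrier z] by (simp_all add: colength_carrier)
qed

end

section \<open>Length of a quotient of ideals\<close>

context cring
begin

lemma quotient_module_smult:
  assumes A: "ideal A R" and B: "ideal B R" and a: "a \<in> carrier R" and x: "x \<in> carrier R"
  shows "a \<odot>\<^bsub>quotient_module R A B\<^esub> (B +> x) = B +> (a \<otimes> x)"
proof -
  interpret B: ideal B R by fact
  have "B +> (a \<otimes> y) = B +> (a \<otimes> x)" if y: "y \<in> B +> x" for y
  proof -
    obtain b where b: "b \<in> B" "y = b \<oplus> x"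
      using y by (auto simp: a_r_coset_def')
    have "a \<otimes> y = a \<otimes> b \<oplus> a \<otimes> x"
      using b B.Icarr[OF b(1)] x a by (simp add: r_distr)
    then have "a \<otimes> y \<in> B +> (a \<otimes> x)"
      using B.I_l_closed[OF b(1) a] unfolding a_r_coset_def' by auto
    then show ?thesis
      using B.a_repr_independence'[of "a \<otimes> y" "a \<otimes> x"] x a by simp
  qed
  moreover have "x \<in> B +> x" using x by (rule B.a_rcos_self)
  ultimately have "(\<Union>y\<in>B +> x. B +> (a \<otimes> y)) = B +> (a \<otimes> x)"
    by blast
  then show ?thesis
    by (simp add: quotient_module_def)
qed

text \<open>The submodules of \<open>A/B\<close> are the images of the ideals between \<open>B\<close> and \<open>A\<close>.\<close>

lemma module_length_quotient_module:
  assumes A: "ideal A R" and B: "ideal B R" and BA: "B \<subseteq> A"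
  shows "module_length R (quotient_module R A B) = interval_length R B A"
proof -
  let ?M = "quotient_module R A B"
  interpret B: ideal B R by fact
  interpret M: module R ?M using A B BA by (rule quotient_module_is_module)
  have cA: "x \<in> carrier R" if "x \<in> A" for x using ideal_carrier[OF A that] .
  have carrier: "carrier ?M = (\<lambda>x. B +> x) ` A"
    by (simp add: quotient_module_def)
  have add: "(B +> x) \<oplus>\<^bsub>?M\<^esub> (B +> y) = B +> (x \<oplus> y)" if "x \<in> A" "y \<in> A" for x y
    using that cA by (simp add: quotient_module_def B.a_rcos_sum)
  have zero: "\<zero>\<^bsub>?M\<^esub> = B +> \<zero>"
    by (simp add: quotient_module_def a_rcos_zero[OF B ideal_zero[OF B]])
  have coset_eq: "B +> x = B +> y \<longleftrightarrow> x \<ominus> y \<in> B" if "x \<in> carrier R" "y \<in> carrier R" for x y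
    using quotient_eq_iff_same_a_r_cos[OF B that] by simp
  have "module_length R ?M = chain_height {N. submodule N R ?M}"
    by (simp add: module_length_def chain_height_def strict_chain_def)
  also have "\<dots> = interval_length R B A"
    unfolding interval_length_def
  proof (rule antisym)
    show "chain_height {N. submodule N R ?M} \<le> chain_height (ideal_interval R B A)"
    proof (rule chain_height_mono_map[where f = "\<lambda>N. {a \<in> A. B +> a \<in> N}"])
      fix N assume "N \<in> {N. submodule N R ?M}"
      then interpret N: submodule N R ?M by simp
      have z: "B +> \<zero> \<in> N"
        using N.one_closed zero by simp
      have "ideal {a \<in> A. B +> a \<in> N} R"
      proof (rule ideal_criterion)
        fix a b assume "a \<in> {a \<in> A. B +> a \<in> N}" "b \<in> {a \<in> A. B +> a \<in> N}"
        then show "a \<oplus> b \<in> {a \<in> A. B +> a \<in> N}"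
          using N.m_closed[of "B +> a" "B +> b"] add ideal_add[OF A] by simp
      next
        fix r a assume "r \<in> carrier R" "a \<in> {a \<in> A. B +> a \<in> N}"
        then show "r \<otimes> a \<in> {a \<in> A. B +> a \<in> N}"
          using N.smult_closed[of r "B +> a"] quotient_module_smult[OF A B, of r a] cA
            ideal_mult[OF A] by simp
      qed (use z cA ideal_zero[OF A] in auto)
      moreover have "B +> b \<in> N" if "b \<in> B" for b
      proof -
        have "B +> b = B +> \<zero>"
          using coset_eq[of b \<zero>] that B.Icarr[OF that] by (simp add: a_minus_def)
        then show ?thesis using z by simp
      qed
      ultimately show "{a \<in> A. B +> a \<in> N} \<in> ideal_interval R B A"
        using BA z by (auto simp: ideal_interval_def)
    next
      fix N N' assume N: "N \<in> {N. submodule N R ?M}" "N' \<in> {N. submodule N R ?M}" "N \<subset> N'"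
      then interpret N': submodule N' R ?M by simp
      obtain X where X: "X \<in> N'" "X \<notin> N" using N by auto
      then obtain x where "x \<in> A" "X = B +> x"
        using N'.subset carrier by auto
      then show "{a \<in> A. B +> a \<in> N} \<subset> {a \<in> A. B +> a \<in> N'}"
        using X N(3) by auto
    qed
    show "chain_height (ideal_interval R B A) \<le> chain_height {N. submodule N R ?M}"
    proof (rule chain_height_mono_map[where f = "\<lambda>N. (\<lambda>x. B +> x) ` N"])
      fix N assume "N \<in> ideal_interval R B A"
      then have N: "ideal N R" "B \<subseteq> N" "N \<subseteq> A" by (auto simp: ideal_interval_def)
      have "submodule ((\<lambda>x. B +> x) ` N) R ?M"
      proof (rule M.submoduleI)
        show "(\<lambda>x. B +> x) ` N \<subseteq> carrier ?M"
          using N carrier by auto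
        show "\<zero>\<^bsub>?M\<^esub> \<in> (\<lambda>x. B +> x) ` N"
          using ideal_zero[OF N(1)] zero by auto
      next
        fix X assume "X \<in> (\<lambda>x. B +> x) ` N"
        then obtain n where n: "n \<in> N" "X = B +> n" by auto
        then have "\<ominus>\<^bsub>?M\<^esub> X = (\<ominus> \<one>) \<odot>\<^bsub>?M\<^esub> X"
          using M.smult_l_minus[of \<one> X] N(3) carrier by auto
        also have "\<dots> = B +> (\<ominus> n)"
          using n quotient_module_smult[OF A B, of "\<ominus> \<one>" n] ideal_carrier[OF N(1)]
          by (simp add: l_minus)
        finally show "\<ominus>\<^bsub>?M\<^esub> X \<in> (\<lambda>x. B +> x) ` N"
          using ideal_uminus[OF N(1) n(1)] by auto
      next
        fix X Y assume "X \<in> (\<lambda>x. B +> x) ` N" "Y \<in> (\<lambda>x. B +> x) ` N"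
        then show "X \<oplus>\<^bsub>?M\<^esub> Y \<in> (\<lambda>x. B +> x) ` N"
          using add N(3) ideal_add[OF N(1)] by (auto simp: subset_iff)
      next
        fix a X assume "a \<in> carrier R" "X \<in> (\<lambda>x. B +> x) ` N"
        then show "a \<odot>\<^bsub>?M\<^esub> X \<in> (\<lambda>x. B +> x) ` N"
          using quotient_module_smult[OF A B] ideal_carrier[OF N(1)] ideal_mult[OF N(1)] by auto
      qed
      then show "(\<lambda>x. B +> x) ` N \<in> {N. submodule N R ?M}" by simp
    next
      fix N N' assume "N \<in> ideal_interval R B A" "N' \<in> ideal_interval R B A" and lt: "N \<subset> N'"
      then have N: "ideal N R" "B \<subseteq> N" "ideal N' R" by (auto simp: ideal_interval_def)
      obtain t where t: "t \<in> N'" "t \<notin> N" using lt by auto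
      have "B +> t \<notin> (\<lambda>x. B +> x) ` N"
      proof
        assume "B +> t \<in> (\<lambda>x. B +> x) ` N"
        then obtain n where n: "n \<in> N" "B +> t = B +> n" by auto
        have c: "t \<in> carrier R" "n \<in> carrier R"
          using t n ideal_carrier[OF N(1)] ideal_carrier[OF N(3)] by auto
        then have "t \<ominus> n \<in> N" using n coset_eq N(2) by auto
        then have "(t \<ominus> n) \<oplus> n \<in> N" using n ideal_add[OF N(1)] by simp
        moreover have "(t \<ominus> n) \<oplus> n = t" using c by algebra
        ultimately show False using t by simp
      qed
      then show "(\<lambda>x. B +> x) ` N \<subset> (\<lambda>x. B +> x) ` N'"
        using lt t by blast
    qed
  qed
  finally show ?thesis .
qed

end

section \<open>Powers of an ideal\<close>

(* These rules rewrite powers in every monoid, and would turn the zeroth power of an ideal into the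
   unit of the monoid of ideals instead of the carrier of R. The instances for R itself stay. *)
declare Group.nat_pow_0 [simp del] Group.nat_pow_Suc [simp del]

context cring
begin

lemma ideals_set_simps:
  "carrier (ideals_set R) = {A. ideal A R}" "\<one>\<^bsub>ideals_set R\<^esub> = carrier R"
  "A \<otimes>\<^bsub>ideals_set R\<^esub> B = A \<cdot> B"
  by (simp_all add: ideals_set_def)

lemmas ideals_monoid = comm_monoid.axioms(1)[OF ideals_set_is_comm_monoid]

lemma ideal_prod_mono: "A \<subseteq> A' \<Longrightarrow> B \<subseteq> B' \<Longrightarrow> A \<cdot> B \<subseteq> A' \<cdot> B'"
proof
  fix x assume "A \<subseteq> A'" "B \<subseteq> B'" "x \<in> A \<cdot> B"
  from this(3,1,2) show "x \<in> A' \<cdot> B'"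
    by (induction rule: ideal_prod.induct) (auto intro: ideal_prod.intros)
qed

lemma ideal_prod_least:
  assumes "ideal C R" "\<And>a b. a \<in> A \<Longrightarrow> b \<in> B \<Longrightarrow> a \<otimes> b \<in> C"
  shows "A \<cdot> B \<subseteq> C"
proof
  fix x assume "x \<in> A \<cdot> B"
  then show "x \<in> C"
    by (induction rule: ideal_prod.induct) (auto intro: assms ideal_add)
qed

lemma ideal_prod_subset:
  assumes "ideal A R" "ideal B R"
  shows "A \<cdot> B \<subseteq> A" "A \<cdot> B \<subseteq> B"
  using ideal_prod_inter[OF assms] by auto

lemma ideal_pow_ideal: "ideal A R \<Longrightarrow> ideal (ideal_pow R A n) R"
  using monoid.nat_pow_closed[OF ideals_monoid, of A n] by (simp add: ideals_set_simps)

lemma ideal_pow_0 [simp]: "ideal_pow R A 0 = carrier R"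
  by (simp add: Group.nat_pow_0 ideals_set_simps)

lemma ideal_pow_add:
  "ideal A R \<Longrightarrow> ideal_pow R A (n + k) = ideal_pow R A n \<cdot> ideal_pow R A k"
  using monoid.nat_pow_mult[OF ideals_monoid, of A n k] by (simp add: ideals_set_simps)

lemma ideal_pow_1: "ideal A R \<Longrightarrow> ideal_pow R A (Suc 0) = A"
  using monoid.nat_pow_eone[OF ideals_monoid, of A] by (simp add: ideals_set_simps)

lemma ideal_pow_Suc: "ideal A R \<Longrightarrow> ideal_pow R A (Suc n) = A \<cdot> ideal_pow R A n"
  using ideal_pow_add[of A 1 n] ideal_pow_1[of A] by simp

lemma ideal_pow_pow:
  "ideal A R \<Longrightarrow> ideal_pow R (ideal_pow R A n) k = ideal_pow R A (n * k)"
  using monoid.nat_pow_pow[OF ideals_monoid, of A n k] by (simp add: ideals_set_simps)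

lemma ideal_pow_antimono: "ideal A R \<Longrightarrow> n \<le> k \<Longrightarrow> ideal_pow R A k \<subseteq> ideal_pow R A n"
  using ideal_pow_add[of A n "k - n"] ideal_prod_subset(1)[OF ideal_pow_ideal ideal_pow_ideal]
  by simp

lemma ideal_pow_mono:
  assumes "ideal A R" "ideal B R" "A \<subseteq> B"
  shows "ideal_pow R A n \<subseteq> ideal_pow R B n"
proof (induction n)
  case (Suc n)
  then show ?case
    using ideal_pow_Suc[OF assms(1)] ideal_pow_Suc[OF assms(2)] ideal_prod_mono[OF assms(3)]
    by simp
qed (simp add: ideal_pow_0)

lemma elem_pow_in_ideal_pow:
  assumes "ideal A R" "a \<in> A"
  shows "a [^] n \<in> ideal_pow R A n"
proof (induction n)
  case (Suc n)
  have "a \<otimes> a [^] n \<in> A \<cdot> ideal_pow R A n"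
    using assms Suc by (intro ideal_prod.prod)
  then show ?case
    using ideal_pow_Suc[OF assms(1)] ideal_carrier[OF assms] by (simp add: m_comm)
qed (simp add: ideal_pow_0)

end

section \<open>Ideals with two generators\<close>

definition two_gen :: "('a, 'b) ring_scheme \<Rightarrow> 'a \<Rightarrow> 'a \<Rightarrow> 'a set \<Rightarrow> 'a set" where
  "two_gen R x y F = {x \<otimes>\<^bsub>R\<^esub> f \<oplus>\<^bsub>R\<^esub> y \<otimes>\<^bsub>R\<^esub> g | f g. f \<in> F \<and> g \<in> F}"

context cring
begin

lemma two_genI: "f \<in> F \<Longrightarrow> g \<in> F \<Longrightarrow> x \<otimes> f \<oplus> y \<otimes> g \<in> two_gen R x y F"
  by (auto simp: two_gen_def)

lemma two_gen_ideal:
  assumes F: "ideal F R" and x: "x \<in> carrier R" and y: "y \<in> carrier R"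
  shows "ideal (two_gen R x y F) R"
proof (rule ideal_criterion)
  show "two_gen R x y F \<subseteq> carrier R"
    using x y ideal_carrier[OF F] by (auto simp: two_gen_def)
  show "\<zero> \<in> two_gen R x y F"
    using two_genI[OF ideal_zero[OF F] ideal_zero[OF F], of x y] x y by simp
next
  fix a b assume "a \<in> two_gen R x y F" "b \<in> two_gen R x y F"
  then obtain f g f' g' where *: "f \<in> F" "g \<in> F" "f' \<in> F" "g' \<in> F"
    "a = x \<otimes> f \<oplus> y \<otimes> g" "b = x \<otimes> f' \<oplus> y \<otimes> g'"
    by (auto simp: two_gen_def)
  have c: "f \<in> carrier R" "g \<in> carrier R" "f' \<in> carrier R" "g' \<in> carrier R"
    using * ideal_carrier[OF F] by auto
  have "a \<oplus> b = x \<otimes> (f \<oplus> f') \<oplus> y \<otimes> (g \<oplus> g')"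
    unfolding * using c x y by algebra
  then show "a \<oplus> b \<in> two_gen R x y F"
    using * by (simp add: two_genI ideal_add[OF F])
next
  fix r a assume r: "r \<in> carrier R" and "a \<in> two_gen R x y F"
  then obtain f g where *: "f \<in> F" "g \<in> F" "a = x \<otimes> f \<oplus> y \<otimes> g"
    by (auto simp: two_gen_def)
  have c: "f \<in> carrier R" "g \<in> carrier R"
    using * ideal_carrier[OF F] by auto
  have "r \<otimes> a = x \<otimes> (r \<otimes> f) \<oplus> y \<otimes> (r \<otimes> g)"
    unfolding * using c x y r by algebra
  then show "r \<otimes> a \<in> two_gen R x y F"
    using * r by (simp add: two_genI ideal_mult[OF F])
qed

lemma two_gen_left:
  assumes F: "ideal F R" and x: "x \<in> carrier R" and y: "y \<in> carrier R" and f: "f \<in> F"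
  shows "x \<otimes> f \<in> two_gen R x y F"
  using two_genI[OF f ideal_zero[OF F], of x y] x y f ideal_carrier[OF F f] by simp

lemma two_gen_right:
  assumes F: "ideal F R" and x: "x \<in> carrier R" and y: "y \<in> carrier R" and f: "f \<in> F"
  shows "y \<otimes> f \<in> two_gen R x y F"
  using two_genI[OF ideal_zero[OF F] f, of x y] x y f ideal_carrier[OF F f] by simp

lemma two_gen_generators:
  assumes "x \<in> carrier R" "y \<in> carrier R"
  shows "x \<in> two_gen R x y (carrier R)" "y \<in> two_gen R x y (carrier R)"
  using two_gen_left[OF oneideal assms one_closed] two_gen_right[OF oneideal assms one_closed]
    assms by simp_all

lemma two_gen_least:
  assumes "ideal A R" "\<And>f. f \<in> F \<Longrightarrow> x \<otimes> f \<in> A" "\<And>f. f \<in> F \<Longrightarrow> y \<otimes> f \<in> A"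
  shows "two_gen R x y F \<subseteq> A"
  using assms by (auto simp: two_gen_def intro: ideal_add)

lemma two_gen_carrier_eq_Idl:
  assumes x: "x \<in> carrier R" and y: "y \<in> carrier R"
  shows "two_gen R x y (carrier R) = Idl {x, y}"
proof
  have i: "ideal (Idl {x, y}) R" using x y by (intro genideal_ideal) auto
  have "x \<in> Idl {x, y}" "y \<in> Idl {x, y}"
    using genideal_self[of "{x, y}"] x y by auto
  then show "two_gen R x y (carrier R) \<subseteq> Idl {x, y}"
    by (intro two_gen_least i ideal_mult'[OF i])
  show "Idl {x, y} \<subseteq> two_gen R x y (carrier R)"
    using two_gen_generators[OF x y]
    by (intro genideal_minimal two_gen_ideal[OF oneideal x y]) auto
qed

lemma two_gen_prod:
  assumes F: "ideal F R" and x: "x \<in> carrier R" and y: "y \<in> carrier R"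
  shows "two_gen R x y (carrier R) \<cdot> F = two_gen R x y F"
proof
  show "two_gen R x y (carrier R) \<cdot> F \<subseteq> two_gen R x y F"
  proof (rule ideal_prod_least[OF two_gen_ideal[OF F x y]])
    fix a f assume "a \<in> two_gen R x y (carrier R)" and f: "f \<in> F"
    then obtain p q where pq: "p \<in> carrier R" "q \<in> carrier R" "a = x \<otimes> p \<oplus> y \<otimes> q"
      by (auto simp: two_gen_def)
    have "a \<otimes> f = x \<otimes> (p \<otimes> f) \<oplus> y \<otimes> (q \<otimes> f)"
      unfolding pq using pq x y ideal_carrier[OF F f] by algebra
    then show "a \<otimes> f \<in> two_gen R x y F"
      using pq f by (simp add: two_genI ideal_mult[OF F])
  qed
  have "x \<otimes> f \<in> two_gen R x y (carrier R) \<cdot> F" "y \<otimes> f \<in> two_gen R x y (carrier R) \<cdot> F"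
    if "f \<in> F" for f
    using that two_gen_generators[OF x y] by (auto intro: ideal_prod.prod)
  then show "two_gen R x y F \<subseteq> two_gen R x y (carrier R) \<cdot> F"
    by (intro two_gen_least ideal_prod_is_ideal F two_gen_ideal[OF oneideal x y])
qed

lemma ideal_colon_two_gen:
  assumes F: "ideal F R" and x: "x \<in> carrier R" and y: "y \<in> carrier R"
  shows "ideal_colon R F (two_gen R x y (carrier R)) = colon_elem R F y \<inter> colon_elem R F x"
proof
  show "ideal_colon R F (two_gen R x y (carrier R)) \<subseteq> colon_elem R F y \<inter> colon_elem R F x"
    using two_gen_generators[OF x y] x y by (auto simp: ideal_colon_def colon_elem_def m_comm)
  show "colon_elem R F y \<inter> colon_elem R F x \<subseteq> ideal_colon R F (two_gen R x y (carrier R))"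
  proof
    fix a assume a: "a \<in> colon_elem R F y \<inter> colon_elem R F x"
    have "a \<otimes> j \<in> F" if "j \<in> two_gen R x y (carrier R)" for j
    proof -
      obtain p q where pq: "p \<in> carrier R" "q \<in> carrier R" "j = x \<otimes> p \<oplus> y \<otimes> q"
        using \<open>j \<in> two_gen R x y (carrier R)\<close> unfolding two_gen_def by blast
      have "a \<in> carrier R" "y \<otimes> a \<in> F" "x \<otimes> a \<in> F" using a by (auto simp: colon_elem_def)
      moreover have "a \<otimes> j = p \<otimes> (x \<otimes> a) \<oplus> q \<otimes> (y \<otimes> a)"
        unfolding pq using pq x y \<open>a \<in> carrier R\<close> by algebra
      ultimately show ?thesis using pq by (simp add: ideal_add[OF F] ideal_mult[OF F])
    qed
    then show "a \<in> ideal_colon R F (two_gen R x y (carrier R))"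
      using a by (auto simp: ideal_colon_def colon_elem_def)
  qed
qed

end

text \<open>The first Koszul homology module of \<open>x, y\<close> vanishes: every relation is a multiple of
  \<open>x y - y x = 0\<close>.\<close>

definition koszul_syzygies :: "('a, 'b) ring_scheme \<Rightarrow> 'a \<Rightarrow> 'a \<Rightarrow> bool" where
  "koszul_syzygies R x y \<longleftrightarrow> x \<in> carrier R \<and> y \<in> carrier R \<and>
     (\<forall>p\<in>carrier R. \<forall>q\<in>carrier R. x \<otimes>\<^bsub>R\<^esub> p \<oplus>\<^bsub>R\<^esub> y \<otimes>\<^bsub>R\<^esub> q = \<zero>\<^bsub>R\<^esub> \<longrightarrow>
        (\<exists>t\<in>carrier R. p = y \<otimes>\<^bsub>R\<^esub> t \<and> q = \<ominus>\<^bsub>R\<^esub> (x \<otimes>\<^bsub>R\<^esub> t)))"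

context cring
begin

lemma koszul_syzygiesE:
  assumes "koszul_syzygies R x y" "p \<in> carrier R" "q \<in> carrier R" "x \<otimes> p \<oplus> y \<otimes> q = \<zero>"
  obtains t where "t \<in> carrier R" "p = y \<otimes> t" "q = \<ominus> (x \<otimes> t)"
  using assms unfolding koszul_syzygies_def by blast

text \<open>For modules, \<open>(R/F)\<^sup>2 \<rightarrow> J/JF\<close>, \<open>(f, g) \<mapsto> xf + yg\<close>, is surjective with kernel isomorphic to
  \<open>R/(F : J)\<close> when the relations between \<open>x\<close> and \<open>y\<close> are trivial. Within the lattice of
  ideals of \<open>R\<close> the same count is made along \<open>JF \<subseteq> xR + JF \<subseteq> J\<close>: the two factors are
  \<open>R/(y(F : x) + F)\<close> and \<open>R/(xR + F)\<close>, and these are compared with \<open>R/F\<close>.\<close>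

lemma colength_two_gen:
  assumes syz: "koszul_syzygies R x y"
    and F: "finite_colength R F" and JF: "finite_colength R (two_gen R x y F)"
  shows "colength R (two_gen R x y F) + colength R (ideal_colon R F (two_gen R x y (carrier R)))
    = colength R (two_gen R x y (carrier R)) + 2 * colength R F"
proof -
  have x: "x \<in> carrier R" and y: "y \<in> carrier R" using syz by (auto simp: koszul_syzygies_def)
  note iF = finite_colength_ideal[OF F]
  have cF: "f \<in> carrier R" if "f \<in> F" for f using ideal_carrier[OF iF that] .
  define K1 where "K1 = mult_plus R x (carrier R) (two_gen R x y F)"
  have K1: "finite_colength R K1"
    unfolding K1_def by (rule colength_mult_plus(2)[OF JF finite_colength_carrier x])
  note iK1 = finite_colength_ideal[OF K1]
  have colon_x: "colon_elem R (two_gen R x y F) x = mult_plus R y (colon_elem R F x) F"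
  proof
    show "colon_elem R (two_gen R x y F) x \<subseteq> mult_plus R y (colon_elem R F x) F"
    proof
      fix r assume "r \<in> colon_elem R (two_gen R x y F) x"
      then obtain f g where *: "r \<in> carrier R" "f \<in> F" "g \<in> F" "x \<otimes> r = x \<otimes> f \<oplus> y \<otimes> g"
        by (auto simp: colon_elem_def two_gen_def)
      have c: "f \<in> carrier R" "g \<in> carrier R" using * cF by auto
      have "x \<otimes> (r \<ominus> f) \<oplus> y \<otimes> (\<ominus> g) = x \<otimes> r \<ominus> (x \<otimes> f \<oplus> y \<otimes> g)"
        using c x y *(1) by algebra
      also have "\<dots> = \<zero>"
        using *(4) c x y by (simp add: r_neg a_minus_def)
      finally obtain t where t: "t \<in> carrier R" "r \<ominus> f = y \<otimes> t" "\<ominus> g = \<ominus> (x \<otimes> t)"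
        using koszul_syzygiesE[OF syz] c *(1) by (metis minus_closed a_inv_closed)
      have "g = x \<otimes> t" using t c x by (metis minus_minus m_closed)
      then have "t \<in> colon_elem R F x" using t * by (auto simp: colon_elem_def)
      moreover have "r = y \<otimes> t \<oplus> f"
        using t(2)[symmetric] c *(1) by (simp add: a_minus_def a_assoc l_neg)
      ultimately show "r \<in> mult_plus R y (colon_elem R F x) F"
        using * by (simp add: mult_plusI)
    qed
    show "mult_plus R y (colon_elem R F x) F \<subseteq> colon_elem R (two_gen R x y F) x"
    proof
      fix r assume "r \<in> mult_plus R y (colon_elem R F x) F"
      then obtain t f where *: "t \<in> carrier R" "x \<otimes> t \<in> F" "f \<in> F" "r = y \<otimes> t \<oplus> f"
        by (auto simp: colon_elem_def mult_plus_def)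
      have "x \<otimes> r = x \<otimes> f \<oplus> y \<otimes> (x \<otimes> t)"
        unfolding * using *(1) cF[OF *(3)] x y by algebra
      then show "r \<in> colon_elem R (two_gen R x y F) x"
        using * x y cF by (auto simp: colon_elem_def two_genI)
    qed
  qed
  have sum_y: "mult_plus R y (carrier R) K1 = two_gen R x y (carrier R)"
  proof
    have "two_gen R x y F \<subseteq> two_gen R x y (carrier R)"
      using cF by (auto simp: two_gen_def)
    then show "mult_plus R y (carrier R) K1 \<subseteq> two_gen R x y (carrier R)"
      unfolding K1_def
      by (intro mult_plus_subset two_gen_ideal oneideal two_gen_left two_gen_right x y)
    show "two_gen R x y (carrier R) \<subseteq> mult_plus R y (carrier R) K1"
    proof (rule two_gen_least)
      fix f assume f: "f \<in> carrier R"
      then have "x \<otimes> f \<in> K1"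
        unfolding K1_def
        by (intro mult_in_mult_plus oneideal two_gen_ideal iF x y)
      then show "x \<otimes> f \<in> mult_plus R y (carrier R) K1"
        using subset_mult_plus[OF oneideal iK1 y] by auto
    qed (intro mult_in_mult_plus mult_plus_ideal oneideal iK1 y | assumption)+
  qed
  have colon_y: "colon_elem R K1 y = mult_plus R x (carrier R) F"
  proof
    show "colon_elem R K1 y \<subseteq> mult_plus R x (carrier R) F"
    proof
      fix r assume "r \<in> colon_elem R K1 y"
      then obtain p f g where *: "r \<in> carrier R" "p \<in> carrier R" "f \<in> F" "g \<in> F"
        "y \<otimes> r = x \<otimes> p \<oplus> (x \<otimes> f \<oplus> y \<otimes> g)"
        by (auto simp: K1_def colon_elem_def two_gen_def mult_plus_def)
      have c: "f \<in> carrier R" "g \<in> carrier R" using * cF by auto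
      have "x \<otimes> (p \<oplus> f) \<oplus> y \<otimes> (g \<ominus> r) = (x \<otimes> p \<oplus> (x \<otimes> f \<oplus> y \<otimes> g)) \<ominus> y \<otimes> r"
        using c x y *(1,2) by algebra
      also have "\<dots> = \<zero>"
        unfolding *(5) using c x y *(2) by (simp add: r_neg a_minus_def)
      finally obtain t where t: "t \<in> carrier R" "g \<ominus> r = \<ominus> (x \<otimes> t)"
        using koszul_syzygiesE[OF syz] c *(1,2) by (metis minus_closed a_closed)
      have "r = g \<ominus> (g \<ominus> r)" using c *(1) by algebra
      also have "\<dots> = x \<otimes> t \<oplus> g" unfolding t(2) using c x t(1) by algebra
      finally show "r \<in> mult_plus R x (carrier R) F"
        using * t by (simp add: mult_plusI)
    qed
    show "mult_plus R x (carrier R) F \<subseteq> colon_elem R K1 y"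
    proof
      fix r assume "r \<in> mult_plus R x (carrier R) F"
      then obtain t f where *: "t \<in> carrier R" "f \<in> F" "r = x \<otimes> t \<oplus> f"
        by (auto simp: mult_plus_def)
      have "y \<otimes> r = x \<otimes> (y \<otimes> t) \<oplus> y \<otimes> f"
        unfolding * using *(1) cF[OF *(2)] x y by algebra
      moreover have "y \<otimes> f \<in> two_gen R x y F" by (rule two_gen_right[OF iF x y *(2)])
      ultimately have "y \<otimes> r \<in> K1" unfolding K1_def using * y by (simp add: mult_plusI)
      then show "r \<in> colon_elem R K1 y"
        using * x y cF by (auto simp: colon_elem_def)
    qed
  qed
  have "colength R (two_gen R x y F) =
      colength R K1 + colength R (mult_plus R y (colon_elem R F x) F)"
    using colength_mult_plus_carrier(1)[OF JF x] colon_x by (simp add: K1_def)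
  moreover have "colength R K1 =
      colength R (two_gen R x y (carrier R)) + colength R (mult_plus R x (carrier R) F)"
    using colength_mult_plus_carrier(1)[OF K1 y] colon_y sum_y by simp
  moreover have "colength R F = colength R (mult_plus R x (carrier R) F) + colength R (colon_elem R F x)"
    by (rule colength_mult_plus_carrier(1)[OF F x])
  moreover have "colength R F + colength R (colon_elem R F x) =
      colength R (mult_plus R y (colon_elem R F x) F) +
      colength R (colon_elem R F y \<inter> colon_elem R F x)"
    by (rule colength_mult_plus(1)[OF F colength_mult_plus_carrier(2)[OF F x] y])
  ultimately show ?thesis
    unfolding ideal_colon_two_gen[OF iF x y] by simp
qed

lemma ideal_pow_two_gen_Suc:
  assumes "x \<in> carrier R" "y \<in> carrier R"
  shows "ideal_pow R (two_gen R x y (carrier R)) (Suc n) =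
    two_gen R x y (ideal_pow R (two_gen R x y (carrier R)) n)"
  using ideal_pow_Suc two_gen_prod ideal_pow_ideal two_gen_ideal[OF oneideal assms] assms by simp

text \<open>Of the monomials of degree \<open>n + 1\<close> in \<open>x\<close> and \<open>y\<close>, only \<open>y\<^bsup>n+1\<^esup>\<close> is not divisible by \<open>x\<close>.\<close>

lemma ideal_pow_two_gen_subset:
  assumes x: "x \<in> carrier R" and y: "y \<in> carrier R"
  defines "Q \<equiv> two_gen R x y (carrier R)"
  shows "ideal_pow R Q (Suc n) \<subseteq> mult_plus R x (ideal_pow R Q n) (PIdl (y [^] Suc n))"
proof (induction n)
  case 0
  have "x \<otimes> f \<oplus> y \<otimes> g \<in> mult_plus R x (carrier R) (PIdl y)"
    if "f \<in> carrier R" "g \<in> carrier R" for f g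
    using that y by (intro mult_plusI) (auto simp: cgenideal_def m_comm)
  then show ?case
    using ideal_pow_1[OF two_gen_ideal[OF oneideal x y]] y
    by (auto simp: Q_def two_gen_def ideal_pow_0)
next
  case (Suc n)
  note iQ = two_gen_ideal[OF oneideal x y, folded Q_def]
  let ?T = "mult_plus R x (ideal_pow R Q (Suc n)) (PIdl (y [^] Suc (Suc n)))"
  have iT: "ideal ?T R"
    using x y by (intro mult_plus_ideal ideal_pow_ideal iQ cgenideal_ideal) auto
  have "y \<otimes> f \<in> ?T" if "f \<in> ideal_pow R Q (Suc n)" for f
  proof -
    have "f \<in> mult_plus R x (ideal_pow R Q n) (PIdl (y [^] Suc n))"
      using Suc that by blast
    then obtain p s where ps: "p \<in> ideal_pow R Q n" "s \<in> carrier R" "f = x \<otimes> p \<oplus> s \<otimes> y [^] Suc n"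
      unfolding mult_plus_def cgenideal_def by blast
    have p: "p \<in> carrier R" using ps ideal_carrier[OF ideal_pow_ideal[OF iQ]] by auto
    have "y \<otimes> f = x \<otimes> (y \<otimes> p) \<oplus> s \<otimes> (y [^] Suc n \<otimes> y)"
      unfolding ps using x y ps(2) p by (simp add: r_distr m_ac)
    moreover have "y \<otimes> p \<in> ideal_pow R Q (Suc n)"
      using ps(1) ideal_prod.prod[of y Q p "ideal_pow R Q n" R] two_gen_generators(2)[OF x y]
        ideal_pow_Suc[OF iQ] by (simp add: Q_def)
    moreover have "s \<otimes> (y [^] Suc n \<otimes> y) \<in> PIdl (y [^] Suc (Suc n))"
      using ps(2) y by (auto simp: cgenideal_def)
    ultimately show ?thesis by (simp add: mult_plusI)
  qed
  moreover have "x \<otimes> f \<in> ?T" if "f \<in> ideal_pow R Q (Suc n)" for f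
    using that x y by (intro mult_in_mult_plus ideal_pow_ideal iQ cgenideal_ideal) auto
  ultimately show ?case
    unfolding Q_def ideal_pow_two_gen_Suc[OF x y, of "Suc n"] unfolding Q_def[symmetric]
    by (intro two_gen_least iT)
qed

text \<open>The powers of an ideal with two generators have at most the colengths they have in the
  regular case: the second differences are bounded by the colength of the ideal. Indeed
  \<open>Q\<^bsup>n+1\<^esup>/Q\<^bsup>n+2\<^esup>\<close> is filtered through \<open>T = xQ\<^bsup>n+1\<^esup> + (y\<^bsup>n+1\<^esup>)\<close>; the upper part is a
  quotient of \<open>Q\<^sup>n/Q\<^bsup>n+1\<^esup>\<close> by multiplication with \<open>x\<close>, the lower part a quotient of \<open>R/Q\<close> by
  multiplication with \<open>y\<^bsup>n+1\<^esup>\<close>.\<close>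

lemma colength_ideal_pow_two_gen:
  assumes x: "x \<in> carrier R" and y: "y \<in> carrier R"
  defines "Q \<equiv> two_gen R x y (carrier R)"
  assumes fin: "\<And>n. finite_colength R (ideal_pow R Q n)"
  shows "2 * colength R (ideal_pow R Q n) \<le> colength R Q * (n * (n + 1))"
proof -
  note iQ = two_gen_ideal[OF oneideal x y, folded Q_def]
  let ?L = "\<lambda>n. colength R (ideal_pow R Q n)"
  have second_diff: "?L (Suc (Suc n)) + ?L n \<le> 2 * ?L (Suc n) + colength R Q" for n
  proof -
    let ?P = "ideal_pow R Q n" and ?P1 = "ideal_pow R Q (Suc n)" and ?P2 = "ideal_pow R Q (Suc (Suc n))"
    note iP = ideal_pow_ideal[OF iQ, of n] and iP1 = ideal_pow_ideal[OF iQ, of "Suc n"]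
      and iP2 = ideal_pow_ideal[OF iQ, of "Suc (Suc n)"]
    let ?Y = "PIdl (y [^] Suc n)"
    have yc: "y [^] Suc n \<in> carrier R" using y by blast
    have iY: "ideal ?Y R" by (rule cgenideal_ideal[OF yc])
    have xQ: "x \<in> Q" and yQ: "y \<in> Q" using two_gen_generators[OF x y] by (auto simp: Q_def)
    have xP: "x \<otimes> p \<in> ideal_pow R Q (Suc k)" if "p \<in> ideal_pow R Q k" for p k
      using ideal_prod.prod[OF xQ that, of R] ideal_pow_Suc[OF iQ] by simp
    have Y1: "?Y \<subseteq> ?P1"
      using cgenideal_minimal[OF iP1] elem_pow_in_ideal_pow[OF iQ yQ] by blast
    define T where "T = mult_plus R x ?P1 ?Y"
    have iT: "ideal T R" unfolding T_def by (rule mult_plus_ideal[OF iP1 iY x])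
    have "PIdl (y [^] Suc (Suc n)) \<subseteq> ?Y"
    proof (rule cgenideal_minimal[OF iY])
      show "y [^] Suc (Suc n) \<in> ?Y"
        using y yc by (auto simp: cgenideal_def m_comm intro!: exI[of _ y])
    qed
    then have "?P2 \<subseteq> T"
      using ideal_pow_two_gen_subset[OF x y, of "Suc n"] mult_plus_mono[of ?P1 ?P1 _ ?Y x]
      by (auto simp: Q_def T_def)
    then have T: "finite_colength R T"
      by (rule finite_colength_superset[OF fin iT])
    have "colength R T + ?L n = colength R (mult_plus R x ?P T) + colength R (colon_elem R T x \<inter> ?P)"
      by (rule colength_mult_plus(1)[OF T fin x])
    moreover have "colength R (mult_plus R x ?P T) \<le> ?L (Suc n)"
    proof (rule colength_antimono[OF fin])
      show "ideal (mult_plus R x ?P T) R" by (rule mult_plus_ideal[OF iP iT x])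
      have "?P1 \<subseteq> mult_plus R x ?P ?Y"
        using ideal_pow_two_gen_subset[OF x y, of n] by (simp add: Q_def)
      also have "\<dots> \<subseteq> mult_plus R x ?P T"
        using subset_mult_plus[OF iP1 iY x] by (intro mult_plus_mono) (auto simp: T_def)
      finally show "?P1 \<subseteq> mult_plus R x ?P T" .
    qed
    moreover have "colength R (colon_elem R T x \<inter> ?P) \<le> ?L (Suc n)"
    proof (rule colength_antimono[OF fin])
      show "ideal (colon_elem R T x \<inter> ?P) R" by (intro i_intersect colon_elem_ideal iT iP x)
      have "x \<otimes> p \<in> T" if "p \<in> ?P1" for p
        unfolding T_def using that by (intro mult_in_mult_plus iP1 iY x)
      then show "?P1 \<subseteq> colon_elem R T x \<inter> ?P"
        using ideal_pow_antimono[OF iQ, of n "Suc n"] ideal_carrier[OF iP1]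
        by (auto simp: colon_elem_def)
    qed
    moreover have "?L (Suc (Suc n)) = colength R (mult_plus R (y [^] Suc n) (carrier R) ?P2)
        + colength R (colon_elem R ?P2 (y [^] Suc n))"
      by (rule colength_mult_plus_carrier(1)[OF fin yc])
    moreover have "colength R (mult_plus R (y [^] Suc n) (carrier R) ?P2) \<le> colength R T"
    proof (rule colength_antimono[OF T])
      show i: "ideal (mult_plus R (y [^] Suc n) (carrier R) ?P2) R"
        by (rule mult_plus_ideal[OF oneideal iP2 yc])
      have "y [^] Suc n \<otimes> \<one> \<in> mult_plus R (y [^] Suc n) (carrier R) ?P2"
        by (rule mult_in_mult_plus[OF oneideal iP2 yc one_closed])
      then have "?Y \<subseteq> mult_plus R (y [^] Suc n) (carrier R) ?P2"
        using yc by (intro cgenideal_minimal[OF i]) simp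
      then show "T \<subseteq> mult_plus R (y [^] Suc n) (carrier R) ?P2"
        unfolding T_def using xP[of _ "Suc n"] subset_mult_plus[OF oneideal iP2 yc]
        by (intro mult_plus_subset[OF i]) blast+
    qed
    moreover have "colength R (colon_elem R ?P2 (y [^] Suc n)) \<le> colength R Q"
    proof (rule colength_antimono)
      show "finite_colength R Q" using fin[of 1] ideal_pow_1[OF iQ] by simp
      show "ideal (colon_elem R ?P2 (y [^] Suc n)) R" by (rule colon_elem_ideal[OF iP2 yc])
      have "y [^] Suc n \<otimes> q \<in> ?P2" if "q \<in> Q" for q
      proof -
        have "q \<otimes> y [^] Suc n \<in> Q \<cdot> ?P1"
          using that elem_pow_in_ideal_pow[OF iQ yQ] by (intro ideal_prod.prod)
        then show ?thesis
          using ideal_pow_Suc[OF iQ, of "Suc n"] yc ideal_carrier[OF iQ that]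
          by (simp add: m_comm)
      qed
      then show "Q \<subseteq> colon_elem R ?P2 (y [^] Suc n)"
        using ideal_carrier[OF iQ] by (auto simp: colon_elem_def)
    qed
    ultimately show ?thesis by linarith
  qed
  have "?L 0 = 0" "?L (Suc 0) = colength R Q"
    using ideal_pow_1[OF iQ] by (simp_all add: ideal_pow_0 colength_carrier)
  have first_diff: "?L (Suc n) \<le> ?L n + colength R Q * (n + 1)" for n
  proof (induction n)
    case 0
    then show ?case using ideal_pow_1[OF iQ] by simp
  next
    case (Suc n)
    then show ?case using second_diff[of n] by (simp add: algebra_simps)
  qed
  show ?thesis
  proof (induction n)
    case 0
    then show ?case using \<open>?L 0 = 0\<close> by simp
  next
    case (Suc n)
    then show ?case using first_diff[of n] by (simp add: algebra_simps)
  qed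
qed

end

section \<open>Noetherian local rings\<close>

lemma (in noetherian_ring) ideal_family_maximal:
  assumes "A \<in> \<A>" and idl: "\<And>A. A \<in> \<A> \<Longrightarrow> ideal A R"
  shows "\<exists>M\<in>\<A>. \<forall>B\<in>\<A>. M \<subseteq> B \<longrightarrow> B = M"
proof (rule subset_Zorn_nonempty)
  fix \<C> assume C: "\<C> \<noteq> {}" "subset.chain \<A> \<C>"
  then have "subset.chain {I. ideal I R} \<C>"
    using idl by (auto simp: pred_on.chain_def)
  then show "\<Union>\<C> \<in> \<A>"
    using ideal_chain_is_trivial[OF C(1)] C(2) by (auto simp: pred_on.chain_def)
qed (use assms(1) in auto)

context noetherian_local_ring
begin

lemma m_ideal: "ideal m R"
  using maximalideal_m by (rule maximalideal.axioms)

lemma one_notin_m: "\<one> \<notin> m"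
  using maximalideal.I_notcarr[OF maximalideal_m] ideal.one_imp_carrier[OF m_ideal] by blast

lemma proper_ideal_subset_m:
  assumes A: "ideal A R" "A \<noteq> carrier R"
  shows "A \<subseteq> m"
proof -
  let ?A = "{B. ideal B R \<and> A \<subseteq> B \<and> B \<noteq> carrier R}"
  have "A \<in> ?A" using A by auto
  then have "\<exists>M\<in>?A. \<forall>B\<in>?A. M \<subseteq> B \<longrightarrow> B = M"
    by (rule ideal_family_maximal) simp
  then obtain M where M: "M \<in> ?A" and max': "\<forall>B\<in>?A. M \<subseteq> B \<longrightarrow> B = M"
    by (rule bexE)
  have max: "B \<in> ?A \<Longrightarrow> M \<subseteq> B \<Longrightarrow> B = M" for B
    using max' by blast
  have "maximalideal M R"
  proof (rule maximalidealI)
    fix B assume "ideal B R" "M \<subseteq> B" "B \<subseteq> carrier R"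
    then show "B = M \<or> B = carrier R"
      using max[of B] M by auto
  qed (use M in auto)
  then show ?thesis using maximalideal_unique M by blast
qed

lemma unit_if_notin_m:
  assumes t: "t \<in> carrier R" "t \<notin> m"
  obtains s where "s \<in> carrier R" "s \<otimes> t = \<one>"
proof -
  have "PIdl t = carrier R"
    using proper_ideal_subset_m[OF cgenideal_ideal[OF t(1)]] cgenideal_self[OF t(1)] t(2) by blast
  then have "\<one> \<in> PIdl t" by simp
  then show ?thesis using that by (auto simp: cgenideal_def)
qed

lemma cancel_unit:
  assumes A: "ideal A R" and u: "u \<in> carrier R" "u \<notin> m" and t: "t \<in> carrier R" "u \<otimes> t \<in> A"
  shows "t \<in> A"
proof -
  obtain s where s: "s \<in> carrier R" "s \<otimes> u = \<one>" using unit_if_notin_m[OF u] .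
  then have "t = s \<otimes> (u \<otimes> t)" using u t by (simp add: m_assoc[symmetric])
  then show ?thesis using ideal_mult[OF A t(2) s(1)] by simp
qed

lemma one_minus_m:
  assumes "a \<in> m" shows "\<one> \<ominus> a \<notin> m"
proof
  assume "\<one> \<ominus> a \<in> m"
  then have "(\<one> \<ominus> a) \<oplus> a \<in> m" using assms ideal_add[OF m_ideal] by simp
  moreover have "(\<one> \<ominus> a) \<oplus> a = \<one>" using ideal_carrier[OF m_ideal assms] by algebra
  ultimately show False using one_notin_m by simp
qed

text \<open>Nakayama's lemma. A maximal proper subideal \<open>B'\<close> of \<open>N\<close> above \<open>B\<close> has
  \<open>mN \<subseteq> B'\<close>, because \<open>N/B'\<close> is simple.\<close>

lemma nakayama:
  assumes B: "ideal B R" and N: "ideal N R" and "B \<subseteq> N" and gen: "N \<subseteq> B <+>\<^bsub>R\<^esub> (m \<cdot> N)"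
  shows "N = B"
proof (rule ccontr)
  assume "N \<noteq> B"
  let ?A = "{A. ideal A R \<and> B \<subseteq> A \<and> A \<subset> N}"
  have "B \<in> ?A" using B \<open>B \<subseteq> N\<close> \<open>N \<noteq> B\<close> by auto
  then have "\<exists>M\<in>?A. \<forall>B\<in>?A. M \<subseteq> B \<longrightarrow> B = M"
    by (rule ideal_family_maximal) simp
  then obtain M where M: "M \<in> ?A" and max': "\<forall>B\<in>?A. M \<subseteq> B \<longrightarrow> B = M"
    by (rule bexE)
  have max: "B \<in> ?A \<Longrightarrow> M \<subseteq> B \<Longrightarrow> B = M" for B
    using max' by blast
  from M have iM: "ideal M R" by simp
  have "a \<otimes> z \<in> M" if a: "a \<in> m" and z: "z \<in> N" for a z
  proof (rule ccontr)
    assume az: "a \<otimes> z \<notin> M"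
    have c: "a \<in> carrier R" "z \<in> carrier R"
      using a z ideal_carrier[OF m_ideal] ideal_carrier[OF N] by auto
    let ?C = "mult_plus R (a \<otimes> z) (carrier R) M"
    have iC: "ideal ?C R" using mult_plus_ideal[OF oneideal iM] c by simp
    have "a \<otimes> z \<in> ?C" using mult_in_mult_plus[OF oneideal iM _ one_closed, of "a \<otimes> z"] c by simp
    moreover have "M \<subseteq> ?C" using subset_mult_plus[OF oneideal iM] c by simp
    ultimately have "?C \<notin> ?A" using max[of ?C] az by auto
    moreover have "?C \<subseteq> N"
      using M by (intro mult_plus_subset[OF N] ideal_mult'[OF N] ideal_mult[OF N z c(1)]) auto
    ultimately have "z \<in> ?C" using iC M \<open>M \<subseteq> ?C\<close> z by auto
    then obtain r k where rk: "r \<in> carrier R" "k \<in> M" "z = a \<otimes> z \<otimes> r \<oplus> k"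
      by (auto simp: mult_plus_def)
    have k: "k \<in> carrier R" using rk ideal_carrier[OF iM] by auto
    have "(\<one> \<ominus> a \<otimes> r) \<otimes> z = z \<ominus> a \<otimes> z \<otimes> r" using c rk(1) by algebra
    also have "\<dots> = (a \<otimes> z \<otimes> r \<oplus> k) \<ominus> a \<otimes> z \<otimes> r" using rk(3) by simp
    also have "\<dots> = k" using c rk(1) k by algebra
    finally have "(\<one> \<ominus> a \<otimes> r) \<otimes> z \<in> M" using rk by simp
    moreover have "\<one> \<ominus> a \<otimes> r \<notin> m"
      using one_minus_m ideal_mult'[OF m_ideal a rk(1)] by blast
    ultimately have "z \<in> M"
      using cancel_unit[OF iM, of "\<one> \<ominus> a \<otimes> r" z] c rk(1) by simp
    then show False using az ideal_mult[OF iM _ c(1)] by blast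
  qed
  then have "m \<cdot> N \<subseteq> M" by (intro ideal_prod_least[OF iM])
  then have "B <+>\<^bsub>R\<^esub> (m \<cdot> N) \<subseteq> M"
    using M ideal_add[OF iM] by (auto simp: set_add_def')
  then show False using gen M by auto
qed

text \<open>Krull: an ideal that is maximal among those disjoint from the multiplicative set \<open>S\<close> is prime,
  since any two elements outside it can be enlarged to members of \<open>S\<close>, whose product lies in
  \<open>S\<close> too.\<close>

lemma prime_ideal_disjoint:
  assumes A: "ideal A R" and S: "\<one> \<in> S" "S \<subseteq> carrier R"
    "\<And>s t. s \<in> S \<Longrightarrow> t \<in> S \<Longrightarrow> s \<otimes> t \<in> S" and dis: "A \<inter> S = {}"
  obtains P where "primeideal P R" "A \<subseteq> P" "P \<inter> S = {}"
proof -
  let ?A = "{B. ideal B R \<and> A \<subseteq> B \<and> B \<inter> S = {}}"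
  have "A \<in> ?A" using A dis by auto
  then have "\<exists>M\<in>?A. \<forall>B\<in>?A. M \<subseteq> B \<longrightarrow> B = M"
    by (rule ideal_family_maximal) simp
  then obtain P where P: "P \<in> ?A" and max': "\<forall>B\<in>?A. P \<subseteq> B \<longrightarrow> B = P"
    by (rule bexE)
  have max: "B \<in> ?A \<Longrightarrow> P \<subseteq> B \<Longrightarrow> B = P" for B
    using max' by blast
  from P have iP: "ideal P R" by simp
  have meets: "\<exists>s r k. s \<in> S \<and> r \<in> carrier R \<and> k \<in> P \<and> s = a \<otimes> r \<oplus> k"
    if a: "a \<in> carrier R" "a \<notin> P" for a
  proof -
    let ?C = "mult_plus R a (carrier R) P"
    have "ideal ?C R" by (rule mult_plus_ideal[OF oneideal iP a(1)])
    moreover have "a \<in> ?C" using mult_in_mult_plus[OF oneideal iP a(1) one_closed] a by simp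
    moreover have "P \<subseteq> ?C" by (rule subset_mult_plus[OF oneideal iP a(1)])
    ultimately have "?C \<inter> S \<noteq> {}" using max[of ?C] P a by auto
    then show ?thesis by (auto simp: mult_plus_def)
  qed
  have "primeideal P R"
  proof (rule primeidealI[OF iP is_cring])
    show "carrier R \<noteq> P" using P S by auto
    fix a b assume ab: "a \<in> carrier R" "b \<in> carrier R" "a \<otimes> b \<in> P"
    show "a \<in> P \<or> b \<in> P"
    proof (rule ccontr)
      assume "\<not> (a \<in> P \<or> b \<in> P)"
      then obtain s r k s' r' k' where *: "s \<in> S" "r \<in> carrier R" "k \<in> P" "s = a \<otimes> r \<oplus> k"
        "s' \<in> S" "r' \<in> carrier R" "k' \<in> P" "s' = b \<otimes> r' \<oplus> k'"
        using meets[of a] meets[of b] ab by blast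
      have c: "k \<in> carrier R" "k' \<in> carrier R" using * ideal_carrier[OF iP] by auto
      have "s \<otimes> s' = (r \<otimes> r') \<otimes> (a \<otimes> b) \<oplus> ((a \<otimes> r) \<otimes> k' \<oplus> (b \<otimes> r' \<oplus> k') \<otimes> k)"
        unfolding * using c ab(1,2) *(2,6) by algebra
      also have "\<dots> \<in> P"
        using ideal_mult[OF iP ab(3), of "r \<otimes> r'"] ideal_mult[OF iP *(7), of "a \<otimes> r"]
          ideal_mult[OF iP *(3), of "b \<otimes> r' \<oplus> k'"] * c ab
        by (simp add: ideal_add[OF iP])
      finally show False using S(3)[OF *(1,5)] P by auto
    qed
  qed
  then show ?thesis using that P by auto
qed

text \<open>A largest counterexample \<open>A\<close> would lie strictly below \<open>A + wR\<close> and \<open>A : w\<close>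
  for a suitable \<open>w\<close>, and powers of \<open>m\<close> inside these two multiply into \<open>A\<close>.\<close>

lemma m_pow_subset_if_radical:
  assumes A: "ideal A R" and rad: "\<And>t. t \<in> m \<Longrightarrow> \<exists>n. t [^] (n::nat) \<in> A"
  shows "\<exists>k. ideal_pow R m k \<subseteq> A"
proof (rule ccontr)
  assume no: "\<nexists>k. ideal_pow R m k \<subseteq> A"
  let ?A = "{A. ideal A R \<and> (\<forall>t\<in>m. \<exists>n. t [^] (n::nat) \<in> A) \<and> (\<nexists>k. ideal_pow R m k \<subseteq> A)}"
  have "A \<in> ?A" using A no rad by auto
  then have "\<exists>M\<in>?A. \<forall>B\<in>?A. M \<subseteq> B \<longrightarrow> B = M"
    by (rule ideal_family_maximal) simp
  then obtain M where M: "M \<in> ?A" and max': "\<forall>B\<in>?A. M \<subseteq> B \<longrightarrow> B = M"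
    by (rule bexE)
  have max: "B \<in> ?A \<Longrightarrow> M \<subseteq> B \<Longrightarrow> B = M" for B
    using max' by blast
  from M have iM: "ideal M R" by simp
  have "\<not> ideal_pow R m (Suc 0) \<subseteq> M" using M by blast
  then have "\<not> m \<subseteq> M" using ideal_pow_1[OF m_ideal] by simp
  then obtain z where z: "z \<in> m" "z \<notin> M" by auto
  have zc: "z \<in> carrier R" using z ideal_carrier[OF m_ideal] by auto
  define n where "n = (LEAST n. z [^] (n::nat) \<in> M)"
  have n: "z [^] n \<in> M"
    unfolding n_def using M z(1) by (auto intro: LeastI_ex)
  have "\<one> \<notin> M" using M ideal.one_imp_carrier[OF iM] ideal_subset_carrier[OF ideal_pow_ideal[OF m_ideal]] by auto
  then have "n \<noteq> 0" using n by (auto intro: ccontr)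
  then obtain j where j: "n = Suc j" by (cases n) auto
  define w where "w = z [^] j"
  have w: "w \<in> carrier R" "w \<notin> M" "w \<otimes> z \<in> M"
    using zc n not_less_Least[of j "\<lambda>n. z [^] n \<in> M"] j by (auto simp: w_def n_def)
  let ?C = "mult_plus R w (carrier R) M" and ?D = "colon_elem R M w"
  have iC: "ideal ?C R" by (rule mult_plus_ideal[OF oneideal iM w(1)])
  have iD: "ideal ?D R" by (rule colon_elem_ideal[OF iM w(1)])
  have CM: "M \<subseteq> ?C" and DM: "M \<subseteq> ?D"
    using subset_mult_plus[OF oneideal iM w(1)] subset_colon_elem[OF iM w(1)] by auto
  have "w \<in> ?C" using mult_in_mult_plus[OF oneideal iM w(1) one_closed] w by simp
  then have "?C \<noteq> M" using w by auto
  then obtain k where k: "ideal_pow R m k \<subseteq> ?C"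
    using max[OF _ CM] iC CM M by blast
  have "z \<in> ?D" using w zc by (simp add: colon_elem_def)
  then have "?D \<noteq> M" using z by auto
  then obtain l where l: "ideal_pow R m l \<subseteq> ?D"
    using max[OF _ DM] iD DM M by blast
  have "ideal_pow R m l \<cdot> ideal_pow R m k \<subseteq> M"
  proof (rule ideal_prod_least[OF iM])
    fix a b assume "a \<in> ideal_pow R m l" "b \<in> ideal_pow R m k"
    then have "a \<in> ?D" "b \<in> ?C" using k l by auto
    then obtain r q where *: "a \<in> carrier R" "w \<otimes> a \<in> M" "r \<in> carrier R" "q \<in> M" "b = w \<otimes> r \<oplus> q"
      by (auto simp: mult_plus_def colon_elem_def)
    have "a \<otimes> b = r \<otimes> (w \<otimes> a) \<oplus> a \<otimes> q"
      unfolding * using w(1) *(1,3) ideal_carrier[OF iM *(4)] by algebra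
    then show "a \<otimes> b \<in> M" using * by (simp add: ideal_add[OF iM] ideal_mult[OF iM])
  qed
  then have "ideal_pow R m (l + k) \<subseteq> M" using ideal_pow_add[OF m_ideal] by simp
  then show False using M by auto
qed

text \<open>Only \<open>m\<close> and \<open>R\<close> itself lie above \<open>m\<close>.\<close>

lemma finite_colength_m: "finite_colength R m"
proof -
  have "interval_length R m (carrier R) \<le> enat 1"
    unfolding interval_length_def
  proof (rule chain_height_leI)
    fix n N assume N: "strict_chain (ideal_interval R m (carrier R)) n N"
    have "\<not> 2 \<le> n"
    proof
      assume "2 \<le> n"
      then have "strict_chain (ideal_interval R m (carrier R)) 2 N"
        using strict_chain_le[OF N] by simp
      then have "N 0 \<subset> N 1" "N 1 \<subset> N 2" "m \<subseteq> N 0" "ideal (N 1) R" "N 2 \<subseteq> carrier R"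
        by (auto simp: strict_chain_def ideal_interval_def numeral_2_eq_2)
      then show False using proper_ideal_subset_m[of "N 1"] by auto
    qed
    then show "enat n \<le> enat 1" by simp
  qed
  then have "interval_length R m (carrier R) \<noteq> \<infinity>"
    using enat_ile by fastforce
  then show ?thesis using m_ideal by (simp add: finite_colength_def)
qed

text \<open>A largest counterexample \<open>A\<close> lies strictly below \<open>A + zR\<close> and \<open>A : z\<close>, whose
  colengths add up to the colength of \<open>A\<close>.\<close>

lemma finite_colength_if_m_pow:
  assumes A: "ideal A R" and k: "ideal_pow R m k \<subseteq> A"
  shows "finite_colength R A"
proof (rule ccontr)
  assume no: "\<not> finite_colength R A"
  let ?A = "{A. ideal A R \<and> ideal_pow R m k \<subseteq> A \<and> \<not> finite_colength R A}"
  have "A \<in> ?A" using A no k by auto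
  then have "\<exists>M\<in>?A. \<forall>B\<in>?A. M \<subseteq> B \<longrightarrow> B = M"
    by (rule ideal_family_maximal) simp
  then obtain M where M: "M \<in> ?A" and max': "\<forall>B\<in>?A. M \<subseteq> B \<longrightarrow> B = M"
    by (rule bexE)
  have max: "B \<in> ?A \<Longrightarrow> M \<subseteq> B \<Longrightarrow> B = M" for B
    using max' by blast
  from M have iM: "ideal M R" by simp
  define j where "j = (LEAST j. ideal_pow R m j \<subseteq> M)"
  have j: "ideal_pow R m j \<subseteq> M"
    unfolding j_def by (rule LeastI[of _ k]) (use M in simp)
  have Mc: "M \<noteq> carrier R" using M finite_colength_carrier by auto
  have "j \<noteq> 0" using j Mc ideal_subset_carrier[OF iM] by (auto intro: ccontr)
  then obtain i where i: "j = Suc i" by (cases j) auto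
  have "\<not> ideal_pow R m i \<subseteq> M"
    using not_less_Least[of i "\<lambda>j. ideal_pow R m j \<subseteq> M"] i by (auto simp: j_def)
  then obtain z where z: "z \<in> ideal_pow R m i" "z \<notin> M" by auto
  have zc: "z \<in> carrier R" using z ideal_carrier[OF ideal_pow_ideal[OF m_ideal]] by auto
  let ?C = "mult_plus R z (carrier R) M" and ?D = "colon_elem R M z"
  have iC: "ideal ?C R" by (rule mult_plus_ideal[OF oneideal iM zc])
  have iD: "ideal ?D R" by (rule colon_elem_ideal[OF iM zc])
  have CM: "M \<subseteq> ?C" and DM: "M \<subseteq> ?D"
    using subset_mult_plus[OF oneideal iM zc] subset_colon_elem[OF iM zc] by auto
  have "z \<in> ?C" using mult_in_mult_plus[OF oneideal iM zc one_closed] zc by simp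
  then have "?C \<noteq> M" using z by auto
  then have C: "finite_colength R ?C" using max[OF _ CM] iC CM M by blast
  have "m \<subseteq> ?D"
  proof
    fix a assume a: "a \<in> m"
    then have "a \<otimes> z \<in> M"
      using ideal_prod.prod[OF a z(1), of R] ideal_pow_Suc[OF m_ideal, of i] j i by auto
    then show "a \<in> ?D" using zc ideal_carrier[OF m_ideal a] by (simp add: colon_elem_def m_comm)
  qed
  then have D: "finite_colength R ?D"
    by (rule finite_colength_superset[OF finite_colength_m iD])
  have "?D \<inter> carrier R = ?D" by (auto simp: colon_elem_def)
  then have "interval_length R M ?C = interval_length R ?D (carrier R)"
    using interval_length_mult_plus[OF oneideal iM zc] by simp
  then have "interval_length R M (carrier R) = enat (colength R ?D + colength R ?C)"
    using interval_length_additive[OF oneideal iC iM CM ideal_subset_carrier[OF iC]]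
      interval_length_carrier[OF C] interval_length_carrier[OF D] by simp
  then show False using M by (auto simp: finite_colength_def)
qed

lemma finite_colength_ideal_pow:
  assumes A: "ideal A R" and k: "ideal_pow R m k \<subseteq> A"
  shows "finite_colength R (ideal_pow R A n)"
proof (rule finite_colength_if_m_pow[OF ideal_pow_ideal[OF A]])
  show "ideal_pow R m (k * n) \<subseteq> ideal_pow R A n"
    using ideal_pow_mono[OF ideal_pow_ideal[OF m_ideal] A k, of n] ideal_pow_pow[OF m_ideal] by simp
qed

end

section \<open>Systems of parameters in dimension two\<close>

definition regular_pair :: "('a, 'b) ring_scheme \<Rightarrow> 'a \<Rightarrow> 'a \<Rightarrow> bool" where
  "regular_pair R a b \<longleftrightarrow> a \<in> carrier R \<and> b \<in> carrier R \<and>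
     (\<forall>s\<in>carrier R. a \<otimes>\<^bsub>R\<^esub> s = \<zero>\<^bsub>R\<^esub> \<longrightarrow> s = \<zero>\<^bsub>R\<^esub>) \<and>
     (\<forall>s\<in>carrier R. b \<otimes>\<^bsub>R\<^esub> s \<in> PIdl\<^bsub>R\<^esub> a \<longrightarrow> s \<in> PIdl\<^bsub>R\<^esub> a)"

lemma (in cohen_macaulay_local_ring) obtain_regular_pair:
  assumes "krull_dim R = 2"
  obtains a b where "a \<in> m" "b \<in> m" "regular_pair R a b"
proof -
  let ?S = "{enat (length xs) | xs. regular_sequence R xs \<and> set xs \<subseteq> m}"
  have Sup: "Sup ?S = 2"
    using depth_eq_dim assms by (simp add: ring_depth_def)
  have "\<exists>xs. regular_sequence R xs \<and> set xs \<subseteq> m \<and> length xs = 2"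
  proof (rule ccontr)
    assume no: "\<nexists>xs. regular_sequence R xs \<and> set xs \<subseteq> m \<and> length xs = 2"
    have "Sup ?S \<le> enat 1"
    proof (rule Sup_least)
      fix e assume e: "e \<in> ?S"
      then obtain xs where xs: "e = enat (length xs)" "regular_sequence R xs" "set xs \<subseteq> m" by auto
      have "e \<le> 2" using Sup_upper[OF e] Sup by simp
      then have "length xs \<le> 2" using xs by (simp add: numeral_eq_enat)
      then show "e \<le> enat 1" using no xs by fastforce
    qed
    then show False using Sup by (simp add: numeral_eq_enat)
  qed
  then obtain xs where xs: "regular_sequence R xs" "set xs \<subseteq> m" "length xs = 2" by auto
  then obtain a b where ab: "xs = [a, b]"
    by (auto simp: length_Suc_conv numeral_2_eq_2)
  have c: "a \<in> carrier R" "b \<in> carrier R" using xs ab by (auto simp: regular_sequence_def)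
  have reg: "xs ! i \<otimes> y \<in> Idl (set (take i xs)) \<longrightarrow> y \<in> Idl (set (take i xs))"
    if "i < 2" "y \<in> carrier R" for i y
    using xs that by (auto simp: regular_sequence_def)
  have "Idl {} = {\<zero>}"
    using genideal_minimal[OF zeroideal, of "{}"] ideal_zero[OF genideal_ideal[of "{}"]] by auto
  then have "regular_pair R a b"
    using reg[of 0] reg[of 1] c by (auto simp: regular_pair_def ab cgenideal_eq_genideal)
  then show ?thesis using that xs ab by auto
qed

context noetherian_local_ring
begin

lemma multiplicative_complement_powers:
  assumes P: "primeideal P R" and b: "b \<in> carrier R"
  defines "S \<equiv> {s \<otimes> b [^] n | s n. s \<in> carrier R - P \<and> n \<in> (UNIV::nat set)}"
  shows "\<one> \<in> S" "S \<subseteq> carrier R" "\<And>s t. s \<in> S \<Longrightarrow> t \<in> S \<Longrightarrow> s \<otimes> t \<in> S" "b \<in> S"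
    "carrier R - P \<subseteq> S"
proof -
  interpret P: primeideal P R by fact
  have one: "\<one> \<notin> P" using P.I_notcarr P.one_imp_carrier by blast
  have "\<one> \<otimes> b [^] (0::nat) \<in> S" "\<one> \<otimes> b [^] (1::nat) \<in> S"
    unfolding S_def using one by blast+
  then show "\<one> \<in> S" "b \<in> S" using b by simp_all
  show "S \<subseteq> carrier R" using b by (auto simp: S_def)
  have "s \<otimes> b [^] (0::nat) \<in> S" if "s \<in> carrier R - P" for s
    unfolding S_def using that by blast
  then show "carrier R - P \<subseteq> S" by auto
  fix s t assume "s \<in> S" "t \<in> S"
  then obtain u v n k where *: "u \<in> carrier R - P" "v \<in> carrier R - P"
    "s = u \<otimes> b [^] (n::nat)" "t = v \<otimes> b [^] (k::nat)"
    by (auto simp: S_def)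
  have "s \<otimes> t = (u \<otimes> v) \<otimes> b [^] (n + k)"
    unfolding * using *(1,2) b by (simp add: nat_pow_mult[symmetric] m_ac)
  moreover have "u \<otimes> v \<in> carrier R - P" using * P.I_prime by auto
  ultimately show "s \<otimes> t \<in> S" unfolding S_def by blast
qed

text \<open>If \<open>z\<close> is regular modulo \<open>A\<close>, then \<open>A\<close> misses all products of powers of \<open>z\<close> with elements
  outside \<open>P\<close>, so some prime between \<open>A\<close> and \<open>P\<close> misses \<open>z\<close>.\<close>

lemma prime_below:
  assumes P: "primeideal P R" and A: "ideal A R" "A \<subseteq> P" and z: "z \<in> P"
    and reg: "\<And>s. s \<in> carrier R \<Longrightarrow> z \<otimes> s \<in> A \<Longrightarrow> s \<in> A"
  shows "\<exists>P'. primeideal P' R \<and> A \<subseteq> P' \<and> P' \<subset> P"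
proof -
  interpret P: primeideal P R by fact
  have zc: "z \<in> carrier R" using z by (rule P.Icarr)
  define S where "S = {s \<otimes> z [^] n | s n. s \<in> carrier R - P \<and> n \<in> (UNIV::nat set)}"
  note S = multiplicative_complement_powers[OF P zc, folded S_def]
  have "s \<in> A" if "s \<in> carrier R" "s \<otimes> z [^] (n::nat) \<in> A" for s n
    using that
  proof (induction n)
    case (Suc n)
    have "z \<otimes> (s \<otimes> z [^] n) \<in> A" using Suc.prems zc by (simp add: m_ac)
    then have "s \<otimes> z [^] n \<in> A"
      by (rule reg[rotated]) (simp add: zc Suc.prems(1))
    then show ?case by (rule Suc.IH[OF Suc.prems(1)])
  qed simp
  then have "A \<inter> S = {}" using A(2) by (auto simp: S_def)
  then obtain P' where P': "primeideal P' R" "A \<subseteq> P'" "P' \<inter> S = {}"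
    using prime_ideal_disjoint[OF A(1) S(1,2,3)] by blast
  have "P' \<subseteq> carrier R" using P'(1) ideal_subset_carrier primeideal.axioms(1) by blast
  then have "P' \<subseteq> P" using P'(3) S(5) by auto
  moreover have "z \<notin> P'" using P'(3) S(4) by auto
  ultimately show ?thesis using P' z by blast
qed

text \<open>A prime \<open>P \<noteq> m\<close> containing \<open>a\<close> and \<open>b\<close> would start a chain \<open>m \<supset> P \<supset> P1 \<supset> P0\<close>, too long
  for the dimension: the pair is regular, so \<open>b\<close> yields a smaller prime \<open>P1\<close> above \<open>a\<close>, and \<open>a\<close> yields a still smaller
  \<open>P0\<close>. So \<open>m\<close> is the only prime containing \<open>a\<close> and \<open>b\<close>.\<close>

lemma regular_pair_m_primary:
  assumes dim: "krull_dim R \<le> 2" and reg: "regular_pair R a b" and ab: "a \<in> m" "b \<in> m"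
  shows "\<exists>k. ideal_pow R m k \<subseteq> two_gen R a b (carrier R)"
proof -
  let ?Q = "two_gen R a b (carrier R)"
  have c: "a \<in> carrier R" "b \<in> carrier R" using reg by (auto simp: regular_pair_def)
  note iQ = two_gen_ideal[OF oneideal c]
  have Pm: "P = m" if P: "primeideal P R" "?Q \<subseteq> P" for P
  proof (rule ccontr)
    assume "P \<noteq> m"
    interpret P: primeideal P R by fact
    have "P \<subset> m"
      using proper_ideal_subset_m[OF P.is_ideal] P.I_notcarr \<open>P \<noteq> m\<close> by auto
    have abP: "a \<in> P" "b \<in> P" using two_gen_generators[OF c] P by auto
    have "PIdl a \<subseteq> P" by (rule cgenideal_minimal[OF P.is_ideal abP(1)])
    then obtain P1 where P1: "primeideal P1 R" "PIdl a \<subseteq> P1" "P1 \<subset> P"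
      using prime_below[OF P(1) cgenideal_ideal[OF c(1)] _ abP(2)] reg
      unfolding regular_pair_def by blast
    have "a \<in> P1" using P1(2) cgenideal_self[OF c(1)] by auto
    moreover have "{\<zero>} \<subseteq> P1" using P1(1) ideal_zero primeideal.axioms(1) by blast
    ultimately obtain P0 where P0: "primeideal P0 R" "P0 \<subset> P1"
      using prime_below[OF P1(1) zeroideal, of a] reg unfolding regular_pair_def by blast
    define N where "N = (\<lambda>i::nat. if i = 0 then P0 else if i = 1 then P1 else if i = 2 then P else m)"
    have "(\<forall>i\<le>3. primeideal (N i) R) \<and> (\<forall>i<3. N i \<subset> N (Suc i))"
      using P0 P1 P(1) \<open>P \<subset> m\<close> maximalideal_prime[OF maximalideal_m]
      by (auto simp: N_def less_Suc_eq numeral_3_eq_3)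
    then have "enat 3 \<le> krull_dim R"
      unfolding krull_dim_def by (intro Sup_upper) blast
    then have "enat 3 \<le> enat 2" using order_trans[OF _ dim, of "enat 3"] by (simp add: numeral_eq_enat)
    then show False by simp
  qed
  show ?thesis
  proof (rule m_pow_subset_if_radical[OF iQ])
    fix t assume t: "t \<in> m"
    then have tc: "t \<in> carrier R" using ideal_carrier[OF m_ideal] by auto
    show "\<exists>n. t [^] (n::nat) \<in> ?Q"
    proof (rule ccontr)
      assume no: "\<nexists>n. t [^] (n::nat) \<in> ?Q"
      have one: "t [^] (0::nat) = \<one>" "t [^] (1::nat) = t" using tc by simp_all
      obtain P where P: "primeideal P R" "?Q \<subseteq> P" "P \<inter> range (\<lambda>n::nat. t [^] n) = {}"
      proof (rule prime_ideal_disjoint[OF iQ, of "range (\<lambda>n::nat. t [^] n)"])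
        show "\<one> \<in> range (\<lambda>n::nat. t [^] n)" using one(1) by (metis rangeI)
        show "u \<otimes> v \<in> range (\<lambda>n::nat. t [^] n)"
          if "u \<in> range (\<lambda>n::nat. t [^] n)" "v \<in> range (\<lambda>n::nat. t [^] n)" for u v
          using that nat_pow_mult[OF tc] by auto
      qed (use no tc in auto)
      then have "t \<in> P" using Pm t by auto
      then show False using P(3) one(2) by (metis IntI empty_iff rangeI)
    qed
  qed
qed

text \<open>In homological terms: \<open>x\<close> and \<open>y\<close> annihilate the first Koszul homology module of
  \<open>x, y\<close>, hence so do a power \<open>a\<^sup>k\<close> and a power \<open>b\<^sup>l\<close>, and regularity of \<open>a, b\<close> forces this
  module to vanish.\<close>

lemma koszul_syzygies_if_m_primary:
  assumes reg: "regular_pair R a b" and ab: "a \<in> m" "b \<in> m"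
    and x: "x \<in> carrier R" and y: "y \<in> carrier R"
    and prim: "ideal_pow R m k \<subseteq> two_gen R x y (carrier R)"
  shows "koszul_syzygies R x y"
proof -
  have c: "a \<in> carrier R" "b \<in> carrier R" using reg by (auto simp: regular_pair_def)
  have a_reg: "s = \<zero>" if "s \<in> carrier R" "a \<otimes> s = \<zero>" for s
    using reg that by (auto simp: regular_pair_def)
  have b_reg: "s \<in> PIdl a" if "s \<in> carrier R" "b \<otimes> s \<in> PIdl a" for s
    using reg that by (auto simp: regular_pair_def)
  define A where "A = a [^] k"
  define B where "B = b [^] k"
  have Ac: "A \<in> carrier R" "B \<in> carrier R" using c by (auto simp: A_def B_def)
  have "A \<in> two_gen R x y (carrier R)" "B \<in> two_gen R x y (carrier R)"
    unfolding A_def B_def using elem_pow_in_ideal_pow[OF m_ideal] ab prim by auto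
  then obtain al be ga de where A: "al \<in> carrier R" "be \<in> carrier R" "A = x \<otimes> al \<oplus> y \<otimes> be"
    and B: "ga \<in> carrier R" "de \<in> carrier R" "B = x \<otimes> ga \<oplus> y \<otimes> de"
    by (auto simp: two_gen_def)
  have rega: "s = \<zero>" if "s \<in> carrier R" "a [^] (n::nat) \<otimes> s = \<zero>" for s n
    using that
  proof (induction n)
    case (Suc n)
    have "a \<otimes> (a [^] n \<otimes> s) = \<zero>" using Suc.prems c by (simp add: m_ac)
    moreover have "a [^] n \<otimes> s \<in> carrier R" using Suc.prems c by simp
    ultimately have "a [^] n \<otimes> s = \<zero>" using a_reg by blast
    then show ?case by (rule Suc.IH[OF Suc.prems(1)])
  qed simp
  have regb1: "\<exists>t\<in>carrier R. s = a [^] n \<otimes> t"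
    if "s \<in> carrier R" "r \<in> carrier R" "b \<otimes> s = a [^] (n::nat) \<otimes> r" for s r n
    using that
  proof (induction n arbitrary: s)
    case 0
    then show ?case by (auto intro!: bexI[of _ s])
  next
    case (Suc n)
    have "b \<otimes> s = (a [^] n \<otimes> r) \<otimes> a" using Suc.prems c by (simp add: m_ac)
    then have "b \<otimes> s \<in> PIdl a" using Suc.prems c by (auto simp: cgenideal_def)
    then have "s \<in> PIdl a" by (rule b_reg[OF Suc.prems(1)])
    then obtain s' where s': "s' \<in> carrier R" "s = s' \<otimes> a" by (auto simp: cgenideal_def)
    have "a \<otimes> (b \<otimes> s' \<ominus> a [^] n \<otimes> r) = b \<otimes> s \<ominus> (a [^] n \<otimes> r) \<otimes> a"
      unfolding s' using c s'(1) Suc.prems(2) nat_pow_closed[OF c(1), of n] by algebra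
    also have "\<dots> = \<zero>" using \<open>b \<otimes> s = (a [^] n \<otimes> r) \<otimes> a\<close> c Suc.prems by simp
    finally have "b \<otimes> s' \<ominus> a [^] n \<otimes> r = \<zero>"
      by (rule a_reg[rotated]) (simp add: c s'(1) Suc.prems(2))
    then have "b \<otimes> s' = a [^] n \<otimes> r"
      using r_right_minus_eq[of "b \<otimes> s'" "a [^] n \<otimes> r"] c s'(1) Suc.prems(2) by simp
    then obtain t where "t \<in> carrier R" "s' = a [^] n \<otimes> t"
      using Suc.IH[OF s'(1) Suc.prems(2)] by blast
    then show ?case using c s' by (auto simp: m_ac intro!: bexI[of _ t])
  qed
  have regb: "\<exists>t\<in>carrier R. s = A \<otimes> t"
    if "s \<in> carrier R" "r \<in> carrier R" "b [^] (n::nat) \<otimes> s = A \<otimes> r" for s r n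
    using that
  proof (induction n arbitrary: s r)
    case 0
    then show ?case by auto
  next
    case (Suc n)
    have "b \<otimes> (b [^] n \<otimes> s) = A \<otimes> r" using Suc.prems c by (simp add: m_ac)
    then obtain t where "t \<in> carrier R" "b [^] n \<otimes> s = A \<otimes> t"
      using regb1[of "b [^] n \<otimes> s" r k] Suc.prems c by (auto simp: A_def)
    then show ?case by (intro Suc.IH[OF Suc.prems(1)])
  qed
  have "\<exists>t\<in>carrier R. p = y \<otimes> t \<and> q = \<ominus> (x \<otimes> t)"
    if pq: "p \<in> carrier R" "q \<in> carrier R" "x \<otimes> p \<oplus> y \<otimes> q = \<zero>" for p q
  proof -
    have xp: "x \<otimes> p = \<ominus> (y \<otimes> q)" using pq x y by (simp add: minus_equality)
    define s where "s = be \<otimes> p \<ominus> al \<otimes> q"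
    have s: "s \<in> carrier R" using A pq by (simp add: s_def)
    have Ap: "A \<otimes> p = y \<otimes> s"
    proof -
      have "A \<otimes> p = al \<otimes> (x \<otimes> p) \<oplus> y \<otimes> be \<otimes> p"
        unfolding A using A(1,2) pq(1) x y by algebra
      also have "\<dots> = y \<otimes> s"
        unfolding xp s_def using A(1,2) pq(1,2) x y by algebra
      finally show ?thesis .
    qed
    have Aq: "A \<otimes> q = \<ominus> (x \<otimes> s)"
    proof -
      have "\<ominus> (x \<otimes> s) = x \<otimes> al \<otimes> q \<oplus> \<ominus> (be \<otimes> (x \<otimes> p))"
        unfolding s_def using A(1,2) pq(1,2) x y by algebra
      also have "\<dots> = A \<otimes> q"
        unfolding xp A using A(1,2) pq(1,2) x y by algebra
      finally show ?thesis by simp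
    qed
    have "B \<otimes> s = ga \<otimes> (x \<otimes> s) \<oplus> de \<otimes> (y \<otimes> s)"
      unfolding B using B(1,2) s x y by algebra
    also have "\<dots> = ga \<otimes> (\<ominus> (A \<otimes> q)) \<oplus> de \<otimes> (A \<otimes> p)"
      unfolding Ap Aq using s x by simp
    also have "\<dots> = A \<otimes> (de \<otimes> p \<ominus> ga \<otimes> q)"
      using B(1,2) pq(1,2) Ac by algebra
    finally obtain t where t: "t \<in> carrier R" "s = A \<otimes> t"
      using regb[of s "de \<otimes> p \<ominus> ga \<otimes> q" k] s B pq by (auto simp: B_def)
    have "A \<otimes> (p \<ominus> y \<otimes> t) = A \<otimes> p \<ominus> y \<otimes> s"
      unfolding t using t(1) Ac pq y by algebra
    also have "\<dots> = \<zero>" unfolding Ap using s y by simp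
    finally have "p \<ominus> y \<otimes> t = \<zero>"
      using rega[of "p \<ominus> y \<otimes> t" k] t pq y by (simp add: A_def)
    moreover have "A \<otimes> (q \<oplus> x \<otimes> t) = A \<otimes> q \<oplus> x \<otimes> s"
      unfolding t using t(1) Ac pq x by algebra
    then have "A \<otimes> (q \<oplus> x \<otimes> t) = \<zero>" unfolding Aq using s x by (simp add: l_neg)
    then have "q \<oplus> x \<otimes> t = \<zero>"
      using rega[of "q \<oplus> x \<otimes> t" k] t pq x by (simp add: A_def)
    ultimately have "p = y \<otimes> t" "q = \<ominus> (x \<otimes> t)"
      using t pq x y by (simp_all add: minus_equality[symmetric])
    then show ?thesis using t by blast
  qed
  then show ?thesis using x y by (auto simp: koszul_syzygies_def)
qed

end

section \<open>Minimal reductions have two generators\<close>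

context noetherian_local_ring
begin

text \<open>The residue field is only used through these elements, whose differences are units.\<close>

lemma residue_sequence:
  assumes "infinite (carrier (R Quot m))"
  obtains c :: "nat \<Rightarrow> 'a" where "\<And>p. c p \<in> carrier R" "\<And>p q. p \<noteq> q \<Longrightarrow> c p \<ominus> c q \<notin> m"
proof -
  have eq: "carrier (R Quot m) = (\<lambda>a. m +> a) ` carrier R"
    by (auto simp: FactRing_def A_RCOSETS_def')
  obtain f :: "nat \<Rightarrow> 'a set" where f: "inj f" "range f \<subseteq> carrier (R Quot m)"
    using infinite_countable_subset[OF assms] by blast
  have "\<exists>a. a \<in> carrier R \<and> f p = m +> a" for p
    using f(2) eq by blast
  then obtain c where c: "\<And>p. c p \<in> carrier R \<and> f p = m +> c p" by metis
  have "c p \<ominus> c q \<notin> m" if "p \<noteq> q" for p q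
    using quotient_eq_iff_same_a_r_cos[OF m_ideal, of "c p" "c q"] c f(1) that
    by (metis injD)
  then show ?thesis using that[of c] c by blast
qed

text \<open>If each \<open>e\<^sub>i\<close> is excluded by some ideal \<open>M\<^sub>i\<close> that contains \<open>K\<close> and all \<open>e\<^sub>j\<close> of lower or
  equal rank, then adjoining the \<open>e\<^sub>i\<close> to \<open>K\<close> by increasing rank is a strict chain.\<close>

lemma card_le_interval_length:
  fixes rank :: "'i \<Rightarrow> nat"
  assumes K: "ideal K R" and N: "ideal N R" and "K \<subseteq> N" and "finite E"
    and e: "\<And>i. i \<in> E \<Longrightarrow> e i \<in> N"
    and M: "\<And>i. i \<in> E \<Longrightarrow> ideal (M i) R" "\<And>i. i \<in> E \<Longrightarrow> K \<subseteq> M i" "\<And>i. i \<in> E \<Longrightarrow> e i \<notin> M i"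
      "\<And>i j. i \<in> E \<Longrightarrow> j \<in> E \<Longrightarrow> j \<noteq> i \<Longrightarrow> rank j \<le> rank i \<Longrightarrow> e j \<in> M i"
  shows "enat (card E) \<le> interval_length R K N"
proof -
  have "S \<subseteq> E \<Longrightarrow> \<exists>G. ideal G R \<and> K \<subseteq> G \<and> G \<subseteq> N \<and> enat (card S) \<le> interval_length R K G \<and>
      (\<forall>A. ideal A R \<and> K \<subseteq> A \<and> e ` S \<subseteq> A \<longrightarrow> G \<subseteq> A)" if "finite S" for S
    using that
  proof (induction S rule: finite_ranking_induct[where f = rank])
    case empty
    then show ?case
      using K \<open>K \<subseteq> N\<close> by (intro exI[of _ K]) (simp add: zero_enat_def[symmetric])
  next
    case (insert x S)
    show ?case
    proof (cases "x \<in> S")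
      case True
      then show ?thesis using insert by (simp add: insert_absorb)
    next
      case False
      obtain G where G: "ideal G R" "K \<subseteq> G" "G \<subseteq> N" "enat (card S) \<le> interval_length R K G"
        and least: "\<And>A. ideal A R \<Longrightarrow> K \<subseteq> A \<Longrightarrow> e ` S \<subseteq> A \<Longrightarrow> G \<subseteq> A"
        using insert by auto
      have x: "x \<in> E" using insert by auto
      have ex: "e x \<in> carrier R" using ideal_carrier[OF N e[OF x]] .
      let ?G = "mult_plus R (e x) (carrier R) G"
      have iG: "ideal ?G R" by (rule mult_plus_ideal[OF oneideal G(1) ex])
      have GG: "G \<subseteq> ?G" by (rule subset_mult_plus[OF oneideal G(1) ex])
      have "e ` S \<subseteq> M x" using M(4)[OF x] insert False by blast
      then have "e x \<notin> G" using least[OF M(1,2)[OF x]] M(3)[OF x] by blast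
      moreover have "e x \<in> ?G"
        using mult_in_mult_plus[OF oneideal G(1) ex one_closed] ex by simp
      ultimately have "interval_length R G ?G \<noteq> 0"
        using interval_length_eq_0_iff[OF iG G(1) GG] by auto
      then have "enat 1 \<le> interval_length R G ?G"
        by (cases "interval_length R G ?G") (auto simp: zero_enat_def)
      then have "enat (card S) + enat 1 \<le> interval_length R K G + interval_length R G ?G"
        using G(4) by (rule add_mono[rotated])
      moreover have "card (insert x S) = card S + 1"
        using False insert by simp
      ultimately have "enat (card (insert x S)) \<le> interval_length R K ?G"
        using interval_length_additive[OF iG G(1) K G(2) GG] by simp
      moreover have "?G \<subseteq> N"
        using G e[OF x] by (intro mult_plus_subset N ideal_mult'[OF N])
      moreover have "?G \<subseteq> A" if "ideal A R \<and> K \<subseteq> A \<and> e ` insert x S \<subseteq> A" for A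
        using that least[of A] by (intro mult_plus_subset ideal_mult') auto
      ultimately show ?thesis using iG GG G(2) by (intro exI[of _ ?G]) auto
    qed
  qed
  from this[OF \<open>finite E\<close> order_refl] obtain G where G: "ideal G R" "K \<subseteq> G" "G \<subseteq> N"
    "enat (card E) \<le> interval_length R K G" by blast
  note G(4)
  also have "interval_length R K G \<le> interval_length R K N"
    using interval_length_additive[OF N G(1) K G(2,3)] by simp
  finally show ?thesis .
qed

end

text \<open>The product \<open>(y - c\<^sub>0 x) \<cdots> (y - c\<^bsub>i-1\<^esub> x)\<close>, a homogeneous Newton basis
  polynomial. It vanishes at the nodes \<open>y = c\<^sub>p x\<close> with \<open>p < i\<close>; replacing monomials by such
  products makes evaluation at the nodes triangular, so that linear independence can be read off
  without discussing polynomials.\<close>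

primrec lin_prod :: "('a, 'b) ring_scheme \<Rightarrow> 'a \<Rightarrow> 'a \<Rightarrow> (nat \<Rightarrow> 'a) \<Rightarrow> nat \<Rightarrow> 'a" where
  "lin_prod R y x c 0 = \<one>\<^bsub>R\<^esub>"
| "lin_prod R y x c (Suc i) = lin_prod R y x c i \<otimes>\<^bsub>R\<^esub> (y \<ominus>\<^bsub>R\<^esub> c i \<otimes>\<^bsub>R\<^esub> x)"

context cring
begin

lemma lin_prod_carrier:
  "x \<in> carrier R \<Longrightarrow> y \<in> carrier R \<Longrightarrow> (\<And>p. c p \<in> carrier R) \<Longrightarrow> lin_prod R y x c i \<in> carrier R"
  by (induction i) auto

lemma ideal_pow_prod_mem:
  assumes "ideal J R" "a \<in> ideal_pow R J i" "b \<in> ideal_pow R J k"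
  shows "a \<otimes> b \<in> ideal_pow R J (i + k)"
  using ideal_prod.prod[OF assms(2,3), of R] ideal_pow_add[OF assms(1)] by simp

lemma lin_factor_mem:
  assumes J: "ideal J R" and "x \<in> J" "y \<in> J" "c \<in> carrier R"
  shows "y \<ominus> c \<otimes> x \<in> J"
  using assms by (intro ideal_minus ideal_mult)

lemma lin_prod_mem:
  assumes J: "ideal J R" and xy: "x \<in> J" "y \<in> J" and c: "\<And>p. c p \<in> carrier R"
  shows "lin_prod R y x c i \<in> ideal_pow R J i"
proof (induction i)
  case (Suc i)
  then show ?case
    using ideal_pow_prod_mem[OF J Suc, where b = "y \<ominus> c i \<otimes> x" and k = 1] lin_factor_mem[OF J xy c]
      ideal_pow_1[OF J] by simp
qed simp

lemma lin_prod_factor: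
  assumes J: "ideal J R" and xy: "x \<in> J" "y \<in> J" and c: "\<And>p. c p \<in> carrier R" and "k < i"
  shows "\<exists>w \<in> ideal_pow R J (i - 1). lin_prod R y x c i = w \<otimes> (y \<ominus> c k \<otimes> x)"
  using \<open>k < i\<close>
proof (induction i)
  case (Suc i)
  have mem: "y \<ominus> c p \<otimes> x \<in> J" for p by (rule lin_factor_mem[OF J xy c])
  note car = ideal_carrier[OF J mem]
  show ?case
  proof (cases "k = i")
    case True
    then show ?thesis using lin_prod_mem[OF J xy, of c i] c by auto
  next
    case False
    then obtain w where w: "w \<in> ideal_pow R J (i - 1)" "lin_prod R y x c i = w \<otimes> (y \<ominus> c k \<otimes> x)"
      using Suc by auto
    have wc: "w \<in> carrier R" using w ideal_carrier[OF ideal_pow_ideal[OF J]] by auto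
    have "w \<otimes> (y \<ominus> c i \<otimes> x) \<in> ideal_pow R J (i - 1 + 1)"
      using mem ideal_pow_1[OF J] by (intro ideal_pow_prod_mem[OF J w(1)]) simp
    moreover have "i - 1 + 1 = i" using False Suc by simp
    moreover have "lin_prod R y x c (Suc i) = w \<otimes> (y \<ominus> c i \<otimes> x) \<otimes> (y \<ominus> c k \<otimes> x)"
      using w wc car[of i] car[of k] by (simp add: m_ac)
    ultimately show ?thesis by auto
  qed
qed simp

end

context noetherian_local_ring
begin

text \<open>Modulo an ideal \<open>M\<close> containing \<open>(y - gx)J\<^bsup>n-1\<^esup>\<close>, each factor \<open>y - c\<^sub>p x\<close> acts on
  \<open>J\<^bsup>n-1\<^esup>\<close> as \<open>(g - c\<^sub>p)x\<close>, that is as \<open>x\<close> up to a unit.\<close>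

lemma lin_prod_cancel:
  assumes J: "ideal J R" and xy: "x \<in> J" "y \<in> J" and c: "\<And>p. c p \<in> carrier R"
    and M: "ideal M R" and g: "g \<in> carrier R"
    and Mg: "\<And>w. w \<in> ideal_pow R J n \<Longrightarrow> (y \<ominus> g \<otimes> x) \<otimes> w \<in> M"
    and unit: "\<And>p. p < i \<Longrightarrow> g \<ominus> c p \<notin> m"
    and "i \<le> Suc n" and z: "z \<in> ideal_pow R J (Suc n - i)" and mem: "lin_prod R y x c i \<otimes> z \<in> M"
  shows "x [^] i \<otimes> z \<in> M"
  using unit \<open>i \<le> Suc n\<close> z mem
proof (induction i arbitrary: z)
  case (Suc i)
  have cx: "x \<in> carrier R" "y \<in> carrier R" using ideal_carrier[OF J] xy by auto
  have cz: "z \<in> carrier R" using Suc.prems(3) ideal_carrier[OF ideal_pow_ideal[OF J]] by auto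
  have cl: "lin_prod R y x c i \<in> carrier R"
    using lin_prod_carrier[of x y c] cx c by blast
  have cxi: "x [^] i \<in> carrier R" using cx by simp
  have eq: "Suc n - i = 1 + (Suc n - Suc i)" using Suc.prems(2) by simp
  have "(y \<ominus> c i \<otimes> x) \<otimes> z \<in> ideal_pow R J (1 + (Suc n - Suc i))"
    using Suc.prems(3) lin_factor_mem[OF J xy c] ideal_pow_1[OF J]
    by (intro ideal_pow_prod_mem[OF J]) simp_all
  moreover have "lin_prod R y x c i \<otimes> ((y \<ominus> c i \<otimes> x) \<otimes> z) \<in> M"
    using Suc.prems(4) cl cx cz c[of i] by (simp add: m_assoc)
  ultimately have mem: "x [^] i \<otimes> ((y \<ominus> c i \<otimes> x) \<otimes> z) \<in> M"
    using Suc.prems(1,2) by (intro Suc.IH) (auto simp: eq)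
  have "x [^] i \<otimes> z \<in> ideal_pow R J (i + (Suc n - Suc i))"
    by (rule ideal_pow_prod_mem[OF J elem_pow_in_ideal_pow[OF J xy(1)] Suc.prems(3)])
  moreover have "i + (Suc n - Suc i) = n" using Suc.prems(2) by simp
  ultimately have "(y \<ominus> g \<otimes> x) \<otimes> (x [^] i \<otimes> z) \<in> M" using Mg by simp
  then have "x [^] i \<otimes> ((y \<ominus> c i \<otimes> x) \<otimes> z) \<ominus> (y \<ominus> g \<otimes> x) \<otimes> (x [^] i \<otimes> z) \<in> M"
    using mem by (intro ideal_minus[OF M])
  moreover have "x [^] i \<otimes> ((y \<ominus> c i \<otimes> x) \<otimes> z) \<ominus> (y \<ominus> g \<otimes> x) \<otimes> (x [^] i \<otimes> z)
      = (g \<ominus> c i) \<otimes> (x [^] i \<otimes> x \<otimes> z)"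
    using cx cz cxi g c[of i] by algebra
  ultimately have "(g \<ominus> c i) \<otimes> (x [^] i \<otimes> x \<otimes> z) \<in> M" by (simp only:)
  then have "x [^] i \<otimes> x \<otimes> z \<in> M"
    by (rule cancel_unit[OF M, rotated 3]) (use Suc.prems(1)[of i] cx cz cxi g c[of i] in simp_all)
  then show ?case using cx by simp
qed (use ideal_carrier[OF ideal_pow_ideal[OF J]] in simp)

text \<open>In the expansion of \<open>(xR + J')\<^bsup>n+1\<^esup>\<close> every term except the pure power of \<open>x\<close> has a factor
  from \<open>J'\<close>.\<close>

lemma ideal_pow_Suc_subset_mult_plus:
  assumes J: "ideal J R" and J': "ideal J' R" "J' \<subseteq> J" and x: "x \<in> J"
    and gen: "J \<subseteq> mult_plus R x (carrier R) J'"
  shows "ideal_pow R J (Suc n) \<subseteq> mult_plus R (x [^] Suc n) (carrier R) (J' \<cdot> ideal_pow R J n)"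
proof (induction n)
  case 0
  then show ?case using gen ideal_pow_1[OF J] ideal_prod_one[OF J'(1)] ideal_carrier[OF J x] by simp
next
  case (Suc n)
  let ?W = "J' \<cdot> ideal_pow R J (Suc n)"
  let ?X = "mult_plus R (x [^] Suc (Suc n)) (carrier R) ?W"
  have xc: "x \<in> carrier R" using ideal_carrier[OF J x] .
  note iJn = ideal_pow_ideal[OF J]
  have iW: "ideal ?W R" by (rule ideal_prod_is_ideal[OF J'(1) iJn])
  have iX: "ideal ?X R" by (rule mult_plus_ideal[OF oneideal iW]) (use xc in simp)
  have WX: "?W \<subseteq> ?X" by (rule subset_mult_plus[OF oneideal iW]) (use xc in simp)
  have "J \<cdot> ideal_pow R J (Suc n) \<subseteq> ?X"
  proof (rule ideal_prod_least[OF iX])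
    fix a b assume a: "a \<in> J" and b: "b \<in> ideal_pow R J (Suc n)"
    obtain r a' where r: "r \<in> carrier R" "a' \<in> J'" "a = x \<otimes> r \<oplus> a'"
      using a gen by (auto simp: mult_plus_def)
    have "b \<in> mult_plus R (x [^] Suc n) (carrier R) (J' \<cdot> ideal_pow R J n)" using b Suc by blast
    then obtain s b' where s: "s \<in> carrier R" "b' \<in> J' \<cdot> ideal_pow R J n" "b = x [^] Suc n \<otimes> s \<oplus> b'"
      unfolding mult_plus_def by blast
    have c: "a' \<in> carrier R" "b' \<in> carrier R" "b \<in> carrier R" "x [^] Suc n \<in> carrier R"
      using ideal_carrier[OF J'(1) r(2)] ideal_carrier[OF ideal_prod_is_ideal[OF J'(1) iJn] s(2)]
        ideal_carrier[OF iJn b] xc by auto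
    have "a \<otimes> b = (a' \<otimes> b \<oplus> r \<otimes> (x \<otimes> b')) \<oplus> (x [^] Suc n \<otimes> x) \<otimes> (r \<otimes> s)"
      unfolding r(3) s(3) using c r(1) s(1) xc by algebra
    moreover have "a' \<otimes> b \<in> ?X" using subsetD[OF WX ideal_prod.prod[OF r(2) b]] .
    moreover have "x \<otimes> b' \<in> ?X"
    proof -
      have "x \<otimes> b' \<in> J \<cdot> (J' \<cdot> ideal_pow R J n)" using x s(2) by (rule ideal_prod.prod)
      also have "J \<cdot> (J' \<cdot> ideal_pow R J n) = J' \<cdot> (J \<cdot> ideal_pow R J n)"
        using ideal_prod_assoc[OF J J'(1) iJn] ideal_prod_assoc[OF J'(1) J iJn]
          ideal_prod_commute[OF J J'(1)] by simp
      also have "\<dots> = ?W" using ideal_pow_Suc[OF J] by simp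
      finally show ?thesis using WX by blast
    qed
    moreover have "(x [^] Suc n \<otimes> x) \<otimes> (r \<otimes> s) \<in> ?X"
      using mult_in_mult_plus[OF oneideal iW, of "x [^] Suc (Suc n)" "r \<otimes> s"] xc r s by simp
    ultimately show "a \<otimes> b \<in> ?X"
      by (simp only:) (intro ideal_add[OF iX] ideal_mult[OF iX _ r(1)])
  qed
  then show ?case using ideal_pow_Suc[OF J, of "Suc n"] by simp
qed

text \<open>\<open>J' g h\<close> stands for the ideal obtained from generators \<open>x1, x2, x3, \<dots>\<close> of \<open>J\<close> by
  discarding \<open>x3\<close> after the change \<open>x1 - g x3, x2 - h x3\<close>. Suppose it is never a reduction of
  \<open>J\<close>. Then, by Nakayama's lemma, \<open>x3\<^bsup>n+1\<^esup>\<close> never lies in \<open>M n g h = J' J\<^sup>n + mJ\<^bsup>n+1\<^esup>\<close>. For a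
  grid of values \<open>g = c\<^sub>i\<close>, \<open>h = c\<^sub>j\<close> the products
  \<open>e\<^bsub>ij\<^esub> = \<Prod>\<^bsub>p<i\<^esub>(x1 - c\<^sub>p x3) \<Prod>\<^bsub>q<j\<^esub>(x2 - c\<^sub>q x3) x3\<^bsup>n+1-i-j\<^esup>\<close>
  are then triangular with respect to the ideals \<open>M n c\<^sub>i c\<^sub>j\<close>: modulo \<open>M n c\<^sub>i c\<^sub>j\<close> the product
  \<open>e\<^bsub>ij\<^esub>\<close> is a unit times \<open>x3\<^bsup>n+1\<^esup>\<close>, whereas \<open>e\<^bsub>i'j'\<^esub>\<close> vanishes if \<open>i' > i\<close> or \<open>j' > j\<close>. So
  \<open>J\<^bsup>n+1\<^esup>/mJ\<^bsup>n+1\<^esup>\<close> has length at least the number of these products, of order \<open>n\<^sup>2\<close>, and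
  the colengths of the powers of \<open>J\<close> grow cubically, against the bound.\<close>

lemma specialised_reduction_exists:
  fixes c :: "nat \<Rightarrow> 'a"
  assumes J: "ideal J R" and Jm: "J \<subseteq> m" and x: "x1 \<in> J" "x2 \<in> J" "x3 \<in> J"
    and c: "\<And>p. c p \<in> carrier R" "\<And>p q. p \<noteq> q \<Longrightarrow> c p \<ominus> c q \<notin> m"
    and J': "\<And>g h. g \<in> carrier R \<Longrightarrow> h \<in> carrier R \<Longrightarrow> ideal (J' g h) R \<and> J' g h \<subseteq> J \<and>
       x1 \<ominus> g \<otimes> x3 \<in> J' g h \<and> x2 \<ominus> h \<otimes> x3 \<in> J' g h \<and> J \<subseteq> mult_plus R x3 (carrier R) (J' g h)"
    and fin: "\<And>n. finite_colength R (ideal_pow R J n)"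
    and bound: "\<And>n. colength R (ideal_pow R J n) \<le> D * n ^ 2"
  shows "\<exists>n g h. g \<in> carrier R \<and> h \<in> carrier R \<and> J' g h \<cdot> ideal_pow R J n = ideal_pow R J (Suc n)"
proof (rule ccontr)
  assume "\<not> ?thesis"
  then have no: "J' g h \<cdot> ideal_pow R J n \<noteq> ideal_pow R J (Suc n)"
    if "g \<in> carrier R" "h \<in> carrier R" for g h n
    using that by blast
  note iJ = ideal_pow_ideal[OF J]
  have xc: "x1 \<in> carrier R" "x2 \<in> carrier R" "x3 \<in> carrier R" using x ideal_carrier[OF J] by auto
  define M where "M = (\<lambda>n g h. J' g h \<cdot> ideal_pow R J n <+>\<^bsub>R\<^esub> m \<cdot> ideal_pow R J (Suc n))"
  have iM: "ideal (M n g h) R" and JM: "J' g h \<cdot> ideal_pow R J n \<subseteq> M n g h"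
    and mM: "m \<cdot> ideal_pow R J (Suc n) \<subseteq> M n g h"
    if "g \<in> carrier R" "h \<in> carrier R" for n g h
  proof -
    have A: "ideal (J' g h \<cdot> ideal_pow R J n) R" "ideal (m \<cdot> ideal_pow R J (Suc n)) R"
      using J'[OF that] m_ideal iJ by (auto intro!: ideal_prod_is_ideal)
    show "ideal (M n g h) R" "J' g h \<cdot> ideal_pow R J n \<subseteq> M n g h"
      "m \<cdot> ideal_pow R J (Suc n) \<subseteq> M n g h"
      unfolding M_def using add_ideals[OF A] set_add_subset[OF A] by auto
  qed
  have notin: "x3 [^] Suc n \<notin> M n g h" if gh: "g \<in> carrier R" "h \<in> carrier R" for n g h
  proof
    assume mem: "x3 [^] Suc n \<in> M n g h"
    have "ideal_pow R J (Suc n) \<subseteq> mult_plus R (x3 [^] Suc n) (carrier R) (J' g h \<cdot> ideal_pow R J n)"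
      using J'[OF gh] by (intro ideal_pow_Suc_subset_mult_plus J x) auto
    also have "\<dots> \<subseteq> M n g h"
      by (intro mult_plus_subset iM JM gh ideal_mult'[OF iM[OF gh] mem])
    finally have sub: "ideal_pow R J (Suc n) \<subseteq> J' g h \<cdot> ideal_pow R J n <+>\<^bsub>R\<^esub> m \<cdot> ideal_pow R J (Suc n)"
      by (simp only: M_def)
    have "J' g h \<cdot> ideal_pow R J n \<subseteq> ideal_pow R J (Suc n)"
      using J'[OF gh] ideal_pow_Suc[OF J, of n] ideal_prod_mono[of "J' g h" J] by simp
    then show False
      using nakayama[OF _ iJ _ sub] no[OF gh, of n] J'[OF gh] ideal_prod_is_ideal[OF _ iJ] by metis
  qed
  have step: "colength R (ideal_pow R J (2 * k + 1)) + (k + 1)\<^sup>2 \<le> colength R (ideal_pow R J (2 * k + 2))" for k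
  proof -
    \<comment> \<open>With exponents \<open>i, j \<le> k\<close> and total degree \<open>2k + 1\<close>, the third exponent is positive.\<close>
    define n where "n = 2 * k"
    let ?N = "ideal_pow R J (Suc n)" and ?E = "{..k} \<times> {..k}"
    let ?K = "m \<cdot> ?N"
    define e where "e = (\<lambda>(i, j). lin_prod R x1 x3 c i \<otimes> (lin_prod R x2 x3 c j \<otimes> x3 [^] (Suc n - i - j)))"
    \<comment> \<open>Products of higher degree in the first two factors are adjoined first.\<close>
    define rank where "rank = (\<lambda>(i, j). n - (i + j))"
    have iK: "ideal ?K R" by (rule ideal_prod_is_ideal[OF m_ideal iJ])
    have KN: "?K \<subseteq> ?N" by (rule ideal_prod_subset(2)[OF m_ideal iJ])
    have JK: "ideal_pow R J (Suc (Suc n)) \<subseteq> ?K"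
      unfolding ideal_pow_Suc[OF J, of "Suc n"] by (rule ideal_prod_mono[OF Jm order_refl])
    have K: "finite_colength R ?K" by (rule finite_colength_superset[OF fin iK JK])
    have l1: "lin_prod R x1 x3 c i \<in> ideal_pow R J i" for i by (rule lin_prod_mem[OF J x(3,1) c(1)])
    have l2: "lin_prod R x2 x3 c i \<in> ideal_pow R J i" for i by (rule lin_prod_mem[OF J x(3,2) c(1)])
    have l3: "x3 [^] (i::nat) \<in> ideal_pow R J i" for i by (rule elem_pow_in_ideal_pow[OF J x(3)])
    have cl: "lin_prod R x1 x3 c i \<in> carrier R" "lin_prod R x2 x3 c i \<in> carrier R" for i
      using lin_prod_carrier[of x3 x1 c] lin_prod_carrier[of x3 x2 c] xc c(1) by simp_all
    have tail: "lin_prod R x2 x3 c j \<otimes> x3 [^] (Suc n - i - j) \<in> ideal_pow R J (Suc n - i)"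
      if "i \<le> k" "j \<le> k" for i j
      using ideal_pow_prod_mem[OF J l2[of j] l3[of "Suc n - i - j"]] that by (simp add: n_def)
    have f1: "(x1 \<ominus> c i \<otimes> x3) \<otimes> w \<in> M n (c i) (c j)"
      and f2: "(x2 \<ominus> c j \<otimes> x3) \<otimes> w \<in> M n (c i) (c j)"
      if "w \<in> ideal_pow R J n" for i j w
      using J'[OF c(1) c(1), of i j] JM[OF c(1) c(1), where n = n] that
      by (auto intro: ideal_prod.prod)
    have fc: "x1 \<ominus> c i \<otimes> x3 \<in> carrier R" "x2 \<ominus> c i \<otimes> x3 \<in> carrier R" for i
      using xc c(1) by auto
    have "enat (card ?E) \<le> interval_length R ?K ?N"
    proof (rule card_le_interval_length[OF iK iJ KN, where e = e and rank = rank
          and M = "\<lambda>(i, j). M n (c i) (c j)"])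
      fix t assume "t \<in> ?E"
      then obtain i j where t: "t = (i, j)" "i \<le> k" "j \<le> k" by auto
      show "e t \<in> ?N"
        using ideal_pow_prod_mem[OF J l1[of i] tail[OF t(2,3)]] t by (simp add: e_def n_def)
      show "ideal (case t of (i, j) \<Rightarrow> M n (c i) (c j)) R" "?K \<subseteq> (case t of (i, j) \<Rightarrow> M n (c i) (c j))"
        using iM mM c(1) t by simp_all
      show "e t \<notin> (case t of (i, j) \<Rightarrow> M n (c i) (c j))"
      proof
        assume "e t \<in> (case t of (i, j) \<Rightarrow> M n (c i) (c j))"
        then have mem: "lin_prod R x1 x3 c i \<otimes> (lin_prod R x2 x3 c j \<otimes> x3 [^] (Suc n - i - j)) \<in> M n (c i) (c j)"
          by (simp add: t e_def)
        have "x3 [^] i \<otimes> (lin_prod R x2 x3 c j \<otimes> x3 [^] (Suc n - i - j)) \<in> M n (c i) (c j)"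
          by (rule lin_prod_cancel[where c = c, OF J x(3,1) c(1) iM[OF c(1) c(1)] c(1) f1 _ _ tail[OF t(2,3)] mem])
            (use c(2) t in \<open>auto simp: n_def\<close>)
        then have "lin_prod R x2 x3 c j \<otimes> (x3 [^] i \<otimes> x3 [^] (Suc n - i - j)) \<in> M n (c i) (c j)"
          using cl xc by (simp add: m_lcomm)
        moreover have "x3 [^] i \<otimes> x3 [^] (Suc n - i - j) = x3 [^] (Suc n - j)"
          using t xc by (simp add: nat_pow_mult n_def)
        ultimately have mem: "lin_prod R x2 x3 c j \<otimes> x3 [^] (Suc n - j) \<in> M n (c i) (c j)" by simp
        have "x3 [^] j \<otimes> x3 [^] (Suc n - j) \<in> M n (c i) (c j)"
          by (rule lin_prod_cancel[where c = c, OF J x(3,2) c(1) iM[OF c(1) c(1)] c(1) f2 _ _ l3 mem])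
            (use c(2) t in \<open>auto simp: n_def\<close>)
        moreover have "x3 [^] j \<otimes> x3 [^] (Suc n - j) = x3 [^] Suc n"
          using t nat_pow_mult[OF xc(3), of j "Suc n - j"] by (simp add: n_def)
        ultimately show False using notin[OF c(1) c(1)] by metis
      qed
      fix u assume "u \<in> ?E" "u \<noteq> t" "rank u \<le> rank t"
      then obtain i' j' where u: "u = (i', j')" "i' \<le> k" "j' \<le> k" by auto
      have "i < i' \<or> j < j'"
        using \<open>u \<noteq> t\<close> \<open>rank u \<le> rank t\<close> t u by (auto simp: rank_def n_def)
      then have "e u \<in> M n (c i) (c j)"
      proof
        assume i': "i < i'"
        obtain w where w: "w \<in> ideal_pow R J (i' - 1)" "lin_prod R x1 x3 c i' = w \<otimes> (x1 \<ominus> c i \<otimes> x3)"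
          using lin_prod_factor[where c = c and k = i and i = i', OF J x(3,1) c(1) i'] by blast
        let ?v = "lin_prod R x2 x3 c j' \<otimes> x3 [^] (Suc n - i' - j')"
        have "i' - 1 + (Suc n - i') = n" using i' u by (simp add: n_def)
        then have "w \<otimes> ?v \<in> ideal_pow R J n"
          using ideal_pow_prod_mem[OF J w(1) tail[OF u(2,3)]] by simp
        then have "(x1 \<ominus> c i \<otimes> x3) \<otimes> (w \<otimes> ?v) \<in> M n (c i) (c j)" by (rule f1)
        moreover have "e u = (x1 \<ominus> c i \<otimes> x3) \<otimes> (w \<otimes> ?v)"
          using w(2) ideal_carrier[OF iJ w(1)] cl xc fc by (simp add: e_def u m_ac)
        ultimately show ?thesis by simp
      next
        assume j': "j < j'"
        obtain w where w: "w \<in> ideal_pow R J (j' - 1)" "lin_prod R x2 x3 c j' = w \<otimes> (x2 \<ominus> c j \<otimes> x3)"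
          using lin_prod_factor[where c = c and k = j and i = j', OF J x(3,2) c(1) j'] by blast
        let ?v = "lin_prod R x1 x3 c i' \<otimes> x3 [^] (Suc n - i' - j')"
        have "j' - 1 + (i' + (Suc n - i' - j')) = n" using j' u by (simp add: n_def)
        then have "w \<otimes> ?v \<in> ideal_pow R J n"
          using ideal_pow_prod_mem[OF J w(1) ideal_pow_prod_mem[OF J l1[of i'] l3[of "Suc n - i' - j'"]]]
          by simp
        then have "(x2 \<ominus> c j \<otimes> x3) \<otimes> (w \<otimes> ?v) \<in> M n (c i) (c j)" by (rule f2)
        moreover have "e u = (x2 \<ominus> c j \<otimes> x3) \<otimes> (w \<otimes> ?v)"
          using w(2) ideal_carrier[OF iJ w(1)] cl xc fc by (simp add: e_def u m_ac)
        ultimately show ?thesis by simp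
      qed
      then show "e u \<in> (case t of (i, j) \<Rightarrow> M n (c i) (c j))" by (simp add: t)
    qed simp
    moreover have "interval_length R ?K ?N = enat (colength R ?K - colength R ?N)"
      by (rule interval_length_eq_colength_diff[OF K iJ KN])
    moreover have "colength R ?K \<le> colength R (ideal_pow R J (Suc (Suc n)))"
      by (rule colength_antimono[OF fin iK JK])
    moreover have "colength R ?N \<le> colength R ?K"
      by (rule colength_antimono[OF K iJ KN])
    ultimately show ?thesis by (simp add: n_def power2_eq_square)
  qed
  have "k ^ 3 \<le> 3 * colength R (ideal_pow R J (2 * k))" for k
  proof (induction k)
    case (Suc k)
    have "colength R (ideal_pow R J (2 * k)) \<le> colength R (ideal_pow R J (2 * k + 1))"
      by (intro colength_antimono fin iJ ideal_pow_antimono J) simp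
    moreover have "2 * Suc k = 2 * k + 2" by simp
    ultimately have "k ^ 3 + 3 * (k + 1)\<^sup>2 \<le> 3 * colength R (ideal_pow R J (2 * Suc k))"
      using Suc step[of k] by (simp only:)
    moreover have "Suc k ^ 3 \<le> k ^ 3 + 3 * (k + 1)\<^sup>2"
      by (simp add: power2_eq_square power3_eq_cube algebra_simps)
    ultimately show ?case by linarith
  qed simp
  \<comment> \<open>The exponent \<open>12 D + 1\<close> is the first at which \<open>k\<^sup>3\<close> exceeds \<open>3 D (2 k)\<^sup>2 = 12 D k\<^sup>2\<close>.\<close>
  then have "(12 * D + 1) ^ 3 \<le> 3 * (D * (2 * (12 * D + 1)) ^ 2)"
    using bound[of "2 * (12 * D + 1)"] by (meson le_trans mult_le_mono2)
  then have "(12 * D + 1)\<^sup>2 * (12 * D + 1) \<le> (12 * D + 1)\<^sup>2 * (12 * D)"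
    by (simp add: power2_eq_square power3_eq_cube algebra_simps)
  then show False by simp
qed

text \<open>Some power of the two-generated ideal \<open>(a, b)\<close> lies in \<open>J\<close>.\<close>

lemma colength_ideal_pow_quadratic:
  assumes J: "ideal J R" and J_prim: "ideal_pow R m k \<subseteq> J"
    and a: "a \<in> m" and b: "b \<in> m" and Q_prim: "ideal_pow R m l \<subseteq> two_gen R a b (carrier R)"
  shows "\<exists>D. \<forall>n. colength R (ideal_pow R J n) \<le> D * n\<^sup>2"
proof -
  let ?Q = "two_gen R a b (carrier R)"
  have c: "a \<in> carrier R" "b \<in> carrier R" using a b ideal_carrier[OF m_ideal] by auto
  note iQ = two_gen_ideal[OF oneideal c]
  have Qm: "?Q \<subseteq> m"
    using a b by (intro two_gen_least m_ideal ideal_mult'[OF m_ideal])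
  have fin: "finite_colength R (ideal_pow R ?Q n)" for n
    by (rule finite_colength_ideal_pow[OF iQ Q_prim])
  have "colength R (ideal_pow R J n) \<le> (colength R ?Q * k\<^sup>2) * n\<^sup>2" for n
  proof -
    have "ideal_pow R ?Q k \<subseteq> J"
      using ideal_pow_mono[OF iQ m_ideal Qm, of k] J_prim by blast
    then have "ideal_pow R ?Q (k * n) \<subseteq> ideal_pow R J n"
      using ideal_pow_mono[OF ideal_pow_ideal[OF iQ] J, of k n] ideal_pow_pow[OF iQ, of k n] by simp
    then have "colength R (ideal_pow R J n) \<le> colength R (ideal_pow R ?Q (k * n))"
      by (intro colength_antimono fin ideal_pow_ideal J)
    moreover have "2 * colength R (ideal_pow R ?Q (k * n)) \<le> colength R ?Q * (k * n * (k * n + 1))"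
      by (rule colength_ideal_pow_two_gen[OF c fin])
    moreover have "k * n * (k * n + 1) \<le> 2 * (k * n)\<^sup>2"
      by (simp add: power2_eq_square)
    then have "colength R ?Q * (k * n * (k * n + 1)) \<le> colength R ?Q * (2 * (k * n)\<^sup>2)"
      by (rule mult_le_mono2)
    ultimately have "2 * colength R (ideal_pow R J n) \<le> colength R ?Q * (2 * (k * n)\<^sup>2)"
      by linarith
    then show ?thesis by (simp add: power2_eq_square algebra_simps)
  qed
  then show ?thesis by blast
qed

lemma reduction_ideal_pow:
  assumes I: "ideal I R" and J: "ideal J R" and red: "J \<cdot> ideal_pow R I n = ideal_pow R I (Suc n)"
  shows "ideal_pow R J k \<cdot> ideal_pow R I n = ideal_pow R I (k + n)"
proof (induction k)
  case 0
  then show ?case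
    using ideal_prod_one[OF ideal_pow_ideal[OF I]] ideal_prod_commute[OF oneideal ideal_pow_ideal[OF I]]
    by simp
next
  case (Suc k)
  note iI = ideal_pow_ideal[OF I]
  have "ideal_pow R J (Suc k) \<cdot> ideal_pow R I n = J \<cdot> (ideal_pow R J k \<cdot> ideal_pow R I n)"
    unfolding ideal_pow_Suc[OF J] by (rule ideal_prod_assoc[OF J ideal_pow_ideal[OF J] iI])
  also have "\<dots> = J \<cdot> (ideal_pow R I n \<cdot> ideal_pow R I k)"
    using Suc ideal_pow_add[OF I, of n k] by (simp add: add.commute)
  also have "\<dots> = (J \<cdot> ideal_pow R I n) \<cdot> ideal_pow R I k"
    by (rule ideal_prod_assoc[OF J iI iI, symmetric])
  also have "\<dots> = ideal_pow R I (Suc k + n)"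
    unfolding red using ideal_pow_add[OF I, of "Suc n" k] by (simp add: add.commute)
  finally show ?case .
qed

lemma is_reduction_trans:
  assumes I: "ideal I R" and red: "is_reduction R J I"
    and J': "ideal J' R" "J' \<subseteq> J" and red': "J' \<cdot> ideal_pow R J n = ideal_pow R J (Suc n)"
  shows "is_reduction R J' I"
proof -
  have J: "ideal J R" "J \<subseteq> I" using red by (auto simp: is_reduction_def)
  obtain r where r: "J \<cdot> ideal_pow R I r = ideal_pow R I (Suc r)"
    using red by (auto simp: is_reduction_def)
  note p = reduction_ideal_pow[OF I J(1) r]
  have "J' \<cdot> ideal_pow R I (n + r) = J' \<cdot> (ideal_pow R J n \<cdot> ideal_pow R I r)"
    using p[of n] by simp
  also have "\<dots> = ideal_pow R J (Suc n) \<cdot> ideal_pow R I r"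
    using ideal_prod_assoc[OF J'(1) ideal_pow_ideal[OF J(1), of n] ideal_pow_ideal[OF I, of r], symmetric]
      red' by simp
  also have "\<dots> = ideal_pow R I (n + r + 1)"
    using p[of "Suc n"] by simp
  finally show ?thesis using J J' by (auto simp: is_reduction_def)
qed

text \<open>A reduction of a reduction is a reduction, so a minimal reduction \<open>J\<close> equals each of its own
  reductions. In a generating set of least size at least three, two of the elements could be
  changed so that a third becomes superfluous for a reduction.\<close>

lemma minimal_reduction_two_gen:
  assumes inf: "infinite (carrier (R Quot m))"
    and I: "ideal I R" "I \<subseteq> m" and min: "is_minimal_reduction R J I"
    and J_prim: "ideal_pow R m k \<subseteq> J"
    and a: "a \<in> m" and b: "b \<in> m" and Q_prim: "ideal_pow R m l \<subseteq> two_gen R a b (carrier R)"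
  shows "\<exists>x\<in>carrier R. \<exists>y\<in>carrier R. J = two_gen R x y (carrier R)"
proof -
  have red: "is_reduction R J I" and J: "ideal J R" and JI: "J \<subseteq> I"
    using min by (auto simp: is_minimal_reduction_def is_reduction_def)
  have Jm: "J \<subseteq> m" using JI I by auto
  obtain c where c: "\<And>p::nat. c p \<in> carrier R" "\<And>p q. p \<noteq> q \<Longrightarrow> c p \<ominus> c q \<notin> m"
    using residue_sequence[OF inf] by blast
  obtain D where D: "\<And>n. colength R (ideal_pow R J n) \<le> D * n\<^sup>2"
    using colength_ideal_pow_quadratic[OF J J_prim a b Q_prim] by blast
  let ?P = "\<lambda>s. \<exists>S. finite S \<and> S \<subseteq> carrier R \<and> J = Idl S \<and> card S = s"
  define s where "s = (LEAST s. ?P s)"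
  have "\<exists>s. ?P s" using finetely_gen[OF J] by blast
  then have "?P s" unfolding s_def by (rule LeastI_ex)
  then obtain S where S: "finite S" "S \<subseteq> carrier R" "J = Idl S" "card S = s" by blast
  have least: "s \<le> card T" if "finite T" "T \<subseteq> carrier R" "J = Idl T" for T
    unfolding s_def using that by (intro Least_le) blast
  have "s \<le> 2"
  proof (rule ccontr)
    assume "\<not> s \<le> 2"
    then have "3 \<le> card S" using S by simp
    then obtain U where U: "U \<subseteq> S" "card U = 3" using obtain_subset_with_card_n by metis
    then obtain x1 x2 x3 where x: "U = {x1, x2, x3}" "x1 \<noteq> x2" "x1 \<noteq> x3" "x2 \<noteq> x3"
      by (auto simp: card_3_iff)
    define T where "T = S - U"
    have T: "finite T" "T \<subseteq> carrier R" "S = T \<union> {x1, x2, x3}" "card T = s - 3"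
      using S U x by (auto simp: T_def card_Diff_subset finite_subset)
    have SJ: "S \<subseteq> J" using genideal_self[OF S(2)] S(3) by simp
    have xJ: "x1 \<in> J" "x2 \<in> J" "x3 \<in> J" using SJ T(3) by auto
    have xc: "x1 \<in> carrier R" "x2 \<in> carrier R" "x3 \<in> carrier R" using xJ ideal_carrier[OF J] by auto
    define G where "G = (\<lambda>g h. T \<union> {x1 \<ominus> g \<otimes> x3, x2 \<ominus> h \<otimes> x3})"
    have G: "ideal (Idl (G g h)) R \<and> Idl (G g h) \<subseteq> J \<and> x1 \<ominus> g \<otimes> x3 \<in> Idl (G g h) \<and>
        x2 \<ominus> h \<otimes> x3 \<in> Idl (G g h) \<and> J \<subseteq> mult_plus R x3 (carrier R) (Idl (G g h)) \<and> G g h \<subseteq> carrier R"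
      if gh: "g \<in> carrier R" "h \<in> carrier R" for g h
    proof -
      have Gc: "G g h \<subseteq> carrier R" using T xc gh by (auto simp: G_def)
      have iG: "ideal (Idl (G g h)) R" by (rule genideal_ideal[OF Gc])
      have self: "G g h \<subseteq> Idl (G g h)" by (rule genideal_self[OF Gc])
      have "G g h \<subseteq> J"
        using SJ T(3) xJ gh by (auto simp: G_def intro!: ideal_minus[OF J] ideal_mult[OF J])
      then have sub: "Idl (G g h) \<subseteq> J" by (rule genideal_minimal[OF J])
      let ?A = "mult_plus R x3 (carrier R) (Idl (G g h))"
      have iA: "ideal ?A R" by (rule mult_plus_ideal[OF oneideal iG xc(3)])
      have GA: "Idl (G g h) \<subseteq> ?A" by (rule subset_mult_plus[OF oneideal iG xc(3)])
      have x3A: "x3 \<in> ?A" using mult_in_mult_plus[OF oneideal iG xc(3) one_closed] xc by simp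
      have "y \<in> ?A" if y: "y \<in> carrier R" "f \<in> carrier R" "y \<ominus> f \<otimes> x3 \<in> G g h" for y f
      proof -
        have "(y \<ominus> f \<otimes> x3) \<oplus> f \<otimes> x3 \<in> ?A"
          using y(3) self GA by (intro ideal_add[OF iA] ideal_mult[OF iA x3A y(2)]) auto
        moreover have "(y \<ominus> f \<otimes> x3) \<oplus> f \<otimes> x3 = y" using y(1,2) xc by algebra
        ultimately show ?thesis by simp
      qed
      from this[OF xc(1) gh(1)] this[OF xc(2) gh(2)] have "x1 \<in> ?A" "x2 \<in> ?A"
        by (auto simp: G_def)
      moreover have "T \<subseteq> ?A" using self GA by (auto simp: G_def)
      ultimately have "J \<subseteq> ?A"
        unfolding S(3) using x3A by (intro genideal_minimal[OF iA]) (auto simp: T(3))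
      then show ?thesis using iG sub self Gc by (auto simp: G_def)
    qed
    have fin: "finite_colength R (ideal_pow R J n)" for n
      by (rule finite_colength_ideal_pow[OF J J_prim])
    have "\<exists>n g h. g \<in> carrier R \<and> h \<in> carrier R \<and> (Idl (G g h)) \<cdot> ideal_pow R J n = ideal_pow R J (Suc n)"
    proof (rule specialised_reduction_exists[where c = c and D = D and J' = "\<lambda>g h. Idl (G g h)"])
      show "colength R (ideal_pow R J n) \<le> D * n\<^sup>2" for n by (rule D)
      show "ideal (Idl (G g h)) R \<and> Idl (G g h) \<subseteq> J \<and> x1 \<ominus> g \<otimes> x3 \<in> Idl (G g h) \<and>
          x2 \<ominus> h \<otimes> x3 \<in> Idl (G g h) \<and> J \<subseteq> mult_plus R x3 (carrier R) (Idl (G g h))"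
        if "g \<in> carrier R" "h \<in> carrier R" for g h
        using G[OF that] by (elim conjE) (intro conjI)
      show "c p \<ominus> c q \<notin> m" if "p \<noteq> q" for p q by (rule c(2)[OF that])
    qed (rule J Jm xJ c(1) fin)+
    then obtain n g h where gh: "g \<in> carrier R" "h \<in> carrier R"
      and red': "(Idl (G g h)) \<cdot> ideal_pow R J n = ideal_pow R J (Suc n)" by blast
    have "is_reduction R (Idl (G g h)) I"
      using is_reduction_trans[OF I(1) red _ _ red'] G[OF gh] by blast
    then have "J = Idl (G g h)"
      using min G[OF gh] by (auto simp: is_minimal_reduction_def)
    moreover have "finite (G g h)" using T by (simp add: G_def)
    ultimately have "s \<le> card (G g h)" using least G[OF gh] by blast
    also have "\<dots> \<le> card T + card {x1 \<ominus> g \<otimes> x3, x2 \<ominus> h \<otimes> x3}"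
      unfolding G_def by (rule card_Un_le)
    also have "\<dots> \<le> (s - 3) + 2"
      using T(4) by (simp add: card_insert_if)
    finally show False using \<open>\<not> s \<le> 2\<close> by simp
  qed
  then consider "card S = 0" | "card S = 1" | "card S = 2" using S(4) by linarith
  then have "\<exists>x\<in>carrier R. \<exists>y\<in>carrier R. J = Idl {x, y}"
  proof cases
    case 1
    then have "J = Idl {}" using S by simp
    also have "\<dots> = Idl {\<zero>}"
      unfolding genideal_zero using genideal_minimal[OF zeroideal, of "{}"]
        ideal_zero[OF genideal_ideal[of "{}"]] by auto
    finally show ?thesis by (intro bexI[of _ \<zero>]) auto
  next
    case 2
    then obtain x where "S = {x}" by (auto simp: card_1_singleton_iff)
    then show ?thesis using S by (intro bexI[of _ x]) auto
  next
    case 3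
    then obtain x y where "S = {x, y}" by (auto simp: card_2_iff)
    then show ?thesis using S by auto
  qed
  then show ?thesis using two_gen_carrier_eq_Idl by auto
qed

end

section \<open>The Ratliff-Rush filtration\<close>

context cring
begin

lemma ideal_colon_pow_Suc:
  assumes I: "ideal I R" and a: "a \<in> ideal_colon R (ideal_pow R I (n + k)) (ideal_pow R I k)"
  shows "a \<in> ideal_colon R (ideal_pow R I (n + Suc k)) (ideal_pow R I (Suc k))"
proof -
  have ac: "a \<in> carrier R" and mult: "\<And>b. b \<in> ideal_pow R I k \<Longrightarrow> a \<otimes> b \<in> ideal_pow R I (n + k)"
    using a by (auto simp: ideal_colon_def)
  have "I \<cdot> ideal_pow R I k \<subseteq> colon_elem R (ideal_pow R I (n + Suc k)) a"
  proof (rule ideal_prod_least)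
    show "ideal (colon_elem R (ideal_pow R I (n + Suc k)) a) R"
      by (rule colon_elem_ideal[OF ideal_pow_ideal[OF I] ac])
    fix i b assume i: "i \<in> I" and b: "b \<in> ideal_pow R I k"
    have c: "i \<in> carrier R" "b \<in> carrier R"
      using i b ideal_carrier[OF I] ideal_carrier[OF ideal_pow_ideal[OF I]] by auto
    have "i \<otimes> (a \<otimes> b) \<in> ideal_pow R I (n + Suc k)"
      using ideal_prod.prod[OF i mult[OF b], of R] ideal_pow_Suc[OF I, of "n + k"] by simp
    moreover have "i \<otimes> (a \<otimes> b) = a \<otimes> (i \<otimes> b)"
      using ac c by (simp add: m_lcomm)
    ultimately show "i \<otimes> b \<in> colon_elem R (ideal_pow R I (n + Suc k)) a"
      using c by (simp add: colon_elem_def)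
  qed
  then show ?thesis
    using ideal_pow_Suc[OF I, of k] ac by (auto simp: ideal_colon_def colon_elem_def)
qed

lemma ideal_colon_pow_mono:
  assumes I: "ideal I R" and "k \<le> l"
    and a: "a \<in> ideal_colon R (ideal_pow R I (n + k)) (ideal_pow R I k)"
  shows "a \<in> ideal_colon R (ideal_pow R I (n + l)) (ideal_pow R I l)"
  using \<open>k \<le> l\<close>
proof (induction l rule: dec_induct)
  case (step l)
  show ?case by (rule ideal_colon_pow_Suc[OF I step.IH])
qed (rule a)

text \<open>The definition uses only exponents that are multiples of \<open>n\<close>; as the colon ideals increase
  with \<open>k\<close>, all exponents give the same union, which is uniform in \<open>n\<close>. For \<open>n = 0\<close> both unions are
  \<open>R\<close>.\<close>

lemma ratliff_rush_closure_pow: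
  assumes I: "ideal I R"
  shows "ratliff_rush_closure R (ideal_pow R I n) =
    (\<Union>k. ideal_colon R (ideal_pow R I (n + k)) (ideal_pow R I k))"
proof
  show "ratliff_rush_closure R (ideal_pow R I n) \<subseteq>
      (\<Union>k. ideal_colon R (ideal_pow R I (n + k)) (ideal_pow R I k))"
    using ideal_pow_pow[OF I] by (auto simp: ratliff_rush_closure_def)
  show "(\<Union>k. ideal_colon R (ideal_pow R I (n + k)) (ideal_pow R I k))
      \<subseteq> ratliff_rush_closure R (ideal_pow R I n)"
  proof
    fix a assume "a \<in> (\<Union>k. ideal_colon R (ideal_pow R I (n + k)) (ideal_pow R I k))"
    then obtain k where a: "a \<in> ideal_colon R (ideal_pow R I (n + k)) (ideal_pow R I k)" by blast
    then have ac: "a \<in> carrier R" by (simp add: ideal_colon_def)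
    show "a \<in> ratliff_rush_closure R (ideal_pow R I n)"
    proof (cases "n = 0")
      case True
      have "ideal_pow R (carrier R) l = carrier R" for l
        using ideal_pow_pow[OF I, of 0 l] by simp
      then have "a \<in> ideal_colon R (ideal_pow R (ideal_pow R I n) (1 + 1)) (ideal_pow R (ideal_pow R I n) 1)"
        using ac True by (auto simp: ideal_colon_def)
      then show ?thesis unfolding ratliff_rush_closure_def by blast
    next
      case False
      then have "k \<le> n * Suc k" by (cases n) auto
      then have "a \<in> ideal_colon R (ideal_pow R I (n + n * Suc k)) (ideal_pow R I (n * Suc k))"
        using a by (rule ideal_colon_pow_mono[OF I])
      moreover have "n + n * Suc k = n * (Suc k + 1)" by simp
      ultimately have "a \<in> ideal_colon R (ideal_pow R (ideal_pow R I n) (Suc k + 1))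
          (ideal_pow R (ideal_pow R I n) (Suc k))"
        unfolding ideal_pow_pow[OF I] by simp
      then show ?thesis unfolding ratliff_rush_closure_def by (intro UN_I[of "Suc k"]) auto
    qed
  qed
qed

lemma ratliff_rush_closure_powE:
  assumes I: "ideal I R" and a: "a \<in> ratliff_rush_closure R (ideal_pow R I n)"
  obtains k where "a \<in> carrier R"
    "\<And>l b. k \<le> l \<Longrightarrow> b \<in> ideal_pow R I l \<Longrightarrow> a \<otimes> b \<in> ideal_pow R I (n + l)"
proof -
  obtain k where k: "a \<in> ideal_colon R (ideal_pow R I (n + k)) (ideal_pow R I k)"
    using a unfolding ratliff_rush_closure_pow[OF I] by blast
  have "a \<otimes> b \<in> ideal_pow R I (n + l)" if "k \<le> l" "b \<in> ideal_pow R I l" for l b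
    using ideal_colon_pow_mono[OF I that(1) k] that(2) by (simp add: ideal_colon_def)
  moreover have "a \<in> carrier R" using k by (simp add: ideal_colon_def)
  ultimately show ?thesis using that by blast
qed

lemma ratliff_rush_closure_powI:
  assumes I: "ideal I R" and "a \<in> carrier R"
    and "\<And>b. b \<in> ideal_pow R I k \<Longrightarrow> a \<otimes> b \<in> ideal_pow R I (n + k)"
  shows "a \<in> ratliff_rush_closure R (ideal_pow R I n)"
  unfolding ratliff_rush_closure_pow[OF I] using assms(2,3)
  by (intro UN_I[of k]) (auto simp: ideal_colon_def)

lemma ratliff_rush_closure_pow_ideal:
  assumes I: "ideal I R"
  shows "ideal (ratliff_rush_closure R (ideal_pow R I n)) R"
proof (rule ideal_criterion)
  let ?F = "ratliff_rush_closure R (ideal_pow R I n)"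
  note iI = ideal_pow_ideal[OF I]
  show "?F \<subseteq> carrier R" by (auto elim: ratliff_rush_closure_powE[OF I])
  show "\<zero> \<in> ?F"
    by (rule ratliff_rush_closure_powI[OF I, where k = 0])
      (use ideal_zero[OF iI] ideal_carrier[OF iI] in auto)
  fix a b assume a: "a \<in> ?F"
  obtain k where k: "a \<in> carrier R"
    "\<And>l c. k \<le> l \<Longrightarrow> c \<in> ideal_pow R I l \<Longrightarrow> a \<otimes> c \<in> ideal_pow R I (n + l)"
    using ratliff_rush_closure_powE[OF I a] by blast
  {
    assume b: "b \<in> ?F"
    obtain l where l: "b \<in> carrier R"
      "\<And>i c. l \<le> i \<Longrightarrow> c \<in> ideal_pow R I i \<Longrightarrow> b \<otimes> c \<in> ideal_pow R I (n + i)"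
      using ratliff_rush_closure_powE[OF I b] by blast
    show "a \<oplus> b \<in> ?F"
    proof (rule ratliff_rush_closure_powI[OF I, where k = "max k l"])
      fix c assume c: "c \<in> ideal_pow R I (max k l)"
      have "(a \<oplus> b) \<otimes> c = a \<otimes> c \<oplus> b \<otimes> c"
        using k(1) l(1) ideal_carrier[OF iI c] by (rule l_distr)
      then show "(a \<oplus> b) \<otimes> c \<in> ideal_pow R I (n + max k l)"
        using k(2)[OF _ c] l(2)[OF _ c] by (simp add: ideal_add[OF iI])
    qed (use k l in simp)
  }
  fix r assume r: "r \<in> carrier R"
  show "r \<otimes> a \<in> ?F"
  proof (rule ratliff_rush_closure_powI[OF I, where k = k])
    fix c assume c: "c \<in> ideal_pow R I k"
    have "r \<otimes> a \<otimes> c = r \<otimes> (a \<otimes> c)"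
      using r k(1) ideal_carrier[OF iI c] by (rule m_assoc)
    then show "r \<otimes> a \<otimes> c \<in> ideal_pow R I (n + k)"
      using ideal_mult[OF iI k(2)[OF order_refl c] r] by simp
  qed (use r k in simp)
qed

lemma ideal_pow_subset_ratliff_rush:
  assumes I: "ideal I R"
  shows "ideal_pow R I n \<subseteq> ratliff_rush_closure R (ideal_pow R I n)"
proof
  fix a assume a: "a \<in> ideal_pow R I n"
  show "a \<in> ratliff_rush_closure R (ideal_pow R I n)"
    by (rule ratliff_rush_closure_powI[OF I, where k = 0])
      (use a ideal_carrier[OF ideal_pow_ideal[OF I]] ideal_mult'[OF ideal_pow_ideal[OF I] a] in auto)
qed

lemma ratliff_rush_closure_pow_0:
  assumes I: "ideal I R"
  shows "ratliff_rush_closure R (ideal_pow R I 0) = carrier R"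
  using ideal_pow_subset_ratliff_rush[OF I, of 0]
    ideal_subset_carrier[OF ratliff_rush_closure_pow_ideal[OF I, of 0]] by simp

end

section \<open>Second differences of integer sequences\<close>

text \<open>If \<open>g\<close> were positive infinitely often, the first differences of \<open>b\<close> would exceed \<open>e n\<close> by any
  given amount, and \<open>b n\<close> would overtake \<open>e n(n+1)/2\<close>.\<close>

lemma excess_eventually_zero:
  fixes b g :: "nat \<Rightarrow> int" and e :: int
  assumes rec: "\<And>n. r \<le> Suc n \<Longrightarrow> b (Suc (Suc n)) = 2 * b (Suc n) - b n + e + g n"
    and g: "\<And>n. r \<le> Suc n \<Longrightarrow> 0 \<le> g n"
    and bound: "\<And>n. 2 * b n \<le> e * (int n * (int n + 1))"
  shows "\<exists>N. \<forall>n\<ge>N. g n = 0"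
proof (rule ccontr)
  assume no: "\<not> ?thesis"
  define d where "d = (\<lambda>n. b (Suc n) - b n - e * int n)"
  have dstep: "d (Suc n) = d n + g n" if "r \<le> Suc n" for n
    using rec[OF that] by (simp add: d_def algebra_simps)
  have mono: "d n \<le> d l" if "r \<le> n" "n \<le> l" for n l
    using that(2)
  proof (induction l rule: dec_induct)
    case (step l)
    then show ?case using dstep[of l] g[of l] that(1) by simp
  qed simp
  have unbounded: "\<exists>n\<ge>r. d r + int q \<le> d n" for q :: nat
  proof (induction q)
    case (Suc q)
    then obtain n where n: "n \<ge> r" "d r + int q \<le> d n" by blast
    obtain l where l: "l \<ge> n" "g l \<noteq> 0" using no by blast
    have "0 \<le> g l" using g l n by simp
    then have "d (Suc l) \<ge> d n + 1"
      using dstep[of l] mono[OF n(1) l(1)] l n by simp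
    then show ?case using n l by (intro exI[of _ "Suc l"]) auto
  qed auto
  obtain N where N: "N \<ge> r" "d N \<ge> e + 1"
    using unbounded[of "nat (e + 1 - d r)"] by (auto split: if_splits simp: nat_eq_iff)
  define u where "u = (\<lambda>n. 2 * b n - e * (int n * (int n + 1)))"
  have ustep: "u (Suc n) \<ge> u n + 1" if "n \<ge> N" for n
  proof -
    have "b (Suc n) - b n \<ge> e * int n + e + 1"
      using mono[OF N(1) that] N(2) by (simp add: d_def)
    then show ?thesis by (simp add: u_def algebra_simps)
  qed
  have "u (N + q) \<ge> u N + int q" for q
  proof (induction q)
    case (Suc q)
    then show ?case using ustep[of "N + q"] by simp
  qed simp
  from this[of "nat (1 - u N)"] have "u (N + nat (1 - u N)) \<ge> 1"
    by (auto split: if_splits)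
  then show False using bound[of "N + nat (1 - u N)"] by (simp add: u_def)
qed

text \<open>The differences of \<open>w\<close> increase to their eventual value \<open>0\<close>, so \<open>w\<close> is nonincreasing.\<close>

lemma convex_zero_persists:
  fixes w :: "nat \<Rightarrow> int"
  assumes convex: "\<And>n. r \<le> Suc n \<Longrightarrow> 2 * w (Suc n) \<le> w (Suc (Suc n)) + w n"
    and nonneg: "\<And>n. 0 \<le> w n" and eventually_zero: "\<And>n. N \<le> n \<Longrightarrow> w n = 0"
    and "r \<le> Suc n" "w n = 0" "n \<le> l"
  shows "w l = 0"
proof -
  have diff_mono: "w (Suc i) - w i \<le> w (Suc j) - w j" if "n \<le> i" "i \<le> j" for i j
    using that(2)
  proof (induction j rule: dec_induct)
    case (step j)
    then show ?case using convex[of j] that(1) \<open>r \<le> Suc n\<close> by simp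
  qed simp
  have decr: "w (Suc i) \<le> w i" if "n \<le> i" for i
    using diff_mono[OF that, of "max i N"] eventually_zero[of "max i N"]
      eventually_zero[of "Suc (max i N)"] by simp
  have "w l \<le> w n"
    using \<open>n \<le> l\<close>
  proof (induction l rule: dec_induct)
    case (step l)
    then show ?case using decr[of l] by simp
  qed simp
  then show ?thesis using nonneg[of l] \<open>w n = 0\<close> by simp
qed

text \<open>Each \<open>i\<close> with \<open>v i > 0\<close> is a lower bound for \<open>e\<close>, which allows replacing the factor \<open>i - 1\<close> by
  \<open>e - 1\<close>.\<close>

lemma sum_choose_two_le:
  fixes v :: "nat \<Rightarrow> int" and M :: nat and e :: int
  assumes "\<And>i. 0 \<le> v i" and e_def: "e = (\<Sum>i<M. int i * v i)"
  shows "(\<Sum>i<M. int (i - 1) * (int i * v i)) \<le> (e - 1) * e"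
proof -
  have "int (i - 1) * (int i * v i) \<le> (e - 1) * (int i * v i)" if i: "i < M" for i
  proof (cases "int i * v i = 0")
    case False
    then have "1 \<le> v i" "1 \<le> i" using assms(1)[of i] by (auto simp: order_le_less)
    then have "int i * 1 \<le> int i * v i" by (intro mult_left_mono) auto
    also have "\<dots> \<le> e"
      unfolding e_def by (rule member_le_sum) (use i assms(1) in auto)
    finally have "int (i - 1) \<le> e - 1" using \<open>1 \<le> i\<close> by simp
    then show ?thesis using assms(1)[of i] by (intro mult_right_mono) auto
  next
    case True
    then show ?thesis by (simp only: mult_zero_right)
  qed
  then have "(\<Sum>i<M. int (i - 1) * (int i * v i)) \<le> (\<Sum>i<M. (e - 1) * (int i * v i))"
    by (intro sum_mono) auto
  also have "\<dots> = (e - 1) * e" by (simp add: e_def sum_distrib_left)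
  finally show ?thesis .
qed

section \<open>Lengths along the Ratliff-Rush filtration\<close>

text \<open>The situation to which the theorem reduces: \<open>J = (x, y)\<close> is a reduction of \<open>I\<close> and is primary
  to \<open>m\<close>, and \<open>x, y\<close> have only trivial relations. Here \<open>r\<close> is any exponent from which on \<open>J\<close>
  multiplies a power of \<open>I\<close> onto the next one.\<close>

locale koszul_reduction = noetherian_local_ring +
  fixes I :: "'a set" and x y :: 'a and r k :: nat
  assumes I: "ideal I R" and syz: "koszul_syzygies R x y"
    and J_subset: "two_gen R x y (carrier R) \<subseteq> I"
    and reduction: "two_gen R x y (carrier R) \<cdot> ideal_pow R I r = ideal_pow R I (Suc r)"
    and m_pow_subset: "ideal_pow R m k \<subseteq> two_gen R x y (carrier R)"
begin

abbreviation J :: "'a set" where "J \<equiv> two_gen R x y (carrier R)"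

definition rr :: "nat \<Rightarrow> 'a set" where "rr n = ratliff_rush_closure R (ideal_pow R I n)"

definition adic_colength :: "nat \<Rightarrow> int" where
  "adic_colength n = int (colength R (ideal_pow R I n))"

definition rr_colength :: "nat \<Rightarrow> int" where
  "rr_colength n = int (colength R (rr n))"

text \<open>Since \<open>I\<^sup>n \<subseteq> rr n\<close>, this is the length of \<open>rr n / I\<^sup>n\<close>.\<close>

definition rr_gap :: "nat \<Rightarrow> int" where
  "rr_gap n = adic_colength n - rr_colength n"

text \<open>Since \<open>two_gen R x y (rr n) = J (rr n) \<subseteq> rr (n + 1)\<close>, this is the length of
  \<open>rr (n + 1) / J (rr n)\<close>.\<close>

definition reduction_gap :: "nat \<Rightarrow> int" where
  "reduction_gap n = int (colength R (two_gen R x y (rr n))) - rr_colength (Suc n)"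

lemma xy: "x \<in> carrier R" "y \<in> carrier R"
  using syz by (auto simp: koszul_syzygies_def)

lemma J_ideal: "ideal J R"
  by (rule two_gen_ideal[OF oneideal xy])

lemma rr_ideal: "ideal (rr n) R"
  unfolding rr_def by (rule ratliff_rush_closure_pow_ideal[OF I])

lemma pow_subset_rr: "ideal_pow R I n \<subseteq> rr n"
  unfolding rr_def by (rule ideal_pow_subset_ratliff_rush[OF I])

lemma rr_0: "rr 0 = carrier R"
  unfolding rr_def by (rule ratliff_rush_closure_pow_0[OF I])

lemma reduction_pow:
  assumes "r \<le> n"
  shows "J \<cdot> ideal_pow R I n = ideal_pow R I (Suc n)"
proof -
  have "J \<cdot> ideal_pow R I n = J \<cdot> (ideal_pow R I r \<cdot> ideal_pow R I (n - r))"
    using ideal_pow_add[OF I, of r "n - r"] assms by simp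
  also have "\<dots> = (J \<cdot> ideal_pow R I r) \<cdot> ideal_pow R I (n - r)"
    by (rule ideal_prod_assoc[OF J_ideal ideal_pow_ideal[OF I] ideal_pow_ideal[OF I], symmetric])
  also have "\<dots> = ideal_pow R I (Suc n)"
    unfolding reduction using ideal_pow_add[OF I, of "Suc r" "n - r"] assms by simp
  finally show ?thesis .
qed

lemma two_gen_pow: "r \<le> n \<Longrightarrow> two_gen R x y (ideal_pow R I n) = ideal_pow R I (Suc n)"
  using reduction_pow two_gen_prod[OF ideal_pow_ideal[OF I] xy] by simp

text \<open>If \<open>aJ \<subseteq> rr (n + 1)\<close>, then for one large \<open>l\<close> both \<open>a x I\<^sup>l\<close> and \<open>a y I\<^sup>l\<close> lie in
  \<open>I\<^bsup>n+1+l\<^esup>\<close>; as \<open>xI\<^sup>l + yI\<^sup>l = I\<^bsup>l+1\<^esup>\<close>, this puts \<open>a\<close> into \<open>rr n\<close>.\<close>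

lemma colon_rr: "ideal_colon R (rr (Suc n)) J = rr n"
proof
  note iI = ideal_pow_ideal[OF I]
  show "rr n \<subseteq> ideal_colon R (rr (Suc n)) J"
  proof
    fix a assume "a \<in> rr n"
    then obtain l where l: "a \<in> carrier R"
      "\<And>i b. l \<le> i \<Longrightarrow> b \<in> ideal_pow R I i \<Longrightarrow> a \<otimes> b \<in> ideal_pow R I (n + i)"
      unfolding rr_def by (rule ratliff_rush_closure_powE[OF I]) blast
    have "a \<otimes> j \<in> rr (Suc n)" if j: "j \<in> J" for j
      unfolding rr_def
    proof (rule ratliff_rush_closure_powI[OF I, where k = l])
      have jI: "j \<in> I" "j \<in> carrier R" using j J_subset ideal_carrier[OF I] by auto
      show "a \<otimes> j \<in> carrier R" using l(1) jI by simp
      fix b assume b: "b \<in> ideal_pow R I l"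
      have "j \<otimes> (a \<otimes> b) \<in> ideal_pow R I (Suc n + l)"
        using ideal_prod.prod[OF jI(1) l(2)[OF order_refl b], of R] ideal_pow_Suc[OF I, of "n + l"] by simp
      moreover have "a \<otimes> j \<otimes> b = j \<otimes> (a \<otimes> b)"
        using l(1) jI ideal_carrier[OF iI b] by (simp add: m_ac)
      ultimately show "a \<otimes> j \<otimes> b \<in> ideal_pow R I (Suc n + l)" by simp
    qed
    then show "a \<in> ideal_colon R (rr (Suc n)) J"
      using l(1) by (simp add: ideal_colon_def)
  qed
  show "ideal_colon R (rr (Suc n)) J \<subseteq> rr n"
  proof
    fix a assume "a \<in> ideal_colon R (rr (Suc n)) J"
    then have a: "a \<in> carrier R" "a \<otimes> x \<in> rr (Suc n)" "a \<otimes> y \<in> rr (Suc n)"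
      using two_gen_generators[OF xy] by (auto simp: ideal_colon_def)
    obtain p where p: "\<And>l b. p \<le> l \<Longrightarrow> b \<in> ideal_pow R I l \<Longrightarrow> a \<otimes> x \<otimes> b \<in> ideal_pow R I (Suc n + l)"
      using a(2) unfolding rr_def by (rule ratliff_rush_closure_powE[OF I]) blast
    obtain q where q: "\<And>l b. q \<le> l \<Longrightarrow> b \<in> ideal_pow R I l \<Longrightarrow> a \<otimes> y \<otimes> b \<in> ideal_pow R I (Suc n + l)"
      using a(3) unfolding rr_def by (rule ratliff_rush_closure_powE[OF I]) blast
    define l where "l = max r (max p q)"
    show "a \<in> rr n"
      unfolding rr_def
    proof (rule ratliff_rush_closure_powI[OF I a(1), where k = "Suc l"])
      fix b assume "b \<in> ideal_pow R I (Suc l)"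
      then have "b \<in> two_gen R x y (ideal_pow R I l)"
        using two_gen_pow[of l] by (simp add: l_def)
      then obtain f g where fg: "f \<in> ideal_pow R I l" "g \<in> ideal_pow R I l" "b = x \<otimes> f \<oplus> y \<otimes> g"
        by (auto simp: two_gen_def)
      have "a \<otimes> b = a \<otimes> x \<otimes> f \<oplus> a \<otimes> y \<otimes> g"
        unfolding fg(3) using a(1) xy ideal_carrier[OF iI fg(1)] ideal_carrier[OF iI fg(2)] by algebra
      moreover have "a \<otimes> x \<otimes> f \<in> ideal_pow R I (Suc n + l)" "a \<otimes> y \<otimes> g \<in> ideal_pow R I (Suc n + l)"
        using p[OF _ fg(1)] q[OF _ fg(2)] by (auto simp: l_def)
      ultimately show "a \<otimes> b \<in> ideal_pow R I (n + Suc l)"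
        using ideal_add[OF iI] by simp
    qed
  qed
qed

lemma finite_colength_J_pow: "finite_colength R (ideal_pow R J n)"
  by (rule finite_colength_ideal_pow[OF J_ideal m_pow_subset])

lemma J_pow_subset: "ideal_pow R J n \<subseteq> ideal_pow R I n"
  by (rule ideal_pow_mono[OF J_ideal I J_subset])

lemma finite_colength_pow: "finite_colength R (ideal_pow R I n)"
  by (rule finite_colength_superset[OF finite_colength_J_pow ideal_pow_ideal[OF I] J_pow_subset])

lemma finite_colength_rr: "finite_colength R (rr n)"
  by (rule finite_colength_superset[OF finite_colength_pow rr_ideal pow_subset_rr])

lemma finite_colength_two_gen:
  assumes "ideal A R" "ideal_pow R I n \<subseteq> A"
  shows "finite_colength R (two_gen R x y A)"
proof (rule finite_colength_superset[OF finite_colength_J_pow[of "Suc n"]])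
  show "ideal (two_gen R x y A) R" by (rule two_gen_ideal[OF assms(1) xy])
  show "ideal_pow R J (Suc n) \<subseteq> two_gen R x y A"
    unfolding ideal_pow_two_gen_Suc[OF xy] using J_pow_subset[of n] assms(2)
    by (auto simp: two_gen_def)
qed

lemma two_gen_rr_subset: "two_gen R x y (rr n) \<subseteq> rr (Suc n)"
proof (rule two_gen_least[OF rr_ideal])
  fix f assume f: "f \<in> rr n"
  then have "f \<in> ideal_colon R (rr (Suc n)) J" using colon_rr by simp
  then show "x \<otimes> f \<in> rr (Suc n)" "y \<otimes> f \<in> rr (Suc n)"
    using two_gen_generators[OF xy] xy by (auto simp: ideal_colon_def m_comm)
qed

lemma adic_colength_0: "adic_colength 0 = 0"
  by (simp add: adic_colength_def colength_carrier)

lemma rr_colength_0: "rr_colength 0 = 0"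
  by (simp add: rr_colength_def rr_0 colength_carrier)

lemma rr_gap_0: "rr_gap 0 = 0"
  by (simp add: rr_gap_def adic_colength_0 rr_colength_0)

lemma rr_gap_nonneg: "0 \<le> rr_gap n"
  using colength_antimono[OF finite_colength_pow rr_ideal pow_subset_rr]
  by (simp add: rr_gap_def adic_colength_def rr_colength_def)

lemma rr_gap_eq_0_iff: "rr_gap n = 0 \<longleftrightarrow> rr n = ideal_pow R I n"
  using colength_eq_imp_eq[OF finite_colength_pow rr_ideal pow_subset_rr, of n]
  by (auto simp: rr_gap_def adic_colength_def rr_colength_def)

lemma reduction_gap_nonneg: "0 \<le> reduction_gap n"
  using colength_antimono[OF finite_colength_two_gen[OF rr_ideal pow_subset_rr] rr_ideal two_gen_rr_subset]
  by (simp add: reduction_gap_def rr_colength_def)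

lemma rr_colength_1: "rr_colength 1 = int (colength R J) - reduction_gap 0"
  by (simp add: reduction_gap_def rr_0)

lemma rr_colength_Suc_Suc:
  "rr_colength (Suc (Suc n)) =
    2 * rr_colength (Suc n) - rr_colength n + int (colength R J) - reduction_gap (Suc n)"
  using colength_two_gen[OF syz finite_colength_rr finite_colength_two_gen[OF rr_ideal pow_subset_rr],
      of "Suc n"] colon_rr[of n]
  by (simp add: reduction_gap_def rr_colength_def)

text \<open>The length of \<open>(I\<^bsup>n+1\<^esup> : J) / I\<^sup>n\<close>. By \<open>colength_two_gen\<close> this is how much the second
  difference of the colengths of the powers of \<open>I\<close> exceeds the colength of \<open>J\<close>.\<close>

definition colon_excess :: "nat \<Rightarrow> int" where
  "colon_excess n = adic_colength n - int (colength R (ideal_colon R (ideal_pow R I (Suc n)) J))"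

lemma pow_colon_ideal: "ideal (ideal_colon R (ideal_pow R I n) J) R"
  unfolding ideal_colon_two_gen[OF ideal_pow_ideal[OF I] xy]
  by (intro i_intersect colon_elem_ideal ideal_pow_ideal I xy)

lemma pow_subset_colon: "ideal_pow R I n \<subseteq> ideal_colon R (ideal_pow R I (Suc n)) J"
proof
  fix a assume a: "a \<in> ideal_pow R I n"
  have ac: "a \<in> carrier R" using a ideal_carrier[OF ideal_pow_ideal[OF I]] by auto
  have "a \<otimes> j \<in> ideal_pow R I (Suc n)" if j: "j \<in> J" for j
  proof -
    have "j \<otimes> a \<in> ideal_pow R I (Suc n)"
      using ideal_prod.prod[of j I a "ideal_pow R I n" R] j J_subset a ideal_pow_Suc[OF I, of n] by auto
    then show ?thesis using ac ideal_carrier[OF J_ideal j] by (simp add: m_comm)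
  qed
  then show "a \<in> ideal_colon R (ideal_pow R I (Suc n)) J"
    using ac by (simp add: ideal_colon_def)
qed

lemma colon_excess_nonneg: "0 \<le> colon_excess n"
  using colength_antimono[OF finite_colength_pow pow_colon_ideal pow_subset_colon]
  by (simp add: colon_excess_def adic_colength_def)

lemma adic_colength_Suc_Suc:
  assumes "r \<le> Suc n"
  shows "adic_colength (Suc (Suc n)) =
    2 * adic_colength (Suc n) - adic_colength n + int (colength R J) + colon_excess n"
  using colength_two_gen[OF syz finite_colength_pow
      finite_colength_two_gen[OF ideal_pow_ideal[OF I] order_refl], of "Suc n"] two_gen_pow[OF assms]
  by (simp add: adic_colength_def colon_excess_def)

lemma adic_colength_bound: "2 * adic_colength n \<le> int (colength R J) * (int n * (int n + 1))"
proof -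
  have "2 * colength R (ideal_pow R I n) \<le> 2 * colength R (ideal_pow R J n)"
    using colength_antimono[OF finite_colength_J_pow ideal_pow_ideal[OF I] J_pow_subset] by simp
  also have "\<dots> \<le> colength R J * (n * (n + 1))"
    by (rule colength_ideal_pow_two_gen[OF xy finite_colength_J_pow])
  finally have "int (2 * colength R (ideal_pow R I n)) \<le> int (colength R J * (n * (n + 1)))"
    by (simp only: of_nat_le_iff)
  then show ?thesis by (simp add: adic_colength_def algebra_simps)
qed

text \<open>The quadratic bound makes \<open>colon_excess\<close> vanish for large \<open>n\<close>, that is
  \<open>I\<^bsup>n+1\<^esup> : J = I\<^sup>n\<close>. From there on \<open>a I\<^sup>l \<subseteq> I\<^bsup>n+l\<^esup>\<close> implies \<open>a \<in> I\<^sup>n\<close>, by removing one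
  factor from \<open>J\<close> at a time.\<close>

lemma rr_gap_eventually_zero: "\<exists>N. \<forall>n\<ge>N. rr_gap n = 0"
proof -
  obtain N where N: "\<And>n. N \<le> n \<Longrightarrow> colon_excess n = 0"
    using excess_eventually_zero[OF adic_colength_Suc_Suc colon_excess_nonneg adic_colength_bound]
    by blast
  have colon: "ideal_colon R (ideal_pow R I (Suc n)) J = ideal_pow R I n" if "N \<le> n" for n
    using N[OF that] by (intro colength_eq_imp_eq[OF finite_colength_pow pow_colon_ideal pow_subset_colon])
      (simp add: colon_excess_def adic_colength_def)
  have mem: "a \<in> ideal_pow R I n" if "N \<le> n" "a \<in> carrier R"
    "\<And>b. b \<in> ideal_pow R I l \<Longrightarrow> a \<otimes> b \<in> ideal_pow R I (n + l)" for a n l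
    using that
  proof (induction l arbitrary: a n)
    case 0
    then show ?case using 0(3)[of \<one>] by simp
  next
    case (Suc l)
    have "a \<otimes> j \<in> ideal_pow R I (Suc n)" if j: "j \<in> J" for j
    proof (rule Suc.IH)
      have jI: "j \<in> I" "j \<in> carrier R" using j J_subset ideal_carrier[OF I] by auto
      show "N \<le> Suc n" "a \<otimes> j \<in> carrier R" using Suc.prems jI by auto
      fix b assume b: "b \<in> ideal_pow R I l"
      have "a \<otimes> (j \<otimes> b) \<in> ideal_pow R I (n + Suc l)"
        using Suc.prems(3)[of "j \<otimes> b"] ideal_prod.prod[OF jI(1) b, of R] ideal_pow_Suc[OF I, of l] by simp
      then show "a \<otimes> j \<otimes> b \<in> ideal_pow R I (Suc n + l)"
        using Suc.prems(2) jI ideal_carrier[OF ideal_pow_ideal[OF I] b] by (simp add: m_assoc)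
    qed
    then have "a \<in> ideal_colon R (ideal_pow R I (Suc n)) J"
      using Suc.prems(2) by (simp add: ideal_colon_def)
    then show ?case using colon[OF Suc.prems(1)] by simp
  qed
  have "rr n = ideal_pow R I n" if n: "N \<le> n" for n
  proof
    show "rr n \<subseteq> ideal_pow R I n"
    proof
      fix a assume "a \<in> rr n"
      then obtain l where "a \<in> carrier R"
        "\<And>i b. l \<le> i \<Longrightarrow> b \<in> ideal_pow R I i \<Longrightarrow> a \<otimes> b \<in> ideal_pow R I (n + i)"
        unfolding rr_def by (rule ratliff_rush_closure_powE[OF I]) blast
      then show "a \<in> ideal_pow R I n" using mem[OF n, of a l] by blast
    qed
  qed (rule pow_subset_rr)
  then show ?thesis using rr_gap_eq_0_iff by blast
qed

lemma reduction_gap_eventually_zero: "\<exists>N. \<forall>n\<ge>N. reduction_gap n = 0"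
proof -
  obtain N where N: "\<And>n. N \<le> n \<Longrightarrow> rr n = ideal_pow R I n"
    using rr_gap_eventually_zero rr_gap_eq_0_iff by blast
  have "reduction_gap n = 0" if "max N r \<le> n" for n
    using N[of n] N[of "Suc n"] two_gen_pow[of n] that by (simp add: reduction_gap_def rr_colength_def)
  then show ?thesis by blast
qed

text \<open>The second difference of \<open>rr_gap\<close> is the sum of the two nonnegative terms by which the second
  differences of \<open>adic_colength\<close> and \<open>rr_colength\<close> deviate from the colength of \<open>J\<close>.\<close>

lemma rr_gap_convex:
  assumes "r \<le> Suc n"
  shows "2 * rr_gap (Suc n) \<le> rr_gap (Suc (Suc n)) + rr_gap n"
  using reduction_gap_nonneg[of "Suc n"] colon_excess_nonneg[of n]
  by (simp add: rr_gap_def adic_colength_Suc_Suc[OF assms] rr_colength_Suc_Suc)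

lemma rr_gap_persists:
  assumes "r \<le> Suc n" "rr_gap n = 0" "n \<le> l"
  shows "rr_gap l = 0"
proof -
  obtain N where N: "\<And>n. N \<le> n \<Longrightarrow> rr_gap n = 0" using rr_gap_eventually_zero by blast
  show ?thesis
    by (rule convex_zero_persists[OF rr_gap_convex rr_gap_nonneg N assms])
qed

text \<open>Convexity already holds at index \<open>r - 1\<close>, one before the reduction number. This is what
  produces the summand \<open>-1\<close> in the final bound.\<close>

lemma rr_gap_pos_below_index:
  assumes "r \<le> Suc n" "n < ratliff_rush_index R I"
  shows "1 \<le> rr_gap n"
proof (rule ccontr)
  assume "\<not> 1 \<le> rr_gap n"
  then have "rr_gap n = 0" using rr_gap_nonneg[of n] by simp
  then have "\<forall>l\<ge>n. ratliff_rush_closure R (ideal_pow R I l) = ideal_pow R I l"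
    using rr_gap_persists[OF assms(1)] rr_gap_eq_0_iff by (auto simp: rr_def)
  then have "ratliff_rush_index R I \<le> n"
    unfolding ratliff_rush_index_def by (rule Least_le)
  then show False using assms(2) by simp
qed

end

section \<open>The Hilbert series\<close>

lemma fps_one_minus_X_mult_nth:
  fixes f :: "'a::comm_ring_1 fps"
  shows "fps_nth ((1 - fps_X) * f) n = (if n = 0 then fps_nth f 0 else fps_nth f n - fps_nth f (n - 1))"
  by (simp add: left_diff_distrib)

lemma fps_of_poly_sum_monom:
  fixes f :: "nat \<Rightarrow> int"
  assumes "\<And>i. M \<le> i \<Longrightarrow> f i = 0"
  shows "fps_of_poly (\<Sum>i<M. monom (f i) i) = Abs_fps f"
proof (rule fps_ext)
  fix n
  show "fps_nth (fps_of_poly (\<Sum>i<M. monom (f i) i)) n = fps_nth (Abs_fps f) n"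
    using assms[of n] by (simp add: coeff_sum sum.delta' not_less)
qed

lemma poly_pderiv_sum_monom:
  fixes f :: "nat \<Rightarrow> int"
  defines "V \<equiv> \<lambda>M. \<Sum>i<M. monom (f i) i"
  shows "poly (pderiv (V M)) 1 = (\<Sum>i<M. int i * f i)"
    and "poly (pderiv (pderiv (V M))) 1 = (\<Sum>i<M. int (i - 1) * (int i * f i))"
    and "poly (V M) 1 = (\<Sum>i<M. f i)"
proof -
  have pderiv_sum: "pderiv (\<Sum>i<M. g i) = (\<Sum>i<M. pderiv (g i))" for g :: "nat \<Rightarrow> int poly"
    by (induction M) (simp_all add: pderiv_add)
  show "poly (pderiv (V M)) 1 = (\<Sum>i<M. int i * f i)"
    and "poly (pderiv (pderiv (V M))) 1 = (\<Sum>i<M. int (i - 1) * (int i * f i))"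
    and "poly (V M) 1 = (\<Sum>i<M. f i)"
    by (simp_all add: V_def pderiv_sum pderiv_monom poly_sum poly_monom)
qed

text \<open>For \<open>q = 1 - z\<close>, which vanishes at \<open>1\<close>, the product rule leaves only few terms at \<open>z = 1\<close>.\<close>

lemma poly_pderiv_numerator:
  fixes q V W :: "int poly" and c :: int
  assumes q: "poly q 1 = 0" "pderiv q = [:-1:]"
  defines "h \<equiv> [:c:] - q * V + q ^ 3 * W"
  shows "poly (pderiv (pderiv h)) 1 = 2 * poly (pderiv V) 1"
    and "poly (pderiv (pderiv (pderiv h))) 1 = 3 * poly (pderiv (pderiv V)) 1 - 6 * poly W 1"
  by (simp_all add: h_def q power3_eq_cube pderiv_mult pderiv_add pderiv_diff pderiv_minus pderiv_pCons)

context koszul_reduction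
begin

lemma hilbert_function:
  "int (the_enat (module_length R (quotient_module R (ideal_pow R I n) (ideal_pow R I (n + 1))))) =
    adic_colength (Suc n) - adic_colength n"
proof -
  have sub: "ideal_pow R I (n + 1) \<subseteq> ideal_pow R I n"
    by (rule ideal_pow_antimono[OF I]) simp
  have "module_length R (quotient_module R (ideal_pow R I n) (ideal_pow R I (n + 1))) =
      enat (colength R (ideal_pow R I (n + 1)) - colength R (ideal_pow R I n))"
    using module_length_quotient_module[OF ideal_pow_ideal[OF I] ideal_pow_ideal[OF I] sub]
      interval_length_eq_colength_diff[OF finite_colength_pow ideal_pow_ideal[OF I] sub] by simp
  then show ?thesis
    using colength_antimono[OF finite_colength_pow ideal_pow_ideal[OF I] sub]
    by (simp add: adic_colength_def of_nat_diff)
qed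

text \<open>Let \<open>A\<close> and \<open>W\<close> be the generating series of \<open>rr_colength\<close> and \<open>rr_gap\<close>, shifted by one, and
  \<open>V\<close> that of \<open>reduction_gap\<close>. The Hilbert series is \<open>(1 - z)(A + W)\<close>, and the recursion for
  \<open>rr_colength\<close> says \<open>(1 - z)\<^sup>2 A = \<lambda>(R/J)/(1 - z) - V\<close>.\<close>

lemma hilbert_numerator_eq:
  assumes V: "\<forall>n\<ge>M. reduction_gap n = 0" and W: "\<forall>n\<ge>M. rr_gap n = 0"
  shows "hilbert_numerator R I = [:int (colength R J):]
    - [:1, -1:] * (\<Sum>i<M. monom (reduction_gap i) i)
    + [:1, -1:] ^ 3 * (\<Sum>i<M. monom (rr_gap (Suc i)) i)" (is "_ = ?h")
proof -
  let ?e = "int (colength R J)"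
  define q :: "int fps" where "q = 1 - fps_X"
  define H where "H = Abs_fps (\<lambda>n. int (the_enat (module_length R
       (quotient_module R (ideal_pow R I n) (ideal_pow R I (n + 1))))))"
  define A where "A = Abs_fps (\<lambda>n. rr_colength (Suc n))"
  define Vf where "Vf = Abs_fps reduction_gap"
  define Wf where "Wf = Abs_fps (\<lambda>n. rr_gap (Suc n))"
  have H: "H = q * (A + Wf)"
  proof (rule fps_ext)
    fix n
    have "fps_nth H n = adic_colength (Suc n) - adic_colength n"
      by (simp add: H_def hilbert_function[simplified])
    then show "fps_nth H n = fps_nth (q * (A + Wf)) n"
      unfolding q_def fps_one_minus_X_mult_nth
      by (cases n) (simp_all add: A_def Wf_def rr_gap_def adic_colength_0)
  qed
  have "q * (q * A) = Abs_fps (\<lambda>n. ?e) - Vf"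
  proof (rule fps_ext)
    fix n
    consider "n = 0" | "n = 1" | k where "n = Suc (Suc k)"
      by (cases n) (auto, metis not0_implies_Suc)
    then show "fps_nth (q * (q * A)) n = fps_nth (Abs_fps (\<lambda>n. ?e) - Vf) n"
    proof cases
      case 1
      then show ?thesis
        using rr_colength_1
        unfolding q_def fps_one_minus_X_mult_nth by (simp add: A_def Vf_def)
    next
      case 2
      then show ?thesis
        using rr_colength_Suc_Suc[of 0]
        unfolding q_def fps_one_minus_X_mult_nth by (simp add: A_def Vf_def rr_colength_0)
    next
      case 3
      then show ?thesis
        using rr_colength_Suc_Suc[of "Suc k"]
        unfolding q_def fps_one_minus_X_mult_nth by (simp add: A_def Vf_def)
    qed
  qed
  moreover have "q * Abs_fps (\<lambda>n. ?e) = fps_const ?e"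
    unfolding q_def by (rule fps_ext) (simp add: fps_one_minus_X_mult_nth)
  ultimately have "q * (q * (q * A)) = fps_const ?e - q * Vf"
    by (simp add: right_diff_distrib)
  then have "q\<^sup>2 * H = fps_const ?e - q * Vf + q ^ 3 * Wf"
    unfolding H by (simp add: power2_eq_square power3_eq_cube algebra_simps)
  moreover have "fps_of_poly [:1, -1:] = q"
    by (simp add: q_def fps_of_poly_pCons)
  moreover have "fps_of_poly (\<Sum>i<M. monom (reduction_gap i) i) = Vf"
    unfolding Vf_def by (rule fps_of_poly_sum_monom) (simp add: V)
  moreover have "fps_of_poly (\<Sum>i<M. monom (rr_gap (Suc i)) i) = Wf"
    unfolding Wf_def by (rule fps_of_poly_sum_monom) (simp add: W)
  ultimately have h: "fps_of_poly ?h = q\<^sup>2 * H"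
    by (simp only: fps_of_poly_add fps_of_poly_diff fps_of_poly_mult fps_of_poly_power fps_of_poly_const)
  show ?thesis
    unfolding hilbert_numerator_def
  proof (rule the_equality)
    show "fps_of_poly ?h = (1 - fps_X)\<^sup>2 * Abs_fps (\<lambda>n. int (the_enat (module_length R
       (quotient_module R (ideal_pow R I n) (ideal_pow R I (n + 1))))))"
      using h by (simp only: q_def H_def)
    from this[symmetric] show "p = ?h" if "fps_of_poly p = (1 - fps_X)\<^sup>2 * Abs_fps (\<lambda>n. int (the_enat (module_length R
       (quotient_module R (ideal_pow R I n) (ideal_pow R I (n + 1))))))" for p
      using trans[OF that \<open>_ = fps_of_poly ?h\<close>] by (simp only: fps_of_poly_eq_iff)
  qed
qed

lemma hilbert_coeff_2:
  assumes V: "\<forall>n\<ge>M. reduction_gap n = 0" and W: "\<forall>n\<ge>M. rr_gap n = 0"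
  shows "hilbert_coeff R I 2 = of_int (\<Sum>i<M. int i * reduction_gap i)"
proof -
  have "poly ((pderiv ^^ 2) (hilbert_numerator R I)) 1 = 2 * (\<Sum>i<M. int i * reduction_gap i)"
    unfolding numeral_2_eq_2 funpow.simps o_apply id_apply
    unfolding hilbert_numerator_eq[OF V W]
    by (subst poly_pderiv_numerator(1)) (simp_all add: pderiv_pCons poly_pderiv_sum_monom)
  then show ?thesis by (simp add: hilbert_coeff_def)
qed

lemma hilbert_coeff_3:
  assumes V: "\<forall>n\<ge>M. reduction_gap n = 0" and W: "\<forall>n\<ge>M. rr_gap n = 0"
  shows "2 * hilbert_coeff R I 3 =
    of_int ((\<Sum>i<M. int (i - 1) * (int i * reduction_gap i)) - 2 * (\<Sum>i<M. rr_gap (Suc i)))"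
    (is "_ = of_int (?T - 2 * ?S)")
proof -
  have "poly ((pderiv ^^ 3) (hilbert_numerator R I)) 1 = 3 * ?T - 6 * ?S"
    unfolding numeral_3_eq_3 funpow.simps o_apply id_apply
    unfolding hilbert_numerator_eq[OF V W]
    by (subst poly_pderiv_numerator(2)) (simp_all add: pderiv_pCons poly_pderiv_sum_monom)
  then have "hilbert_coeff R I 3 = of_int (3 * ?T - 6 * ?S) / 6"
    by (simp add: hilbert_coeff_def fact_numeral)
  then show ?thesis by simp
qed

text \<open>The sum of \<open>rr_gap\<close> enters \<open>-e\<^sub>3\<close> and is at least the number \<open>\<rho>(I) - r + 1\<close> of indices from
  \<open>r - 1\<close> to \<open>\<rho>(I) - 1\<close>.\<close>

lemma ratliff_rush_index_le:
  assumes lt: "r < ratliff_rush_index R I"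
  shows "of_nat (ratliff_rush_index R I) \<le>
    of_nat r - 1 + (hilbert_coeff R I 2 - 1) * hilbert_coeff R I 2 - hilbert_coeff R I 3"
proof -
  let ?\<rho> = "ratliff_rush_index R I"
  obtain N1 where N1: "\<And>n. N1 \<le> n \<Longrightarrow> reduction_gap n = 0"
    using reduction_gap_eventually_zero by blast
  obtain N2 where N2: "\<And>n. N2 \<le> n \<Longrightarrow> rr_gap n = 0"
    using rr_gap_eventually_zero by blast
  define M where "M = max ?\<rho> (max N1 N2)"
  have V: "\<forall>n\<ge>M. reduction_gap n = 0" and W: "\<forall>n\<ge>M. rr_gap n = 0"
    using N1 N2 by (auto simp: M_def)
  define e where "e = (\<Sum>i<M. int i * reduction_gap i)"
  define T where "T = (\<Sum>i<M. int (i - 1) * (int i * reduction_gap i))"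
  define S where "S = (\<Sum>i<M. rr_gap (Suc i))"
  \<comment> \<open>Otherwise \<open>r - 1\<close> would be truncated to \<open>0\<close> and the index range would be one too short.\<close>
  have r: "r \<noteq> 0"
  proof
    assume "r = 0"
    then show False using rr_gap_pos_below_index[of 0] lt by (simp add: rr_gap_0)
  qed
  have "int (?\<rho> - r + 1) = (\<Sum>i\<in>{r - 1..<?\<rho>}. 1)"
    using lt r by simp
  also have "\<dots> \<le> (\<Sum>i\<in>{r - 1..<?\<rho>}. rr_gap i)"
    using rr_gap_pos_below_index by (intro sum_mono) auto
  also have "\<dots> \<le> (\<Sum>i<Suc M. rr_gap i)"
    by (intro sum_mono2) (auto simp: M_def rr_gap_nonneg)
  also have "\<dots> = S"
    unfolding S_def by (simp add: sum.lessThan_Suc_shift rr_gap_0 del: sum.lessThan_Suc)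
  finally have S: "int ?\<rho> - int r + 1 \<le> S" using lt by simp
  have "0 \<le> T"
    unfolding T_def by (intro sum_nonneg mult_nonneg_nonneg reduction_gap_nonneg) auto
  moreover have "T \<le> (e - 1) * e"
    unfolding T_def by (rule sum_choose_two_le[OF reduction_gap_nonneg e_def])
  moreover have "2 * (s + 1) \<le> 2 * p - (T - 2 * S)" if "0 \<le> T" "T \<le> p" "s + 1 \<le> S" for p s :: int
    using that by presburger
  ultimately have "2 * (int ?\<rho> - int r + 1) \<le> 2 * ((e - 1) * e) - (T - 2 * S)"
    using S by blast
  then have "of_int (2 * (int ?\<rho> - int r + 1)) \<le> (of_int (2 * ((e - 1) * e) - (T - 2 * S)) :: rat)"
    by (simp only: of_int_le_iff)
  moreover have "hilbert_coeff R I 2 = of_int e"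
    unfolding e_def by (rule hilbert_coeff_2[OF V W])
  moreover have "2 * hilbert_coeff R I 3 = of_int (T - 2 * S)"
    unfolding T_def S_def by (rule hilbert_coeff_3[OF V W])
  ultimately show ?thesis by (simp add: algebra_simps)
qed

end

text \<open>A power of \<open>m\<close> lies in \<open>I\<close>, hence one lies in \<open>J\<close> because \<open>I\<^bsup>r+1\<^esup> = JI\<^sup>r \<subseteq> J\<close>; so the
  results on two generators and on their relations apply to \<open>J\<close>.\<close>

theorem proposition1p2:
  fixes R :: "('a, 'b) ring_scheme" and m I J :: "'a set"
  assumes "cohen_macaulay_local_ring R m"
    and "krull_dim R = 2"
    and "infinite (carrier (R Quot m))"
    and "is_primary_to R m I"
    and "is_minimal_reduction R J I"
    and "reduction_number R J I < ratliff_rush_index R I"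
  shows "of_nat (ratliff_rush_index R I) \<le>
    of_nat (reduction_number R J I) - 1
      + (hilbert_coeff R I 2 - 1) * hilbert_coeff R I 2 - hilbert_coeff R I 3"
proof -
  interpret cohen_macaulay_local_ring R m by fact
  obtain a b where ab: "a \<in> m" "b \<in> m" "regular_pair R a b"
    using obtain_regular_pair[OF assms(2)] by blast
  obtain l where l: "ideal_pow R m l \<subseteq> two_gen R a b (carrier R)"
    using regular_pair_m_primary[OF _ ab(3,1,2)] assms(2) by auto
  have I: "ideal I R" "I \<noteq> carrier R" and rad: "ideal_radical R I = m"
    using assms(4) by (auto simp: is_primary_to_def primary_ideal_def)
  have Im: "I \<subseteq> m" by (rule proper_ideal_subset_m[OF I])
  obtain s where s: "ideal_pow R m s \<subseteq> I"
    using m_pow_subset_if_radical[OF I(1)] rad by (auto simp: ideal_radical_def)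
  have J: "ideal J R" "J \<subseteq> I" and ex: "\<exists>n. J \<cdot>\<^bsub>R\<^esub> ideal_pow R I n = ideal_pow R I (n + 1)"
    using assms(5) by (auto simp: is_minimal_reduction_def is_reduction_def)
  have red: "J \<cdot>\<^bsub>R\<^esub> ideal_pow R I (reduction_number R J I) = ideal_pow R I (reduction_number R J I + 1)"
    using LeastI_ex[OF ex] by (simp only: reduction_number_def)
  define k where "k = s * (reduction_number R J I + 1)"
  have "ideal_pow R m k \<subseteq> ideal_pow R I (reduction_number R J I + 1)"
    using ideal_pow_mono[OF ideal_pow_ideal[OF m_ideal] I(1) s, of "reduction_number R J I + 1"]
    by (simp only: k_def ideal_pow_pow[OF m_ideal])
  also have "\<dots> \<subseteq> J"
    unfolding red[symmetric] by (rule ideal_prod_subset(1)[OF J(1) ideal_pow_ideal[OF I(1)]])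
  finally have k: "ideal_pow R m k \<subseteq> J" .
  obtain x y where xy: "x \<in> carrier R" "y \<in> carrier R" "J = two_gen R x y (carrier R)"
    using minimal_reduction_two_gen[OF assms(3) I(1) Im assms(5) k ab(1,2) l] by blast
  have syz: "koszul_syzygies R x y"
    using koszul_syzygies_if_m_primary[OF ab(3,1,2) xy(1,2)] k xy(3) by blast
  have "koszul_reduction_axioms R m I x y (reduction_number R J I) k"
    using I(1) syz J(2) red k unfolding koszul_reduction_axioms_def xy(3)[symmetric] by simp
  then interpret koszul_reduction R m I x y "reduction_number R J I" k
    by (intro koszul_reduction.intro noetherian_local_ring_axioms)
  show ?thesis by (rule ratliff_rush_index_le[OF assms(6)])
qed

end
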